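(* Let $k\ge1$, $m\ge1$, let $1\le t_1,\dots,t_m\le k$ be distinct integers, $a_1,\dots,a_m$ positive integers, $P=R_{t_1}^{a_1}\cup\cdots\cup R_{t_m}^{a_m}$ and $Q=R_{t_1}\cup\cdots\cup R_{t_m}$. Then for every $\lambda\in\mathcal P^k$, $$\frac{g^{(k)}_{P\cup\lambda}}{g^{(k)}_P}=\frac{g^{(k)}_{Q\cup\lambda}}{g^{(k)}_Q}.$$
   Context: Partitions are identified with Young diagrams in French notation (cells $(i,j)$ with $j\le\lambda_i$, row $i$ from the bottom); $\lambda'$ is the conjugate; $\lambda\cup\mu$ is the partition whose multiset of parts is the union of those of $\lambda$ and $\mu$. $\mathcal P^k$ is the set of partitions with $\lambda_1\le k$. For $1\le t\le k$, $R_t=(t^{k+1-t})$ and $R_t^a$ is the union of $a$ copies of $R_t$. The hook length of $c=(i,j)\in\lambda$ is $\lambda_i+\lambda'_j-i-j+1$. A $(k+1)$-core has no cell of hook length $k+1$; $|\kappa|_{k+1}$ is its number of cells of hook length $<k+1$. The map $\mathfrak p(\kappa)_i=\#\{j:(i,j)\in\kappa,\ \text{hook length}\le k\}$ is a bijection from $(k+1)$-cores to $\mathcal P^k$ with inverse $\mathfrak c$. The residue of $(i,j)$ is $j-i\bmod(k+1)$. For $(k+1)$-cores $\tau\subset\kappa$, $\kappa/\tau$ is a weak $r$-strip if it is a horizontal strip, $|\kappa|_{k+1}=|\tau|_{k+1}+r$, and its cells have exactly $r$ distinct residues. A removable corner of $\mu$ is $(i,j)\in\mu$ with $(i+1,j),(i,j+1)\notin\mu$;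 $(i,j)$ is $\lambda$-blocked if $(i+1,j)\in\lambda$; $r_{\lambda\mu}$ is the number of distinct residues of non-$\lambda$-blocked removable corners of $\mu$. $h_r$ are the complete homogeneous symmetric functions ($h_0=1$), $\Lambda^{(k)}=\mathbb Z[h_1,\dots,h_k]$; $\binom ab=0$ for $b<0$. The $K$-$k$-Schur functions $\{g^{(k)}_\lambda\}_{\lambda\in\mathcal P^k}$ are the unique elements of $\Lambda^{(k)}$ with $g^{(k)}_\emptyset=1$ and, for $\lambda\in\mathcal P^k$, $0\le r\le k$, $$h_r\,g^{(k)}_\lambda=\sum_{s=0}^{r}(-1)^{r-s}\sum_{\mu\in\mathcal P^k:\ \mathfrak c(\mu)/\mathfrak c(\lambda)\text{ weak }s\text{-strip}}\binom{r_{\mathfrak c(\mu)\mathfrak c(\lambda)}}{r-s}g^{(k)}_\mu .$$ Quotients are taken in the fraction field of $\Lambda^{(k)}$ (they lie in $\Lambda^{(k)}$). *)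

theory Defs
  imports
    "HOL-Library.Multiset"
    "HOL-Library.Poly_Mapping"
    "HOL-Computational_Algebra.Fraction_Field"
begin

section \<open>The ring of symmetric functions\<close>

text \<open>A monomial in the variables $x_0, x_1, \ldots$ is its exponent vector
  \<open>m :: nat \<Rightarrow>\<^sub>0 nat\<close>; a symmetric function with integer coefficients is a formal series
  of bounded degree whose coefficients are invariant under permutations of the variables.\<close>

definition mdeg :: "(nat \<Rightarrow>\<^sub>0 nat) \<Rightarrow> nat" where
  "mdeg m = (\<Sum>i\<in>Poly_Mapping.keys m. Poly_Mapping.lookup m i)"

lemma mdeg_superset:
  assumes "finite A" "Poly_Mapping.keys m \<subseteq> A"
  shows "mdeg m = (\<Sum>i\<in>A. Poly_Mapping.lookup m i)"
  unfolding mdeg_def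
  by (rule sum.mono_neutral_left) (use assms in \<open>auto simp: in_keys_iff\<close>)

lemma keys_add_nat:
  "Poly_Mapping.keys (a + b) = Poly_Mapping.keys a \<union> Poly_Mapping.keys (b :: nat \<Rightarrow>\<^sub>0 nat)"
  by (auto simp: in_keys_iff lookup_add)

lemma mdeg_add: "mdeg (a + b) = mdeg a + mdeg b"
proof -
  let ?A = "Poly_Mapping.keys a \<union> Poly_Mapping.keys b"
  have "mdeg (a + b) = (\<Sum>i\<in>?A. Poly_Mapping.lookup (a + b) i)"
    by (rule mdeg_superset) (auto simp: keys_add_nat)
  also have "\<dots> = (\<Sum>i\<in>?A. Poly_Mapping.lookup a i) + (\<Sum>i\<in>?A. Poly_Mapping.lookup b i)"
    by (simp add: lookup_add sum.distrib)
  also have "\<dots> = mdeg a + mdeg b"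
    by (simp add: mdeg_superset[of ?A a] mdeg_superset[of ?A b])
  finally show ?thesis .
qed

lemma mdeg_map_key:
  assumes "bij \<pi>"
  shows "mdeg (Poly_Mapping.map_key \<pi> m) = mdeg m"
proof -
  have inj: "inj \<pi>" using assms by (rule bij_is_inj)
  have "mdeg (Poly_Mapping.map_key \<pi> m) = (\<Sum>i\<in>\<pi> -` Poly_Mapping.keys m. Poly_Mapping.lookup m (\<pi> i))"
    by (simp add: mdeg_def keys_map_key[OF inj] map_key.rep_eq[OF inj])
  also have "\<dots> = (\<Sum>i\<in>\<pi> ` (\<pi> -` Poly_Mapping.keys m). Poly_Mapping.lookup m i)"
    by (subst sum.reindex) (use inj in \<open>auto intro: inj_on_subset\<close>)
  also have "\<pi> ` (\<pi> -` Poly_Mapping.keys m) = Poly_Mapping.keys m"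
    using assms by (simp add: bij_is_surj surj_image_vimage_eq)
  finally show ?thesis by (simp add: mdeg_def)
qed

lemma finite_bounded_exponents:
  assumes "finite A"
  shows "finite {m :: nat \<Rightarrow>\<^sub>0 nat. Poly_Mapping.keys m \<subseteq> A \<and> (\<forall>i. Poly_Mapping.lookup m i \<le> d)}"
    (is "finite ?S")
proof (rule inj_on_finite)
  show "inj_on Poly_Mapping.lookup ?S" by (auto intro: inj_onI)
  show "Poly_Mapping.lookup ` ?S \<subseteq> {f. \<forall>i. (i \<in> A \<longrightarrow> f i \<in> {..d}) \<and> (i \<notin> A \<longrightarrow> f i = 0)}"
    by (auto simp: in_keys_iff)
  show "finite {f :: nat \<Rightarrow> nat. \<forall>i. (i \<in> A \<longrightarrow> f i \<in> {..d}) \<and> (i \<notin> A \<longrightarrow> f i = 0)}"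
    by (rule finite_set_of_finite_funs) (use assms in auto)
qed

lemma lookup_le_mdeg: "Poly_Mapping.lookup m i \<le> mdeg m"
  by (cases "i \<in> Poly_Mapping.keys m") (auto simp: mdeg_def in_keys_iff intro: member_le_sum)

definition splits :: "(nat \<Rightarrow>\<^sub>0 nat) \<Rightarrow> ((nat \<Rightarrow>\<^sub>0 nat) \<times> (nat \<Rightarrow>\<^sub>0 nat)) set" where
  "splits m = {(a, b). a + b = m}"

lemma finite_splits [simp]: "finite (splits m)"
proof -
  let ?S = "{a. Poly_Mapping.keys a \<subseteq> Poly_Mapping.keys m \<and> (\<forall>i. Poly_Mapping.lookup a i \<le> mdeg m)}"
  have "a \<in> ?S \<and> b \<in> ?S" if "a + b = m" for a b
  proof -
    have "Poly_Mapping.lookup a i \<le> mdeg m \<and> Poly_Mapping.lookup b i \<le> mdeg m" for i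
      using lookup_le_mdeg[of a i] lookup_le_mdeg[of b i] mdeg_add[of a b] that by auto
    moreover have "Poly_Mapping.keys a \<union> Poly_Mapping.keys b = Poly_Mapping.keys m"
      using that keys_add_nat by metis
    ultimately show ?thesis by auto
  qed
  then have "splits m \<subseteq> ?S \<times> ?S" unfolding splits_def by blast
  then show ?thesis
    by (rule finite_subset) (intro finite_cartesian_product finite_bounded_exponents finite_keys)
qed

typedef symfun =
  "{f :: (nat \<Rightarrow>\<^sub>0 nat) \<Rightarrow> int.
      (\<exists>d. \<forall>m. f m \<noteq> 0 \<longrightarrow> mdeg m \<le> d) \<and>
      (\<forall>\<pi> m. bij \<pi> \<longrightarrow> f (Poly_Mapping.map_key \<pi> m) = f m)}"
  morphisms sym_coeff Abs_symfun
  by (rule exI[of _ "\<lambda>_. 0"]) simp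

setup_lifting type_definition_symfun

lemma sum_splits_map_key:
  assumes "bij \<pi>"
  shows "(\<Sum>(a, b)\<in>splits (Poly_Mapping.map_key \<pi> m). F a b) =
    (\<Sum>(a, b)\<in>splits m. F (Poly_Mapping.map_key \<pi> a) (Poly_Mapping.map_key \<pi> b))"
proof -
  let ?\<rho> = "inv \<pi>"
  have inj: "inj \<pi>" and inj': "inj ?\<rho>"
    using assms by (auto simp: bij_is_inj bij_imp_bij_inv)
  have 1: "Poly_Mapping.map_key ?\<rho> (Poly_Mapping.map_key \<pi> x) = x" for x :: "nat \<Rightarrow>\<^sub>0 nat"
    by (rule poly_mapping_eqI)
       (simp add: map_key.rep_eq[OF inj] map_key.rep_eq[OF inj'] surj_f_inv_f[OF bij_is_surj[OF assms]])
  have 2: "Poly_Mapping.map_key \<pi> (Poly_Mapping.map_key ?\<rho> x) = x" for x :: "nat \<Rightarrow>\<^sub>0 nat"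
    by (rule poly_mapping_eqI)
       (simp add: map_key.rep_eq[OF inj] map_key.rep_eq[OF inj'] inv_f_f[OF inj])
  show ?thesis
    by (rule sum.reindex_bij_witness[where
          j = "\<lambda>(a, b). (Poly_Mapping.map_key ?\<rho> a, Poly_Mapping.map_key ?\<rho> b)" and
          i = "\<lambda>(a, b). (Poly_Mapping.map_key \<pi> a, Poly_Mapping.map_key \<pi> b)"])
       (auto simp: splits_def 1 2 map_key_plus[OF inj, symmetric] map_key_plus[OF inj', symmetric])
qed

instantiation symfun :: comm_ring_1
begin

lift_definition zero_symfun :: symfun is "\<lambda>_. 0" by simp

lift_definition one_symfun :: symfun is "\<lambda>m. if m = 0 then 1 else 0"
proof (intro conjI exI allI impI)
  fix \<pi> :: "nat \<Rightarrow> nat" and m :: "nat \<Rightarrow>\<^sub>0 nat"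
  assume "bij \<pi>"
  then have *: "inj \<pi>" "surj \<pi>" by (auto simp: bij_def)
  have "Poly_Mapping.keys (Poly_Mapping.map_key \<pi> m) = {} \<longleftrightarrow> Poly_Mapping.keys m = {}"
    unfolding keys_map_key[OF *(1)] using surj_image_vimage_eq[OF *(2), of "Poly_Mapping.keys m"]
    by (metis image_empty vimage_empty)
  then show "(if Poly_Mapping.map_key \<pi> m = 0 then 1 else 0) = (if m = 0 then 1 else (0::int))"
    by simp
qed (auto split: if_splits)

lift_definition plus_symfun :: "symfun \<Rightarrow> symfun \<Rightarrow> symfun" is "\<lambda>f g m. f m + g m"
proof (elim conjE exE, intro conjI exI allI impI)
  fix f g :: "(nat \<Rightarrow>\<^sub>0 nat) \<Rightarrow> int" and m d e
  assume "\<forall>m. f m \<noteq> 0 \<longrightarrow> mdeg m \<le> d" "\<forall>m. g m \<noteq> 0 \<longrightarrow> mdeg m \<le> e" "f m + g m \<noteq> 0"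
  then show "mdeg m \<le> max d e" by (metis add.right_neutral le_max_iff_disj)
qed auto

lift_definition uminus_symfun :: "symfun \<Rightarrow> symfun" is "\<lambda>f m. - f m" by simp

lift_definition minus_symfun :: "symfun \<Rightarrow> symfun \<Rightarrow> symfun" is "\<lambda>f g m. f m - g m"
proof (elim conjE exE, intro conjI exI allI impI)
  fix f g :: "(nat \<Rightarrow>\<^sub>0 nat) \<Rightarrow> int" and m d e
  assume "\<forall>m. f m \<noteq> 0 \<longrightarrow> mdeg m \<le> d" "\<forall>m. g m \<noteq> 0 \<longrightarrow> mdeg m \<le> e" "f m - g m \<noteq> 0"
  then show "mdeg m \<le> max d e" by (metis diff_self le_max_iff_disj)
qed auto

lift_definition times_symfun :: "symfun \<Rightarrow> symfun \<Rightarrow> symfun"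
  is "\<lambda>f g m. \<Sum>(a, b)\<in>splits m. f a * g b"
proof (elim conjE exE, intro conjI exI allI impI)
  fix f g :: "(nat \<Rightarrow>\<^sub>0 nat) \<Rightarrow> int" and m d e
  assume f: "\<forall>m. f m \<noteq> 0 \<longrightarrow> mdeg m \<le> d" and g: "\<forall>m. g m \<noteq> 0 \<longrightarrow> mdeg m \<le> e"
    and "(\<Sum>(a, b)\<in>splits m. f a * g b) \<noteq> 0"
  then obtain x where "x \<in> splits m" "(case x of (a, b) \<Rightarrow> f a * g b) \<noteq> 0"
    by (metis (no_types, lifting) sum.neutral)
  then obtain a b where "a + b = m" "f a * g b \<noteq> 0" by (auto simp: splits_def)
  then have "mdeg a \<le> d" "mdeg b \<le> e" using f g by auto
  then show "mdeg m \<le> d + e" using \<open>a + b = m\<close> mdeg_add[of a b] by simp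
next
  fix f g :: "(nat \<Rightarrow>\<^sub>0 nat) \<Rightarrow> int" and \<pi> :: "nat \<Rightarrow> nat" and m
  assume "\<forall>\<pi> m. bij \<pi> \<longrightarrow> f (Poly_Mapping.map_key \<pi> m) = f m"
    "\<forall>\<pi> m. bij \<pi> \<longrightarrow> g (Poly_Mapping.map_key \<pi> m) = g m" "bij \<pi>"
  then show "(\<Sum>(a, b)\<in>splits (Poly_Mapping.map_key \<pi> m). f a * g b) = (\<Sum>(a, b)\<in>splits m. f a * g b)"
    by (simp add: sum_splits_map_key)
qed

instance
proof
  fix f g h :: symfun
  show "f * g * h = f * (g * h)"
  proof transfer
    fix f g h :: "(nat \<Rightarrow>\<^sub>0 nat) \<Rightarrow> int"
    show "(\<lambda>m. \<Sum>(a, b)\<in>splits m. (\<Sum>(a, b)\<in>splits a. f a * g b) * h b) =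
          (\<lambda>m. \<Sum>(a, b)\<in>splits m. f a * (\<Sum>(a, b)\<in>splits b. g a * h b))"
    proof
      fix m
      have "(\<Sum>(a, b)\<in>splits m. (\<Sum>(a, b)\<in>splits a. f a * g b) * h b) =
          (\<Sum>(x, y)\<in>(SIGMA x:splits m. splits (fst x)). f (fst y) * g (snd y) * h (snd x))"
        by (simp add: sum.Sigma sum_distrib_right case_prod_unfold)
      also have "\<dots> = (\<Sum>(x, y)\<in>(SIGMA x:splits m. splits (snd x)). f (fst x) * (g (fst y) * h (snd y)))"
        by (rule sum.reindex_bij_witness[where
              j = "\<lambda>((a, b), (c, d)). ((c, d + b), (d, b))" and
              i = "\<lambda>((a, b), (c, d)). ((a + c, d), (a, c))"])
           (auto simp: splits_def algebra_simps)
      also have "\<dots> = (\<Sum>(a, b)\<in>splits m. f a * (\<Sum>(a, b)\<in>splits b. g a * h b))"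
        by (simp add: sum.Sigma sum_distrib_left case_prod_unfold)
      finally show "(\<Sum>(a, b)\<in>splits m. (\<Sum>(a, b)\<in>splits a. f a * g b) * h b) =
          (\<Sum>(a, b)\<in>splits m. f a * (\<Sum>(a, b)\<in>splits b. g a * h b))" .
    qed
  qed
  show "f * g = g * f"
  proof transfer
    fix f g :: "(nat \<Rightarrow>\<^sub>0 nat) \<Rightarrow> int"
    show "(\<lambda>m. \<Sum>(a, b)\<in>splits m. f a * g b) = (\<lambda>m. \<Sum>(a, b)\<in>splits m. g a * f b)"
      by (rule ext, rule sum.reindex_bij_witness[where
            j = "\<lambda>(a, b). (b, a)" and i = "\<lambda>(a, b). (b, a)"])
         (auto simp: splits_def algebra_simps)
  qed
  show "1 * f = f"
  proof transfer
    fix f :: "(nat \<Rightarrow>\<^sub>0 nat) \<Rightarrow> int"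
    show "(\<lambda>m. \<Sum>(a, b)\<in>splits m. (if a = 0 then 1 else 0) * f b) = f"
    proof
      fix m
      have "(\<Sum>(a, b)\<in>splits m. (if a = 0 then 1 else 0) * f b) =
          (\<Sum>(a, b)\<in>{(0 :: nat \<Rightarrow>\<^sub>0 nat, m)}. (if a = 0 then 1 else 0) * f b)"
        by (rule sum.mono_neutral_right[OF finite_splits])
           (auto simp: splits_def split: if_splits)
      then show "(\<Sum>(a, b)\<in>splits m. (if a = 0 then 1 else 0) * f b) = f m" by simp
    qed
  qed
  show "(f + g) * h = f * h + g * h"
    by transfer (simp add: distrib_right sum.distrib case_prod_unfold)
  show "f + g + h = f + (g + h)" by transfer (simp add: add.assoc)
  show "f + g = g + f" by transfer (simp add: add.commute)
  show "0 + f = f" by transfer simp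
  show "- f + f = 0" by transfer simp
  show "f - g = f + - g" by transfer simp
  show "(0 :: symfun) \<noteq> 1" by transfer (auto simp: fun_eq_iff)
qed

end

text \<open>There are no zero divisors: compare the lowest-degree parts in finitely many variables, which
  are honest polynomials.\<close>

lemma lookup_mult_splits:
  fixes p q :: "(nat \<Rightarrow>\<^sub>0 nat) \<Rightarrow>\<^sub>0 int"
  shows "Poly_Mapping.lookup (p * q) m =
    (\<Sum>(a, b)\<in>splits m. Poly_Mapping.lookup p a * Poly_Mapping.lookup q b)"
proof -
  have "Poly_Mapping.lookup (p * q) m =
      (\<Sum>(a, b). Poly_Mapping.lookup p a * Poly_Mapping.lookup q b when m = a + b)"
    by (simp add: times_poly_mapping.rep_eq prod_fun_unfold_prod)
  also have "\<dots> = (\<Sum>(a, b)\<in>splits m. Poly_Mapping.lookup p a * Poly_Mapping.lookup q b when m = a + b)"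
    by (rule Sum_any.expand_superset[OF finite_splits])
       (auto simp: splits_def when_def split: if_splits)
  also have "\<dots> = (\<Sum>(a, b)\<in>splits m. Poly_Mapping.lookup p a * Poly_Mapping.lookup q b)"
    by (rule sum.cong) (auto simp: splits_def)
  finally show ?thesis .
qed

lemma finite_monomials: "finite {m. Poly_Mapping.keys m \<subseteq> {..<n} \<and> mdeg m = d}"
  by (rule finite_subset[OF _ finite_bounded_exponents[of "{..<n}" d]])
     (use lookup_le_mdeg in auto)

lemma truncation_exists:
  obtains p :: "(nat \<Rightarrow>\<^sub>0 nat) \<Rightarrow>\<^sub>0 int" where
    "\<And>m. Poly_Mapping.lookup p m =
      (if Poly_Mapping.keys m \<subseteq> {..<n} \<and> mdeg m = d then f m else 0)"
proof
  let ?F = "\<lambda>m. if Poly_Mapping.keys m \<subseteq> {..<n} \<and> mdeg m = d then f m else 0"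
  have "finite {m. ?F m \<noteq> 0}"
    by (rule finite_subset[OF _ finite_monomials[of n d]]) auto
  then show "Poly_Mapping.lookup (Abs_poly_mapping ?F) m = ?F m" for m by simp
qed

lemma symfun_lowest:
  assumes "f \<noteq> 0"
  obtains m where "sym_coeff f m \<noteq> 0" "\<And>m'. sym_coeff f m' \<noteq> 0 \<Longrightarrow> mdeg m \<le> mdeg m'"
proof -
  have "\<exists>m. sym_coeff f m \<noteq> 0" using assms by transfer auto
  then show ?thesis
    using that ex_has_least_nat[of "\<lambda>m. sym_coeff f m \<noteq> 0" _ mdeg] by metis
qed

instance symfun :: idom
proof
  fix f g :: symfun
  assume "f \<noteq> 0" "g \<noteq> 0"
  obtain u where u: "sym_coeff f u \<noteq> 0" "\<And>m. sym_coeff f m \<noteq> 0 \<Longrightarrow> mdeg u \<le> mdeg m"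
    using symfun_lowest[OF \<open>f \<noteq> 0\<close>] by blast
  obtain v where v: "sym_coeff g v \<noteq> 0" "\<And>m. sym_coeff g m \<noteq> 0 \<Longrightarrow> mdeg v \<le> mdeg m"
    using symfun_lowest[OF \<open>g \<noteq> 0\<close>] by blast
  have "finite (Poly_Mapping.keys u \<union> Poly_Mapping.keys v)" by simp
  then obtain n where n: "Poly_Mapping.keys u \<union> Poly_Mapping.keys v \<subseteq> {..<n}"
    using finite_nat_set_iff_bounded by (metis lessThan_iff subsetI)
  obtain p where p: "\<And>m. Poly_Mapping.lookup p m =
      (if Poly_Mapping.keys m \<subseteq> {..<n} \<and> mdeg m = mdeg u then sym_coeff f m else 0)"
    using truncation_exists by metis
  obtain q where q: "\<And>m. Poly_Mapping.lookup q m =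
      (if Poly_Mapping.keys m \<subseteq> {..<n} \<and> mdeg m = mdeg v then sym_coeff g m else 0)"
    using truncation_exists by metis
  have "p \<noteq> 0" using p[of u] u(1) n by auto
  moreover have "q \<noteq> 0" using q[of v] v(1) n by auto
  ultimately have "p * q \<noteq> 0" by simp
  then obtain m where m: "Poly_Mapping.lookup (p * q) m \<noteq> 0"
    by (metis poly_mapping_eqI lookup_zero)
  then obtain x where "x \<in> splits m"
      "(case x of (a, b) \<Rightarrow> Poly_Mapping.lookup p a * Poly_Mapping.lookup q b) \<noteq> 0"
    unfolding lookup_mult_splits by (metis (no_types, lifting) sum.neutral)
  then obtain a b where ab: "a + b = m" "Poly_Mapping.lookup p a \<noteq> 0" "Poly_Mapping.lookup q b \<noteq> 0"
    by (auto simp: splits_def)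
  have km: "Poly_Mapping.keys m \<subseteq> {..<n}"
    using ab p[of a] q[of b] keys_add_nat[of a b] by (auto split: if_splits)
  have dm: "mdeg m = mdeg u + mdeg v"
    using ab p[of a] q[of b] mdeg_add[of a b] by (auto split: if_splits)
  have "Poly_Mapping.lookup (p * q) m = (\<Sum>(a, b)\<in>splits m. sym_coeff f a * sym_coeff g b)"
    unfolding lookup_mult_splits
  proof (rule sum.cong[OF refl], clarify)
    fix c d assume "(c, d) \<in> splits m"
    then have cd: "c + d = m" by (simp add: splits_def)
    have k: "Poly_Mapping.keys c \<subseteq> {..<n}" "Poly_Mapping.keys d \<subseteq> {..<n}"
      using km keys_add_nat[of c d] cd by auto
    have "mdeg c + mdeg d = mdeg u + mdeg v" using cd dm mdeg_add[of c d] by simp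
    then show "Poly_Mapping.lookup p c * Poly_Mapping.lookup q d = sym_coeff f c * sym_coeff g d"
      using u(2)[of c] v(2)[of d] k
      by (cases "sym_coeff f c = 0"; cases "sym_coeff g d = 0") (auto simp: p q)
  qed
  then have "sym_coeff (f * g) m \<noteq> 0" using m by (simp add: times_symfun.rep_eq)
  then show "f * g \<noteq> 0" by (auto simp: zero_symfun.rep_eq)
qed

lift_definition hsym :: "nat \<Rightarrow> symfun" is "\<lambda>r m. if mdeg m = r then 1 else 0"
  by (auto simp: mdeg_map_key)

text \<open>The subring of symmetric functions generated by $h_1, \ldots, h_k$.\<close>

inductive_set Lambda_k :: "nat \<Rightarrow> symfun set" for k :: nat where
  one: "1 \<in> Lambda_k k"
| gen: "1 \<le> r \<Longrightarrow> r \<le> k \<Longrightarrow> hsym r \<in> Lambda_k k"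
| diff: "x \<in> Lambda_k k \<Longrightarrow> y \<in> Lambda_k k \<Longrightarrow> x - y \<in> Lambda_k k"
| mult: "x \<in> Lambda_k k \<Longrightarrow> y \<in> Lambda_k k \<Longrightarrow> x * y \<in> Lambda_k k"


section \<open>Partitions and cores\<close>

text \<open>A partition is the multiset of its (positive) parts, so that \<open>\<nu> \<union> \<mu>\<close> is the multiset
  sum \<open>\<nu> + \<mu>\<close>, and an \<open>a\<close>-fold union is \<open>repeat_mset a\<close>. Rows, columns and parts are
  numbered from 1.\<close>

definition is_partition :: "nat multiset \<Rightarrow> bool" where
  "is_partition \<nu> \<longleftrightarrow> 0 \<notin># \<nu>"

definition part :: "nat multiset \<Rightarrow> nat \<Rightarrow> nat" where
  "part \<nu> i = (if 1 \<le> i \<and> i \<le> size \<nu> then rev (sorted_list_of_multiset \<nu>) ! (i - 1) else 0)"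

definition diagram :: "nat multiset \<Rightarrow> (nat \<times> nat) set" where
  "diagram \<nu> = {(i, j). 1 \<le> i \<and> 1 \<le> j \<and> j \<le> part \<nu> i}"

definition conj_part :: "nat multiset \<Rightarrow> nat \<Rightarrow> nat" where
  "conj_part \<nu> j = card {i. (i, j) \<in> diagram \<nu>}"

definition k_bounded :: "nat \<Rightarrow> nat multiset set" where
  "k_bounded k = {\<nu>. is_partition \<nu> \<and> part \<nu> 1 \<le> k}"

definition rect :: "nat \<Rightarrow> nat \<Rightarrow> nat multiset" where
  "rect k t = replicate_mset (k + 1 - t) t"

fun hook :: "nat multiset \<Rightarrow> nat \<times> nat \<Rightarrow> nat" where
  "hook \<nu> (i, j) = part \<nu> i + conj_part \<nu> j + 1 - i - j"

definition cores :: "nat \<Rightarrow> nat multiset set" where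
  "cores k = {\<kappa>. is_partition \<kappa> \<and> (\<forall>c\<in>diagram \<kappa>. hook \<kappa> c \<noteq> k + 1)}"

definition core_size :: "nat \<Rightarrow> nat multiset \<Rightarrow> nat" where
  "core_size k \<kappa> = card {c \<in> diagram \<kappa>. hook \<kappa> c < k + 1}"

text \<open>For a $(k+1)$-core the row counts below are positive and weakly decreasing in the row index,
  so the \<open>i\<close>-th part of \<open>core_to_bounded k \<kappa>\<close> is the count of row \<open>i\<close>.\<close>

definition core_to_bounded :: "nat \<Rightarrow> nat multiset \<Rightarrow> nat multiset" where
  "core_to_bounded k \<kappa> =
    image_mset (\<lambda>i. card {j. (i, j) \<in> diagram \<kappa> \<and> hook \<kappa> (i, j) \<le> k}) (mset_set {1..size \<kappa>})"

definition bounded_to_core :: "nat \<Rightarrow> nat multiset \<Rightarrow> nat multiset" where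
  "bounded_to_core k = inv_into (cores k) (core_to_bounded k)"

fun residue :: "nat \<Rightarrow> nat \<times> nat \<Rightarrow> int" where
  "residue k (i, j) = (int j - int i) mod (int k + 1)"

definition horizontal_strip :: "nat multiset \<Rightarrow> nat multiset \<Rightarrow> bool" where
  "horizontal_strip \<kappa> \<tau> \<longleftrightarrow>
    diagram \<tau> \<subseteq> diagram \<kappa> \<and> inj_on snd (diagram \<kappa> - diagram \<tau>)"

definition weak_strip :: "nat \<Rightarrow> nat \<Rightarrow> nat multiset \<Rightarrow> nat multiset \<Rightarrow> bool" where
  "weak_strip k r \<kappa> \<tau> \<longleftrightarrow>
    \<kappa> \<in> cores k \<and> \<tau> \<in> cores k \<and> horizontal_strip \<kappa> \<tau> \<and>
    core_size k \<kappa> = core_size k \<tau> + r \<and>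
    card (residue k ` (diagram \<kappa> - diagram \<tau>)) = r"

definition removable_corners :: "nat multiset \<Rightarrow> (nat \<times> nat) set" where
  "removable_corners \<mu> =
    {(i, j). (i, j) \<in> diagram \<mu> \<and> (i + 1, j) \<notin> diagram \<mu> \<and> (i, j + 1) \<notin> diagram \<mu>}"

definition blocked :: "nat multiset \<Rightarrow> nat \<times> nat \<Rightarrow> bool" where
  "blocked \<nu> c \<longleftrightarrow> (fst c + 1, snd c) \<in> diagram \<nu>"

definition num_residues :: "nat \<Rightarrow> nat multiset \<Rightarrow> nat multiset \<Rightarrow> nat" where
  "num_residues k \<nu> \<mu> = card (residue k ` {c \<in> removable_corners \<mu>. \<not> blocked \<nu> c})"


section \<open>\<open>K\<close>-\<open>k\<close>-Schur functions\<close>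

text \<open>The defining property of the family $(g^{(k)}_\nu)$. It determines \<open>g\<close> uniquely on
  \<open>k_bounded k\<close>; values of \<open>g\<close> elsewhere are irrelevant.\<close>

definition K_k_Schur :: "nat \<Rightarrow> (nat multiset \<Rightarrow> symfun) \<Rightarrow> bool" where
  "K_k_Schur k g \<longleftrightarrow>
    (\<forall>\<nu>\<in>k_bounded k. g \<nu> \<in> Lambda_k k) \<and>
    g {#} = 1 \<and>
    (\<forall>\<nu>\<in>k_bounded k. \<forall>r\<le>k.
      hsym r * g \<nu> =
        (\<Sum>s = 0..r. (- 1) ^ (r - s) *
          (\<Sum>\<mu> \<in> {\<mu> \<in> k_bounded k. weak_strip k s (bounded_to_core k \<mu>) (bounded_to_core k \<nu>)}.
            of_nat (num_residues k (bounded_to_core k \<mu>) (bounded_to_core k \<nu>) choose (r - s)) * g \<mu>)))"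

text \<open>\<open>Fract x y\<close> is the quotient $x/y$ in the fraction field of the ring of symmetric functions,
  which contains the fraction field of the subring \<open>Lambda_k k\<close>. The denominators $g^{(k)}_\mu$
  used here are nonzero (the top-degree part of $g^{(k)}_\mu$ is a \<open>k\<close>-Schur function), so the
  convention \<open>Fract x 0 = 0\<close> plays no role.\<close>

end

(*
Encode a (k+1)-core by its beads part i - i, a set of integers closed under subtraction of n = k+1,
and that set by its window g 0 < ... < g (n-1), the least non-bead in each residue class mod n.
The t-th column length of the k-bounded partition is the number of beads above g t, so adding R_t
adds n to every g q with q >= t, up to a translation. A weak strip is a move of the
window which depends only on the residues of the g q in their order; hence the weak strips over
P + l are exactly the P + m for the weak strips m over l. The number r of residues of unblocked
corners depends in addition only on which consecutive entries of the window have been pushed apart,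
i.e. on the set of the t_i and not on the multiplicities a_i. So g_{P + l} g_Q and g_{Q + l} g_P
satisfy the same Pieri recursion in l with the same initial value, and this recursion is triangular.
The denominators are nonzero because g_l is h_l plus lower terms and the h's are independent.
*)
theory Submission
  imports Defs "HOL-Number_Theory.Cong"
begin

text \<open>The strips over \<open>P + \<nu>\<close> see nothing of \<open>P\<close>; the obstacle
  is the number r, which asks whether the place just below a bead is occupied. For window entries
  \<open>q < p\<close> this can only happen by the exact coincidence of an entry with
  \<open>g p - 1\<close>. One added multiple of \<open>n\<close> destroys it as well as many do, so
  \<open>P\<close> has to be compared with \<open>Q\<close>, where the same entries are apart,
  rather than with the empty partition. That a weak strip moves whole residue classes rests on a
  count: along a horizontal strip the core size grows by the number of added contents
  \<open>x\<close> with an old bead at \<open>x - n\<close>, minus the number of those with a new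
  bead at \<open>x + k\<close>. The first number is at most the number of residues, so requiring
  growth and residues to agree makes the second one vanish. Since the size of the strip is at most
  \<open>k < n\<close>, some class stays fixed, and each run of moved classes has a fixed class in
  front of it from which its beads climb. Translations enter because a partition has charge zero:
  \<open>g 0\<close> must be minus the number of beads above it. The quotients are compared by cross
  multiplication; nonvanishing is needed only at the very end.\<close>

section \<open>Partitions through their column lengths\<close>

text \<open>The list of parts is decreasing, so its entries that are at least \<open>j\<close> form
  an initial segment, and position \<open>i\<close> lies in it iff their number reaches
  \<open>i\<close>. This trades the sorted list for a count in the multiset.\<close>

lemma part_ge_iff:
  assumes "1 \<le> i" "1 \<le> j"
  shows "j \<le> part \<nu> i \<longleftrightarrow> i \<le> size {#x \<in># \<nu>. j \<le> x#}"
proof -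
  define xs where "xs = rev (sorted_list_of_multiset \<nu>)"
  have len: "length xs = size \<nu>"
    by (metis xs_def length_rev mset_sorted_list_of_multiset size_mset)
  have dec: "xs ! b \<le> xs ! a" if "a \<le> b" "b < length xs" for a b
    using that sorted_rev_nth_mono[of xs a b] by (simp add: xs_def)
  have "size {#x \<in># \<nu>. j \<le> x#} = length (filter (\<lambda>x. j \<le> x) xs)"
    by (metis xs_def mset_filter mset_rev mset_sorted_list_of_multiset size_mset)
  also have "\<dots> = card {a. a < length xs \<and> j \<le> xs ! a}"
    by (rule length_filter_conv_card)
  finally have sz: "size {#x \<in># \<nu>. j \<le> x#} = card {a. a < length xs \<and> j \<le> xs ! a}" .
  show ?thesis
  proof
    assume h: "j \<le> part \<nu> i"
    then have i: "i \<le> size \<nu>" "j \<le> xs ! (i - 1)"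
      using assms by (auto simp: part_def xs_def split: if_splits)
    have "{..<i} \<subseteq> {a. a < length xs \<and> j \<le> xs ! a}"
    proof
      fix a assume "a \<in> {..<i}"
      then show "a \<in> {a. a < length xs \<and> j \<le> xs ! a}"
        using dec[of a "i - 1"] i len assms by (auto intro: le_trans)
    qed
    then have "card {..<i} \<le> card {a. a < length xs \<and> j \<le> xs ! a}"
      by (intro card_mono) auto
    then show "i \<le> size {#x \<in># \<nu>. j \<le> x#}" using sz by simp
  next
    assume h: "i \<le> size {#x \<in># \<nu>. j \<le> x#}"
    show "j \<le> part \<nu> i"
    proof (rule ccontr)
      assume n: "\<not> j \<le> part \<nu> i"
      have le: "i \<le> size \<nu>"
        using h size_filter_mset_lesseq[of "\<lambda>x. j \<le> x" \<nu>] by linarith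
      then have "xs ! (i - 1) < j"
        using n assms by (auto simp: part_def xs_def)
      then have "{a. a < length xs \<and> j \<le> xs ! a} \<subseteq> {..<i - 1}"
        using dec[of "i - 1"] by (force simp: not_le[symmetric])
      then have "card {a. a < length xs \<and> j \<le> xs ! a} \<le> i - 1"
        by (metis card_lessThan card_mono finite_lessThan)
      then show False using h sz assms by linarith
    qed
  qed
qed

lemma part_antimono:
  assumes "1 \<le> i" "i \<le> j"
  shows "part \<nu> j \<le> part \<nu> i"
proof (cases "part \<nu> j = 0")
  case False
  then have "j \<le> size {#x \<in># \<nu>. part \<nu> j \<le> x#}"
    using part_ge_iff[of j "part \<nu> j" \<nu>] assms by simp
  then show ?thesis
    using part_ge_iff[of i "part \<nu> j" \<nu>] assms False by simp
qed simp

lemma part_eq_0: "size \<nu> < i \<Longrightarrow> part \<nu> i = 0"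
  by (simp add: part_def)

text \<open>The length of column \<open>t + 1\<close> of the diagram. Indexing from 0 matches the
  index of window entries, and counting in the multiset makes it additive under union.\<close>

definition col :: "nat multiset \<Rightarrow> nat \<Rightarrow> nat" where
  "col \<nu> t = size {#x \<in># \<nu>. t < x#}"

lemma col_add [simp]: "col (\<mu> + \<nu>) t = col \<mu> t + col \<nu> t"
  by (simp add: col_def)

lemma col_empty [simp]: "col {#} t = 0"
  by (simp add: col_def)

lemma col_single [simp]: "col {#r#} t = (if t < r then 1 else 0)"
  by (simp add: col_def)

lemma part_gt_iff: "1 \<le> i \<Longrightarrow> t < part \<nu> i \<longleftrightarrow> i \<le> col \<nu> t"
  using part_ge_iff[of i "Suc t" \<nu>] by (simp add: col_def Suc_le_eq)

text \<open>The multiplicity of a part \<open>x > 0\<close> is \<open>col (x - 1) - col x\<close>;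
  zero parts are invisible to \<open>col\<close> and are excluded by
  \<open>is_partition\<close>.\<close>

lemma col_eqI:
  assumes "is_partition \<mu>" "is_partition \<nu>" "\<And>t. col \<mu> t = col \<nu> t"
  shows "\<mu> = \<nu>"
proof (rule multiset_eqI)
  fix x
  have c: "count \<rho> x = col \<rho> (x - 1) - col \<rho> x" if "x > 0" for \<rho>
  proof -
    have "{#y \<in># \<rho>. x - 1 < y#} = {#y \<in># \<rho>. x < y#} + {#y \<in># \<rho>. y = x#}"
      using that by (auto simp: multiset_eq_iff)
    then have "col \<rho> (x - 1) = col \<rho> x + size {#y \<in># \<rho>. y = x#}"
      by (simp add: col_def)
    moreover have "size {#y \<in># \<rho>. y = x#} = count \<rho> x"
      by (simp add: filter_eq_replicate_mset)
    ultimately show ?thesis by simp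
  qed
  show "count \<mu> x = count \<nu> x"
  proof (cases "x = 0")
    case True
    then show ?thesis using assms(1,2) by (simp add: is_partition_def not_in_iff)
  next
    case False
    then show ?thesis using c assms(3) by simp
  qed
qed

lemma partition_eqI:
  assumes "is_partition \<mu>" "is_partition \<nu>" "\<And>i. 1 \<le> i \<Longrightarrow> part \<mu> i = part \<nu> i"
  shows "\<mu> = \<nu>"
proof (rule col_eqI[OF assms(1,2)])
  fix t
  have "i \<le> col \<mu> t \<longleftrightarrow> i \<le> col \<nu> t" if "1 \<le> i" for i
    using part_gt_iff[OF that] assms(3)[OF that] by metis
  then show "col \<mu> t = col \<nu> t"
    by (metis le_antisym le_refl less_one linorder_not_less nle_le)
qed

lemma part_pos:
  assumes "is_partition \<nu>" "1 \<le> i" "i \<le> size \<nu>"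
  shows "0 < part \<nu> i"
proof -
  have "{#x \<in># \<nu>. 0 < x#} = \<nu>"
    using assms(1) by (auto simp: is_partition_def filter_mset_eq_conv intro: gr0I)
  then show ?thesis using part_gt_iff[OF assms(2), of 0 \<nu>] assms(3) by (simp add: col_def)
qed

lemma part_le_iff_all: "part \<nu> 1 \<le> k \<longleftrightarrow> (\<forall>x\<in>#\<nu>. x \<le> k)"
proof -
  have "k < part \<nu> 1 \<longleftrightarrow> {#x \<in># \<nu>. k < x#} \<noteq> {#}"
    using part_gt_iff[of 1 k \<nu>] unfolding col_def
    by (metis One_nat_def Suc_le_eq le_refl nonempty_has_size)
  also have "\<dots> \<longleftrightarrow> (\<exists>x\<in>#\<nu>. k < x)"
    unfolding filter_mset_eq_mempty_iff by blast
  finally show ?thesis by (metis not_le)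
qed

lemma k_bounded_iff: "\<nu> \<in> k_bounded k \<longleftrightarrow> (\<forall>x\<in>#\<nu>. 1 \<le> x \<and> x \<le> k)"
proof -
  have "is_partition \<nu> \<longleftrightarrow> (\<forall>x\<in>#\<nu>. 1 \<le> x)"
    unfolding is_partition_def by (metis One_nat_def Suc_leI gr0I not_one_le_zero)
  then show ?thesis unfolding k_bounded_def mem_Collect_eq part_le_iff_all by blast
qed

lemma col_image_mset:
  "finite I \<Longrightarrow> col (image_mset f (mset_set I)) t = card {i \<in> I. t < f i}"
  unfolding col_def
  by (simp add: filter_mset_image_mset filter_mset_mset_set image_mset.compositionality)

text \<open>A finite downward closed set of positive integers is an interval starting at 1, so its
  cardinality decides membership.\<close>

lemma atLeast1_antimono_set:
  fixes P :: "nat \<Rightarrow> bool"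
  assumes "\<And>i j. 1 \<le> i \<Longrightarrow> i \<le> j \<Longrightarrow> P j \<Longrightarrow> P i" "finite {i. 1 \<le> i \<and> P i}"
  shows "1 \<le> i \<Longrightarrow> P i \<longleftrightarrow> i \<le> card {i. 1 \<le> i \<and> P i}"
proof -
  let ?A = "{i. 1 \<le> i \<and> P i}"
  assume i: "1 \<le> i"
  show ?thesis
  proof
    assume "P i"
    then have "{1..i} \<subseteq> ?A" using assms(1) by auto
    then have "card {1..i} \<le> card ?A" by (rule card_mono[OF assms(2)])
    then show "i \<le> card ?A" by simp
  next
    assume le: "i \<le> card ?A"
    show "P i"
    proof (rule ccontr)
      assume "\<not> P i"
      then have "?A \<subseteq> {1..<i}" using assms(1)[OF i] by (auto simp: not_le[symmetric])
      then have "card ?A \<le> i - 1" by (metis card_atLeastLessThan card_mono finite_atLeastLessThan)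
      then show False using le i by linarith
    qed
  qed
qed

lemma part_of_antimono:
  fixes f :: "nat \<Rightarrow> nat"
  assumes "\<And>i j. 1 \<le> i \<Longrightarrow> i \<le> j \<Longrightarrow> j \<le> m \<Longrightarrow> f j \<le> f i" "1 \<le> i" "i \<le> m"
  shows "part (image_mset f (mset_set {1..m})) i = f i"
proof -
  have "t < part (image_mset f (mset_set {1..m})) i \<longleftrightarrow> t < f i" for t
  proof -
    have "{j \<in> {1..m}. t < f j} = {j. 1 \<le> j \<and> j \<le> m \<and> t < f j}" by auto
    moreover have "(i \<le> m \<and> t < f i) \<longleftrightarrow> i \<le> card {j. 1 \<le> j \<and> (j \<le> m \<and> t < f j)}"
      by (rule atLeast1_antimono_set[OF _ _ assms(2)])
         (use assms(1) in \<open>auto intro: le_trans less_le_trans\<close>)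
    ultimately show ?thesis
      using part_gt_iff[OF assms(2)] col_image_mset[of "{1..m}" f t] assms(3) by simp
  qed
  then show ?thesis by (metis linorder_neqE_nat less_irrefl)
qed

lemma partition_exists:
  fixes f :: "nat \<Rightarrow> nat"
  assumes "\<And>i j. 1 \<le> i \<Longrightarrow> i \<le> j \<Longrightarrow> f j \<le> f i" "\<And>i. m < i \<Longrightarrow> f i = 0"
  obtains \<kappa> where "is_partition \<kappa>" "\<And>i. 1 \<le> i \<Longrightarrow> part \<kappa> i = f i"
proof
  define \<rho> where "\<rho> = image_mset f (mset_set {1..m})"
  \<comment> \<open>Zero values of \<open>f\<close> produce zero parts, which a partition must not
    have; removing them leaves all columns unchanged.\<close>
  define \<kappa> where "\<kappa> = {#x \<in># \<rho>. 0 < x#}"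
  show "is_partition \<kappa>" by (simp add: \<kappa>_def is_partition_def)
  fix i :: nat assume i: "1 \<le> i"
  have "col \<kappa> t = col \<rho> t" for t
    unfolding col_def \<kappa>_def by (rule arg_cong[of _ _ size]) (auto simp: multiset_eq_iff)
  then have eq: "part \<kappa> i = part \<rho> i"
    using part_gt_iff[OF i] by (metis linorder_neqE_nat less_irrefl)
  show "part \<kappa> i = f i"
  proof (cases "i \<le> m")
    case True
    then show ?thesis unfolding eq \<rho>_def by (intro part_of_antimono) (use assms i in auto)
  next
    case False
    then show ?thesis unfolding eq \<rho>_def using assms(2)[of i] by (simp add: part_eq_0)
  qed
qed

lemma sum_mset_eq_sum_col:
  assumes "\<nu> \<in> k_bounded k" "k \<le> m"
  shows "sum_mset \<nu> = (\<Sum>t<m. col \<nu> t)"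
proof -
  have "\<forall>x\<in>#\<nu>. x \<le> m" using assms by (auto simp: k_bounded_iff)
  then show ?thesis
  proof (induction \<nu>)
    case (add x \<nu>)
    have "(\<Sum>t<m. col {#x#} t) = card ({..<m} \<inter> {..<x})"
      by (simp add: sum.If_cases lessThan_def)
    also have "{..<m} \<inter> {..<x} = {..<x}" using add.prems by auto
    finally have "(\<Sum>t<m. col {#x#} t) = x" by simp
    moreover have "col (add_mset x \<nu>) t = col {#x#} t + col \<nu> t" for t
      by (metis col_add add_mset_add_single union_commute)
    ultimately show ?case using add by (simp add: sum.distrib)
  qed simp
qed

lemma mem_diagram: "(i, j) \<in> diagram \<nu> \<longleftrightarrow> 1 \<le> i \<and> 1 \<le> j \<and> j \<le> part \<nu> i"
  by (simp add: diagram_def)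

lemma conj_part_eq: 
  assumes "1 \<le> j" shows "conj_part \<nu> j = col \<nu> (j - 1)"
proof -
  have "1 \<le> i \<Longrightarrow> j \<le> part \<nu> i \<longleftrightarrow> i \<le> col \<nu> (j - 1)" for i
    using part_gt_iff[of i "j - 1" \<nu>] assms by linarith
  then have "{i. (i, j) \<in> diagram \<nu>} = {1..col \<nu> (j - 1)}"
    using assms by (auto simp: mem_diagram)
  then show ?thesis by (simp add: conj_part_def)
qed

lemma mem_diagram_conj: "1 \<le> i \<Longrightarrow> 1 \<le> j \<Longrightarrow> (i, j) \<in> diagram \<nu> \<longleftrightarrow> i \<le> conj_part \<nu> j"
  using part_gt_iff[of i "j - 1" \<nu>] by (auto simp: mem_diagram conj_part_eq)

section \<open>Bead sets of partitions\<close>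

text \<open>The content (column minus row) of the last cell of row \<open>i\<close>. An empty row
  gives \<open>- i\<close>, so the rows beyond the diagram supply all sufficiently negative
  integers.\<close>

definition bead :: "nat multiset \<Rightarrow> nat \<Rightarrow> int" where
  "bead \<nu> i = int (part \<nu> i) - int i"

definition beads :: "nat multiset \<Rightarrow> int set" where
  "beads \<nu> = bead \<nu> ` {1..}"

definition periodic :: "nat \<Rightarrow> int set \<Rightarrow> bool" where
  "periodic n B \<longleftrightarrow> (\<forall>x\<in>B. x - int n \<in> B)"

lemma bead_less: 
  assumes "1 \<le> i" "i < j" shows "bead \<nu> j < bead \<nu> i"
  using part_antimono[of i j \<nu>] assms by (simp add: bead_def)

lemma bead_le: "1 \<le> i \<Longrightarrow> i \<le> j \<Longrightarrow> bead \<nu> j \<le> bead \<nu> i"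
  using bead_less[of i j \<nu>] by (cases "i = j") auto

lemma bead_less_iff: "1 \<le> i \<Longrightarrow> 1 \<le> j \<Longrightarrow> bead \<nu> j < bead \<nu> i \<longleftrightarrow> i < j"
  using bead_less bead_le by (metis leD not_le)

lemma bead_inj: "inj_on (bead \<nu>) {1..}"
  by (rule inj_onI) (metis atLeast_iff bead_less less_irrefl linorder_neqE_nat)

lemma bead_in_beads: "1 \<le> i \<Longrightarrow> bead \<nu> i \<in> beads \<nu>"
  by (auto simp: beads_def)

lemma beadsE:
  assumes "x \<in> beads \<nu>" obtains i where "1 \<le> i" "x = bead \<nu> i"
  using assms by (auto simp: beads_def)

lemma bead_beyond: "size \<nu> < i \<Longrightarrow> bead \<nu> i = - int i"
  by (simp add: bead_def part_eq_0)

lemma low_in_beads: 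
  assumes "x < - int (size \<nu>)" shows "x \<in> beads \<nu>"
proof -
  have "bead \<nu> (nat (- x)) = x" using assms by (subst bead_beyond) auto
  moreover have "1 \<le> nat (- x)" using assms by auto
  ultimately show ?thesis using bead_in_beads by metis
qed

lemma beads_le: "x \<in> beads \<nu> \<Longrightarrow> x \<le> bead \<nu> 1"
  by (auto elim!: beadsE intro: bead_le)

lemma finite_beads_above: "finite {i. 1 \<le> i \<and> x < bead \<nu> i}"
proof (rule finite_subset)
  show "{i. 1 \<le> i \<and> x < bead \<nu> i} \<subseteq> {..max (size \<nu>) (nat (- x))}"
  proof clarify
    fix i assume "1 \<le> i" "x < bead \<nu> i"
    then show "i \<le> max (size \<nu>) (nat (- x))"
      using bead_beyond[of \<nu> i] by (cases "size \<nu> < i") auto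
  qed
qed simp

text \<open>The content of the lowest cell of column \<open>j\<close> outside the diagram. Beads and
  gaps are the two kinds of boundary steps, so the gaps should fill the complement of the
  beads.\<close>

definition gap :: "nat multiset \<Rightarrow> nat \<Rightarrow> int" where
  "gap \<nu> j = int j - 1 - int (conj_part \<nu> j)"

text \<open>The difference \<open>bead \<nu> i - gap \<nu> j\<close> is
  \<open>(part \<nu> i - j) + (conj_part \<nu> j - i) + 1\<close>. Both brackets are nonnegative
  inside the diagram and both are negative outside.\<close>

lemma cell_iff_gap_less_bead:
  assumes "1 \<le> i" "1 \<le> j"
  shows "(i, j) \<in> diagram \<nu> \<longleftrightarrow> gap \<nu> j < bead \<nu> i"
proof (cases "(i, j) \<in> diagram \<nu>")
  case True
  then show ?thesis using mem_diagram_conj[OF assms, of \<nu>] by (simp add: mem_diagram gap_def bead_def)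
next
  case False
  then have "\<not> j \<le> part \<nu> i" "\<not> i \<le> conj_part \<nu> j"
    using mem_diagram_conj[OF assms, of \<nu>] assms by (auto simp: mem_diagram)
  then show ?thesis using False by (simp add: gap_def bead_def)
qed

lemma gap_notin: 
  assumes "1 \<le> j" shows "gap \<nu> j \<notin> beads \<nu>"
proof
  assume "gap \<nu> j \<in> beads \<nu>"
  then obtain i where i: "1 \<le> i" "gap \<nu> j = bead \<nu> i" by (rule beadsE)
  show False
    using assms i mem_diagram_conj[OF i(1) assms, of \<nu>] mem_diagram[of i j \<nu>]
    by (cases "(i, j) \<in> diagram \<nu>") (auto simp: gap_def bead_def)
qed

lemma gap_inj: "inj_on (gap \<nu>) {1..}"
proof -
  have "gap \<nu> i < gap \<nu> j" if "1 \<le> i" "i < j" for i j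
  proof -
    have "conj_part \<nu> j \<le> conj_part \<nu> i"
    proof (cases "conj_part \<nu> j = 0")
      case False
      then have "(conj_part \<nu> j, j) \<in> diagram \<nu>" using mem_diagram_conj that by auto
      then have "(conj_part \<nu> j, i) \<in> diagram \<nu>" using that by (auto simp: mem_diagram)
      then show ?thesis using mem_diagram_conj[of "conj_part \<nu> j" i] False that by simp
    qed simp
    then show ?thesis using that by (simp add: gap_def)
  qed
  then show ?thesis by (metis inj_onI atLeast_iff less_irrefl linorder_neqE_nat)
qed

text \<open>With \<open>i\<close> beads above \<open>x\<close>, the cell of content \<open>x\<close>
  in row \<open>i + 1\<close> lies outside the diagram while the cell below it, if there is a row
  \<open>i\<close>, lies inside; its column is the one sought.\<close>

lemma gap_surj:
  assumes "x \<notin> beads \<nu>"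
  obtains j where "1 \<le> j" "x = gap \<nu> j"
proof
  define i where "i = card {i. 1 \<le> i \<and> x < bead \<nu> i}"
  have iff: "x < bead \<nu> j \<longleftrightarrow> j \<le> i" if "1 \<le> j" for j
    unfolding i_def
    by (rule atLeast1_antimono_set[OF _ finite_beads_above that]) (meson bead_le less_le_trans)
  have ne: "x \<noteq> bead \<nu> (Suc i)" using assms bead_in_beads[of "Suc i" \<nu>] by auto
  then have up: "bead \<nu> (Suc i) < x" using iff[of "Suc i"] by simp
  \<comment> \<open>The column in which row \<open>i + 1\<close> has content
    \<open>x\<close>.\<close>
  define j where "j = nat (x + int i + 1)"
  have j: "int j = x + int i + 1" "1 \<le> j" using up unfolding j_def bead_def by linarith+
  then show "1 \<le> j" by simp
  have "i' \<le> conj_part \<nu> j \<longleftrightarrow> i' \<le> i" if "1 \<le> i'" for i'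
  proof -
    have "i' \<le> conj_part \<nu> j \<longleftrightarrow> j \<le> part \<nu> i'"
      using mem_diagram_conj[of i' j \<nu>] mem_diagram[of i' j \<nu>] j that by simp
    also have "\<dots> \<longleftrightarrow> i' \<le> i"
    proof
      assume "i' \<le> i"
      then have "j \<le> part \<nu> i" if "1 \<le> i" using iff[OF that] j unfolding bead_def by linarith
      then show "j \<le> part \<nu> i'" using part_antimono[of i' i \<nu>] \<open>1 \<le> i'\<close> \<open>i' \<le> i\<close> by linarith
    next
      assume "j \<le> part \<nu> i'"
      show "i' \<le> i"
      proof (rule ccontr)
        assume "\<not> i' \<le> i"
        then have "part \<nu> i' \<le> part \<nu> (Suc i)" by (intro part_antimono) auto
        then show False using \<open>j \<le> part \<nu> i'\<close> up j unfolding bead_def by linarith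
      qed
    qed
    finally show ?thesis .
  qed
  then have "conj_part \<nu> j = i"
    by (metis le_antisym le_refl less_one linorder_not_less nat_le_linear)
  then show "x = gap \<nu> j" using j by (simp add: gap_def)
qed

lemma hook_eq: 
  assumes "1 \<le> i" "1 \<le> j" "(i, j) \<in> diagram \<nu>"
  shows "int (hook \<nu> (i, j)) = bead \<nu> i - gap \<nu> j"
proof -
  have "i \<le> conj_part \<nu> j" "j \<le> part \<nu> i"
    using assms mem_diagram_conj[OF assms(1,2), of \<nu>] by (simp_all add: mem_diagram)
  then show ?thesis by (simp add: gap_def bead_def)
qed

text \<open>By \<open>hook_eq\<close> a cell of hook length \<open>k + 1\<close> is a bead
  \<open>x\<close> together with a gap at \<open>x - (k + 1)\<close>; periodicity says that no such
  pair exists.\<close>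

lemma core_iff_periodic:
  "\<kappa> \<in> cores k \<longleftrightarrow> is_partition \<kappa> \<and> periodic (k + 1) (beads \<kappa>)"
proof -
  have "(\<forall>c\<in>diagram \<kappa>. hook \<kappa> c \<noteq> k + 1) \<longleftrightarrow> periodic (k + 1) (beads \<kappa>)"
  proof
    assume h: "\<forall>c\<in>diagram \<kappa>. hook \<kappa> c \<noteq> k + 1"
    show "periodic (k + 1) (beads \<kappa>)" unfolding periodic_def
    proof (rule ccontr, clarsimp)
      fix x assume "x \<in> beads \<kappa>" and n: "x - (1 + int k) \<notin> beads \<kappa>"
      then obtain i where i: "1 \<le> i" "x = bead \<kappa> i" by (auto elim: beadsE)
      obtain j where j: "1 \<le> j" "x - (1 + int k) = gap \<kappa> j" using gap_surj[OF n] by metis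
      have "(i, j) \<in> diagram \<kappa>" using cell_iff_gap_less_bead[OF i(1) j(1)] i j by simp
      moreover have "hook \<kappa> (i, j) = k + 1"
        using hook_eq[OF i(1) j(1) calculation] i j by linarith
      ultimately show False using h by blast
    qed
  next
    assume h: "periodic (k + 1) (beads \<kappa>)"
    show "\<forall>c\<in>diagram \<kappa>. hook \<kappa> c \<noteq> k + 1"
    proof (clarify)
      fix i j assume c: "(i, j) \<in> diagram \<kappa>" and e: "hook \<kappa> (i, j) = k + 1"
      have ij: "1 \<le> i" "1 \<le> j" using c by (auto simp: mem_diagram)
      have "gap \<kappa> j = bead \<kappa> i - int (k + 1)"
        using hook_eq[OF ij c] e by linarith
      then have "gap \<kappa> j \<in> beads \<kappa>"
        using h bead_in_beads[OF ij(1), of \<kappa>] unfolding periodic_def by metis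
      then show False using gap_notin[OF ij(2)] by blast
    qed
  qed
  then show ?thesis by (simp add: cores_def)
qed

text \<open>The cells of hook length below \<open>n\<close> in row \<open>i\<close>, seen on the
  boundary: they are the gaps at distance less than \<open>n\<close> below the bead.\<close>

definition row_count :: "nat \<Rightarrow> nat multiset \<Rightarrow> nat \<Rightarrow> nat" where
  "row_count n \<nu> i = card ({bead \<nu> i - int n<..bead \<nu> i} - beads \<nu>)"

lemma row_count_eq:
  assumes "1 \<le> i"
  shows "card {j. (i, j) \<in> diagram \<nu> \<and> hook \<nu> (i, j) \<le> k} = row_count (k + 1) \<nu> i"
  unfolding row_count_def
proof (rule bij_betw_same_card)
  have d: "(i, j) \<in> diagram \<nu> \<and> hook \<nu> (i, j) \<le> k \<longleftrightarrow>
      1 \<le> j \<and> bead \<nu> i - int (k + 1) < gap \<nu> j \<and> gap \<nu> j < bead \<nu> i" for j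
  proof (cases "1 \<le> j \<and> (i, j) \<in> diagram \<nu>")
    case True
    then show ?thesis
      using hook_eq[of i j \<nu>] cell_iff_gap_less_bead[of i j \<nu>] assms by auto
  next
    case False
    then show ?thesis using cell_iff_gap_less_bead[of i j \<nu>] assms by (auto simp: mem_diagram)
  qed
  show "bij_betw (gap \<nu>) {j. (i, j) \<in> diagram \<nu> \<and> hook \<nu> (i, j) \<le> k}
      ({bead \<nu> i - int (k + 1)<..bead \<nu> i} - beads \<nu>)"
    unfolding d bij_betw_def
  proof
    show "inj_on (gap \<nu>) {j. 1 \<le> j \<and> bead \<nu> i - int (k + 1) < gap \<nu> j \<and> gap \<nu> j < bead \<nu> i}"
      by (rule inj_on_subset[OF gap_inj]) auto
    have ne: "x \<noteq> bead \<nu> i" if "x \<notin> beads \<nu>" for x using that bead_in_beads[OF assms] by auto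
    have im: "x \<in> gap \<nu> ` {j. 1 \<le> j \<and> P (gap \<nu> j)} \<longleftrightarrow> P x \<and> x \<notin> beads \<nu>" for x P
      using gap_notin gap_surj by (metis (mono_tags, lifting) image_iff mem_Collect_eq)
    show "gap \<nu> ` {j. 1 \<le> j \<and> bead \<nu> i - int (k + 1) < gap \<nu> j \<and> gap \<nu> j < bead \<nu> i} =
      {bead \<nu> i - int (k + 1)<..bead \<nu> i} - beads \<nu>"
    proof (rule set_eqI)
      fix x
      have "x \<in> gap \<nu> ` {j. 1 \<le> j \<and> bead \<nu> i - int (k + 1) < gap \<nu> j \<and> gap \<nu> j < bead \<nu> i} \<longleftrightarrow>
        (bead \<nu> i - int (k + 1) < x \<and> x < bead \<nu> i) \<and> x \<notin> beads \<nu>"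
        by (rule im)
      also have "\<dots> \<longleftrightarrow> x \<in> {bead \<nu> i - int (k + 1)<..bead \<nu> i} - beads \<nu>"
        using ne[of x] by auto
      finally show "x \<in> gap \<nu> ` {j. 1 \<le> j \<and> bead \<nu> i - int (k + 1) < gap \<nu> j \<and> gap \<nu> j < bead \<nu> i} \<longleftrightarrow>
        x \<in> {bead \<nu> i - int (k + 1)<..bead \<nu> i} - beads \<nu>" .
    qed
  qed
qed

lemma core_to_bounded_eq:
  "core_to_bounded k \<kappa> = image_mset (row_count (k + 1) \<kappa>) (mset_set {1..size \<kappa>})"
  unfolding core_to_bounded_def
  by (rule image_mset_cong) (simp only: row_count_eq finite_set_mset_mset_set[OF finite_atLeastAtMost] atLeastAtMost_iff)

text \<open>The free bound \<open>m\<close> allows two cores of different length to be summed over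
  the same rows; the extra rows are empty and count nothing.\<close>

lemma core_size_eq:
  assumes "size \<kappa> \<le> m"
  shows "core_size k \<kappa> = (\<Sum>i\<in>{1..m}. row_count (k + 1) \<kappa> i)"
proof -
  have e: "{c \<in> diagram \<kappa>. hook \<kappa> c < k + 1} =
      (SIGMA i:{1..m}. {j. (i, j) \<in> diagram \<kappa> \<and> hook \<kappa> (i, j) \<le> k})"
  proof -
    have "i \<le> m" if "(i, j) \<in> diagram \<kappa>" for i j
      using that part_eq_0[of \<kappa> i] assms by (auto simp: mem_diagram intro: ccontr)
    then show ?thesis by (auto simp: mem_diagram simp del: hook.simps)
  qed
  have fin: "finite {j. (i, j) \<in> diagram \<kappa> \<and> hook \<kappa> (i, j) \<le> k}" for i
    by (rule finite_subset[of _ "{..part \<kappa> i}"]) (auto simp: mem_diagram)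
  show ?thesis unfolding core_size_def e
    using row_count_eq[of _ \<kappa> k] by (subst card_SigmaI) (simp_all add: fin del: hook.simps)
qed

lemma partition_of_beads:
  fixes b :: "nat \<Rightarrow> int"
  assumes dec: "\<And>i. 1 \<le> i \<Longrightarrow> b (Suc i) < b i" and ev: "\<And>i. m < i \<Longrightarrow> b i = - int i"
  obtains \<kappa> where "is_partition \<kappa>" "\<And>i. 1 \<le> i \<Longrightarrow> bead \<kappa> i = b i"
proof -
  have anti: "b j + int j \<le> b i + int i" if "1 \<le> i" "i \<le> j" for i j
    using that(2)
  proof (induction rule: dec_induct)
    case (step j)
    then show ?case using dec[of j] that by simp
  qed simp
  have nn: "0 \<le> b i + int i" if "1 \<le> i" for i
    using anti[OF that, of "i + m + 1"] ev[of "i + m + 1"] that by simp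
  obtain \<kappa> where "is_partition \<kappa>" "\<And>i. 1 \<le> i \<Longrightarrow> part \<kappa> i = nat (b i + int i)"
    by (rule partition_exists[of "\<lambda>i. nat (b i + int i)" m]) (use anti ev in \<open>auto intro: nat_mono\<close>)
  then show ?thesis using that[of \<kappa>] nn by (simp add: bead_def)
qed

text \<open>Exactly \<open>m\<close> elements at or above \<open>- m\<close>, with everything below
  \<open>- m\<close> present, is the condition of charge zero. It fixes the translation, since the
  row numbers enter \<open>bead\<close>.\<close>

lemma partition_of_bead_set:
  assumes low: "\<And>x. x < - int m \<Longrightarrow> x \<in> B" and fin: "finite (B \<inter> {- int m..})"
    and card: "card (B \<inter> {- int m..}) = m"
  obtains \<kappa> where "is_partition \<kappa>" "beads \<kappa> = B"
proof -
  define L where "L = sorted_list_of_set (B \<inter> {- int m..})"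
  have L: "length L = m" "set L = B \<inter> {- int m..}" "sorted_wrt (<) L"
    using fin card unfolding L_def by auto
  define b where "b i = (if 1 \<le> i \<and> i \<le> m then L ! (m - i) else - int i)" for i
  have "b (Suc i) < b i" if "1 \<le> i" for i
  proof (cases "Suc i \<le> m")
    case True
    then show ?thesis using L that by (auto simp: b_def intro: sorted_wrt_nth_less)
  next
    case False
    have "- int m \<le> b i" if "i = m"
    proof -
      have "L ! 0 \<in> set L" using that \<open>1 \<le> i\<close> L(1) by (intro nth_mem) auto
      then show ?thesis using that \<open>1 \<le> i\<close> L(2) by (simp add: b_def)
    qed
    then show ?thesis using False that by (auto simp: b_def)
  qed
  then obtain \<kappa> where \<kappa>: "is_partition \<kappa>" "\<And>i. 1 \<le> i \<Longrightarrow> bead \<kappa> i = b i"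
    using partition_of_beads[of b m] by (auto simp: b_def)
  have "beads \<kappa> = b ` {1..}" using \<kappa>(2) by (auto simp: beads_def image_iff)
  also have "\<dots> = B"
  proof
    show "b ` {1..} \<subseteq> B"
    proof clarsimp
      fix i :: nat assume i: "Suc 0 \<le> i"
      show "b i \<in> B"
      proof (cases "i \<le> m")
        case True
        then have "L ! (m - i) \<in> set L" using i L(1) by (intro nth_mem) auto
        then show ?thesis using True i L(2) by (simp add: b_def)
      qed (use low in \<open>simp add: b_def\<close>)
    qed
    show "B \<subseteq> b ` {1..}"
    proof
      fix x assume x: "x \<in> B"
      show "x \<in> b ` {1..}"
      proof (cases "x < - int m")
        case True
        then show ?thesis by (intro image_eqI[of _ _ "nat (- x)"]) (auto simp: b_def)
      next
        case False
        then obtain a where "a < m" "x = L ! a" using x L by (metis IntI atLeast_iff in_set_conv_nth not_le)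
        then show ?thesis by (intro image_eqI[of _ _ "m - a"]) (auto simp: b_def)
      qed
    qed
  qed
  finally show ?thesis using that \<kappa> by blast
qed

section \<open>Windows of periodic bead sets\<close>

lemma cong_less_step:
  assumes "[x = y] (mod int n)" "x < y" shows "x + int n \<le> y"
proof -
  have "int n dvd y - x" using assms(1) by (simp add: cong_iff_dvd_diff dvd_diff_commute)
  then show ?thesis using assms(2) zdvd_imp_le[of "int n" "y - x"] by simp
qed

lemma cong_self_minus: "[x - int n = x] (mod int n)"
  by (simp add: cong_iff_dvd_diff)

lemma cong_move: "[x = y + c] (mod m) \<longleftrightarrow> [x - c = y] (mod (m :: int))"
  by (simp add: cong_iff_dvd_diff algebra_simps)

definition window :: "nat \<Rightarrow> (nat \<Rightarrow> int) \<Rightarrow> bool" where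
  "window n g \<longleftrightarrow> 0 < n \<and> (\<forall>p q. p < q \<longrightarrow> q < n \<longrightarrow> g p < g q) \<and>
    (\<forall>p<n. \<forall>q<n. [g p = g q] (mod int n) \<longrightarrow> p = q)"

definition below :: "nat \<Rightarrow> (nat \<Rightarrow> int) \<Rightarrow> int set" where
  "below n g = {x. \<exists>q<n. x < g q \<and> [x = g q] (mod int n)}"

lemma window_less_iff: "window n g \<Longrightarrow> p < n \<Longrightarrow> q < n \<Longrightarrow> g p < g q \<longleftrightarrow> p < q"
  unfolding window_def by (metis less_asym' less_irrefl linorder_neqE_nat)

lemma window_le_iff: "window n g \<Longrightarrow> p < n \<Longrightarrow> q < n \<Longrightarrow> g p \<le> g q \<longleftrightarrow> p \<le> q"
  using window_less_iff[of n g q p] by (simp add: not_less[symmetric])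

lemma window_cong: "window n g \<Longrightarrow> p < n \<Longrightarrow> q < n \<Longrightarrow> [g p = g q] (mod int n) \<Longrightarrow> p = q"
  unfolding window_def by blast

text \<open>\<open>n\<close> pairwise incongruent integers form a complete system of
  residues.\<close>

lemma window_cover:
  assumes "window n g" obtains q where "q < n" "[x = g q] (mod int n)"
proof -
  have n: "0 < n" using assms by (simp add: window_def)
  let ?f = "\<lambda>q. g q mod int n"
  have "inj_on ?f {..<n}"
    using assms by (auto simp: window_def cong_def intro!: inj_onI)
  then have "card (?f ` {..<n}) = n" by (simp add: card_image)
  moreover have "?f ` {..<n} \<subseteq> {0..<int n}" using n by auto
  ultimately have "?f ` {..<n} = {0..<int n}" by (intro card_subset_eq) auto
  then have "x mod int n \<in> ?f ` {..<n}" using n by auto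
  then show ?thesis using that by (auto simp: cong_def)
qed

lemma below_iff:
  assumes "window n g" "q < n" "[x = g q] (mod int n)"
  shows "x \<in> below n g \<longleftrightarrow> x < g q"
proof
  assume "x \<in> below n g"
  then obtain p where p: "p < n" "x < g p" "[x = g p] (mod int n)" by (auto simp: below_def)
  then have "[g q = g p] (mod int n)" using assms(3) cong_sym cong_trans by blast
  then show "x < g q" using window_cong[OF assms(1,2) p(1)] p(2) by blast
next
  assume "x < g q" then show "x \<in> below n g" using assms by (auto simp: below_def)
qed

lemma below_periodic: "periodic n (below n g)"
  unfolding periodic_def
proof
  fix x assume "x \<in> below n g"
  then obtain q where "q < n" "x < g q" "[x = g q] (mod int n)" by (auto simp: below_def)
  then have "q < n \<and> x - int n < g q \<and> [x - int n = g q] (mod int n)"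
    using cong_trans[OF cong_self_minus] by auto
  then show "x - int n \<in> below n g" unfolding below_def by blast
qed

lemma periodic_multiple: 
  assumes "periodic n B" "y \<in> B" "[x = y] (mod int n)" "x \<le> y" shows "x \<in> B"
proof -
  have "y - int n * int j \<in> B" for j
  proof (induction j)
    case (Suc j)
    then have "y - int n * int j - int n \<in> B" using assms(1) unfolding periodic_def by blast
    then show ?case by (simp add: algebra_simps)
  qed (use assms in simp)
  moreover obtain c where c: "y - x = int n * c"
    using assms(3) by (metis cong_iff_dvd_diff cong_sym_eq dvd_def)
  have "x = y - int n * int (nat c)" if "n > 0"
  proof -
    have "0 \<le> int n * c" using c assms(4) by simp
    then have "0 \<le> c" using that by (simp add: zero_le_mult_iff)
    then show ?thesis using c by simp
  qed
  moreover have "x = y" if "n = 0" using c that by simp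
  ultimately show ?thesis using assms(2) by (metis gr0I)
qed

lemma below_eqI:
  assumes "window n g" "periodic n B" "\<And>q. q < n \<Longrightarrow> g q \<notin> B \<and> g q - int n \<in> B"
  shows "below n g = B"
proof (rule set_eqI)
  fix x
  obtain q where q: "q < n" "[x = g q] (mod int n)" using window_cover[OF assms(1)] .
  show "x \<in> below n g \<longleftrightarrow> x \<in> B"
  proof (cases "x < g q")
    case True
    then have "x \<le> g q - int n" using cong_less_step[OF q(2)] by simp
    moreover have "[x = g q - int n] (mod int n)"
      using q(2) cong_self_minus cong_sym cong_trans by blast
    ultimately show ?thesis
      using True below_iff[OF assms(1) q] periodic_multiple[OF assms(2)] assms(3)[OF q(1)] by blast
  next
    case False
    then show ?thesis
      using below_iff[OF assms(1) q] periodic_multiple[OF assms(2), of x "g q"] assms(3)[OF q(1)] 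
        cong_sym[OF q(2)] by auto
  qed
qed

lemma window_notin_below: "window n g \<Longrightarrow> q < n \<Longrightarrow> g q \<notin> below n g"
  using below_iff[of n g q "g q"] by simp

text \<open>Within each residue class the beads form a half-line, unbounded below and bounded above,
  so there is one element of \<open>G\<close> per class; sorting these \<open>n\<close> elements
  gives the window.\<close>

lemma window_exists:
  assumes n: "0 < n" and per: "periodic n B" and low: "\<And>x. x < L \<Longrightarrow> x \<in> B"
    and up: "\<And>x. x \<in> B \<Longrightarrow> x \<le> U"
  obtains g where "window n g" "below n g = B"
proof -
  define G where "G = {x. x \<notin> B \<and> x - int n \<in> B}"
  have fin: "finite G"
    by (rule finite_subset[of _ "{L..U + int n}"]) (use low up in \<open>force simp: G_def not_le[symmetric]\<close>, simp)
  have uniq: "x = y" if "x \<in> G" "y \<in> G" "[x = y] (mod int n)" for x y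
  proof -
    have "\<not> x < y" if "x \<in> G" "y \<in> G" "[x = y] (mod int n)" for x y
    proof
      assume "x < y"
      then have "x \<le> y - int n" "[x = y - int n] (mod int n)"
        using cong_less_step[OF that(3)] that(3) cong_self_minus cong_sym cong_trans by (force, blast)
      then show False using periodic_multiple[OF per, of "y - int n" x] that by (simp add: G_def)
    qed
    then show ?thesis using that by (metis cong_sym linorder_neqE)
  qed
  have ex: "\<exists>x\<in>G. [x = r] (mod int n)" for r
  proof -
    \<comment> \<open>\<open>L + (r - L) mod int n\<close> is the first member of the class of
      \<open>r\<close> from \<open>L\<close> on. The climb in steps of \<open>n\<close> ends at the
      first non-bead; the member before it is a bead by minimality, or because it lies below
      \<open>L\<close>.\<close>
    define j where "j = (LEAST j. L + (r - L) mod int n + int n * int j \<notin> B)"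
    let ?x = "\<lambda>j. L + (r - L) mod int n + int n * int j"
    have c: "[?x j = r] (mod int n)" for j
    proof -
      have "?x j - r = int n * (int j - (r - L) div int n)"
        by (simp add: algebra_simps minus_mult_div_eq_mod[symmetric])
      then show ?thesis by (simp add: cong_iff_dvd_diff)
    qed
    have "\<exists>j. ?x j \<notin> B"
    proof -
      have "U < ?x (nat (U - L) + 1)"
      proof -
        have "0 \<le> (r - L) mod int n" using n by simp
        moreover have "int (nat (U - L) + 1) \<le> int n * int (nat (U - L) + 1)" using n by simp
        ultimately show ?thesis by linarith
      qed
      then show ?thesis using up by (meson not_le)
    qed
    then have nj: "?x j \<notin> B" unfolding j_def by (rule LeastI_ex)
    have "?x j - int n \<in> B"
    proof (cases j)
      case 0
      have "(r - L) mod int n < int n" using n by simp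
      then show ?thesis using low 0 by simp
    next
      case (Suc i)
      then have "?x i \<in> B" using not_less_Least[of i "\<lambda>j. ?x j \<notin> B"] unfolding j_def[symmetric] by simp
      then show ?thesis using Suc by (simp add: algebra_simps)
    qed
    then show ?thesis using nj c G_def by blast
  qed
  have "bij_betw (\<lambda>x. x mod int n) G {0..<int n}"
  proof (rule bij_betw_imageI)
    show "inj_on (\<lambda>x. x mod int n) G" using uniq by (auto intro!: inj_onI simp: cong_def)
    show "(\<lambda>x. x mod int n) ` G = {0..<int n}"
    proof
      show "{0..<int n} \<subseteq> (\<lambda>x. x mod int n) ` G"
      proof
        fix r assume "r \<in> {0..<int n}"
        then show "r \<in> (\<lambda>x. x mod int n) ` G" using ex[of r] by (auto simp: cong_def)
      qed
    qed (use n in auto)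
  qed
  then have card: "card G = n" using bij_betw_same_card by fastforce
  define g where "g q = sorted_list_of_set G ! q" for q
  have sl: "sorted_wrt (<) (sorted_list_of_set G)" "length (sorted_list_of_set G) = n"
      "set (sorted_list_of_set G) = G" using fin card by auto
  have gG: "g q \<in> G" if "q < n" for q using sl that nth_mem by (fastforce simp: g_def)
  have less: "g p < g q" if "p < q" "q < n" for p q
    using that sl by (auto simp: g_def intro: sorted_wrt_nth_less)
  have w: "window n g"
    unfolding window_def
  proof (intro conjI allI impI)
    fix p q assume "p < n" "q < n" "[g p = g q] (mod int n)"
    then have "g p = g q" using uniq gG by blast
    then show "p = q" using less \<open>p < n\<close> \<open>q < n\<close> by (metis less_irrefl linorder_neqE_nat)
  qed (use n less in auto)
  have "below n g = B"
    by (rule below_eqI[OF w per]) (use gG in \<open>auto simp: G_def\<close>)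
  then show ?thesis using that w by blast
qed

lemma beads_window_exists:
  assumes "0 < n" "periodic n (beads \<nu>)"
  obtains g where "window n g" "below n g = beads \<nu>"
proof -
  from window_exists[OF assms, of "- int (size \<nu>)" "bead \<nu> 1"] low_in_beads beads_le
  obtain g where "window n g" "below n g = beads \<nu>" by blast
  then show ?thesis by (rule that)
qed

text \<open>The \<open>n\<close> positions ending at the bead contain each residue class once, and
  the member of the class of \<open>g q\<close> is a gap iff it is at least \<open>g q\<close>,
  which amounts to \<open>g q\<close> lying below the bead.\<close>

lemma row_count_window:
  assumes w: "window n g" and b: "below n g = beads \<nu>" and i: "1 \<le> i"
  shows "row_count n \<nu> i = card {q. q < n \<and> g q < bead \<nu> i}"
proof -
  \<comment> \<open>The representative of the class of \<open>g q\<close> among the \<open>n\<close>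
    positions ending at the bead.\<close>
  define c where "c q = bead \<nu> i - (bead \<nu> i - g q) mod int n" for q
  have n: "0 < n" using w by (simp add: window_def)
  have cg: "[c q = g q] (mod int n)" for q
    unfolding c_def by (simp add: cong_def mod_simps)
  have cw: "bead \<nu> i - int n < c q" "c q \<le> bead \<nu> i" for q using n by (auto simp: c_def)
  have eq: "y = c q" if "[y = g q] (mod int n)" "bead \<nu> i - int n < y" "y \<le> bead \<nu> i" for y q
  proof -
    have "[y = c q] (mod int n)" using that(1) cg cong_sym cong_trans by blast
    then show ?thesis using cong_less_step[of y "c q" n] cong_less_step[of "c q" y n] cw[of q] that
      by (smt (verit) cong_sym)
  qed
  have "bij_betw c {q. q < n \<and> g q < bead \<nu> i} ({bead \<nu> i - int n<..bead \<nu> i} - beads \<nu>)"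
  proof (rule bij_betw_imageI)
    show "inj_on c {q. q < n \<and> g q < bead \<nu> i}"
      by (rule inj_onI) (metis (mono_tags) cg cong_sym cong_trans mem_Collect_eq w window_cong)
    show "c ` {q. q < n \<and> g q < bead \<nu> i} = {bead \<nu> i - int n<..bead \<nu> i} - beads \<nu>"
    proof (intro equalityI subsetI)
      fix y assume "y \<in> c ` {q. q < n \<and> g q < bead \<nu> i}"
      then obtain q where q: "q < n" "g q < bead \<nu> i" "y = c q" by auto
      have "\<not> c q < g q" using cong_less_step[OF cg, of q] cw[of q] q by linarith
      then have "c q \<notin> beads \<nu>" using below_iff[OF w q(1) cg] b by simp
      then show "y \<in> {bead \<nu> i - int n<..bead \<nu> i} - beads \<nu>" using cw q by simp
    next
      fix y assume y: "y \<in> {bead \<nu> i - int n<..bead \<nu> i} - beads \<nu>"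
      obtain q where q: "q < n" "[y = g q] (mod int n)" using window_cover[OF w] .
      have "g q \<le> y" using below_iff[OF w q] b y by auto
      moreover have "g q \<noteq> bead \<nu> i" 
        using window_notin_below[OF w q(1)] b bead_in_beads[OF i] by metis
      ultimately show "y \<in> c ` {q. q < n \<and> g q < bead \<nu> i}"
        using eq[OF q(2)] y q(1) by force
    qed
  qed
  then show ?thesis unfolding row_count_def by (rule bij_betw_same_card[symmetric])
qed

lemma row_count_gt_iff:
  assumes w: "window n g" and b: "below n g = beads \<nu>" and i: "1 \<le> i" and t: "t < n"
  shows "t < row_count n \<nu> i \<longleftrightarrow> g t < bead \<nu> i"
proof
  assume "g t < bead \<nu> i"
  then have "{..t} \<subseteq> {q. q < n \<and> g q < bead \<nu> i}"
    using window_le_iff[OF w _ t] t by (auto intro: le_less_trans)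
  then have "card {..t} \<le> card {q. q < n \<and> g q < bead \<nu> i}" by (intro card_mono) auto
  then show "t < row_count n \<nu> i" using row_count_window[OF w b i] by simp
next
  assume h: "t < row_count n \<nu> i"
  show "g t < bead \<nu> i"
  proof (rule ccontr)
    assume "\<not> g t < bead \<nu> i"
    then have "\<forall>q. q < n \<and> g q < bead \<nu> i \<longrightarrow> g q < g t" by auto
    then have "{q. q < n \<and> g q < bead \<nu> i} \<subseteq> {..<t}"
      using window_less_iff[OF w _ t] by auto
    then have "card {q. q < n \<and> g q < bead \<nu> i} \<le> t" by (metis card_lessThan card_mono finite_lessThan)
    then show False using h row_count_window[OF w b i] by simp
  qed
qed

text \<open>The residue class of the bead itself contributes no gap. With \<open>n = k + 1\<close>
  this keeps the row counts at most \<open>k\<close>.\<close>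

lemma row_count_less:
  assumes "window n g" "below n g = beads \<nu>" "1 \<le> i"
  shows "row_count n \<nu> i < n"
proof -
  obtain q where q: "q < n" "[bead \<nu> i = g q] (mod int n)" using window_cover[OF assms(1)] .
  then have "bead \<nu> i < g q"
    using below_iff[OF assms(1) q] assms(2) bead_in_beads[OF assms(3)] by metis
  then have "{q. q < n \<and> g q < bead \<nu> i} \<subseteq> {..<n} - {q}" by auto
  then have "card {q. q < n \<and> g q < bead \<nu> i} \<le> card ({..<n} - {q})" by (intro card_mono) auto
  then show ?thesis using q row_count_window[OF assms] by simp
qed

lemma bead_le_gap:
  assumes "g \<notin> beads \<nu>" "g < bead \<nu> i" "1 \<le> i" shows "i \<le> size \<nu>"
proof (rule ccontr)
  assume "\<not> i \<le> size \<nu>"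
  then have "g < - int (size \<nu>)" using assms bead_beyond[of \<nu> i] by simp
  then show False using low_in_beads assms(1) by blast
qed

text \<open>Every nonempty row has a cell in column 1, so its bead exceeds
  \<open>gap \<nu> 1\<close>, and \<open>g 0\<close> is the least gap. It keeps zero parts out of
  the image of a core.\<close>

lemma window_0_less_bead:
  assumes "window n g" "below n g = beads \<nu>" "is_partition \<nu>" "1 \<le> i" "i \<le> size \<nu>"
  shows "g 0 < bead \<nu> i"
proof -
  have "(i, 1) \<in> diagram \<nu>" using part_pos[OF assms(3-5)] assms(4) by (simp add: mem_diagram)
  then have "gap \<nu> 1 < bead \<nu> i" using cell_iff_gap_less_bead[of i 1 \<nu>] assms(4) by simp
  moreover obtain q where q: "q < n" "[gap \<nu> 1 = g q] (mod int n)" using window_cover[OF assms(1)] .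
  have "g q \<le> gap \<nu> 1" using below_iff[OF assms(1) q] gap_notin[of 1 \<nu>] assms(2) by simp
  moreover have "g 0 \<le> g q" using window_le_iff[OF assms(1), of 0 q] q by simp
  ultimately show ?thesis by linarith
qed

lemma col_core_to_bounded:
  assumes w: "window (k + 1) g" and b: "below (k + 1) g = beads \<kappa>" and t: "t < k + 1"
  shows "col (core_to_bounded k \<kappa>) t = card {i. 1 \<le> i \<and> g t < bead \<kappa> i}"
proof -
  have "{i. 1 \<le> i \<and> g t < bead \<kappa> i} = {i \<in> {1..size \<kappa>}. t < row_count (k + 1) \<kappa> i}"
    using row_count_gt_iff[OF w b _ t] bead_le_gap[of "g t" \<kappa>] window_notin_below[OF w t] b by auto
  then show ?thesis unfolding core_to_bounded_eq by (simp add: col_image_mset)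
qed

lemma core_window_exists:
  assumes "\<kappa> \<in> cores k"
  obtains g where "window (k + 1) g" "below (k + 1) g = beads \<kappa>"
proof -
  have "periodic (k + 1) (beads \<kappa>)" using assms core_iff_periodic by blast
  from beads_window_exists[OF _ this] obtain g
    where "window (k + 1) g" "below (k + 1) g = beads \<kappa>" by auto
  then show ?thesis by (rule that)
qed

lemma core_to_bounded_in:
  assumes "\<kappa> \<in> cores k" shows "core_to_bounded k \<kappa> \<in> k_bounded k"
proof -
  obtain g where g: "window (k + 1) g" "below (k + 1) g = beads \<kappa>" using core_window_exists[OF assms] .
  have p: "is_partition \<kappa>" using assms core_iff_periodic by blast
  have "1 \<le> row_count (k + 1) \<kappa> i \<and> row_count (k + 1) \<kappa> i \<le> k" if "1 \<le> i" "i \<le> size \<kappa>" for i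
    using row_count_less[OF g that(1)] row_count_gt_iff[OF g that(1), of 0] window_0_less_bead[OF g p that]
    by simp
  then show ?thesis unfolding k_bounded_iff core_to_bounded_eq by auto
qed

lemma k_bounded_col_eq_0: "\<nu> \<in> k_bounded k \<Longrightarrow> k \<le> t \<Longrightarrow> col \<nu> t = 0"
  by (auto simp: k_bounded_iff col_def)

lemma k_bounded_eqI:
  assumes "\<mu> \<in> k_bounded k" "\<nu> \<in> k_bounded k" "\<And>t. t < k \<Longrightarrow> col \<mu> t = col \<nu> t"
  shows "\<mu> = \<nu>"
proof (rule col_eqI)
  show "is_partition \<mu>" "is_partition \<nu>" using assms(1,2) by (auto simp: k_bounded_def)
  fix t show "col \<mu> t = col \<nu> t"
    using assms(3)[of t] k_bounded_col_eq_0[OF assms(1), of t] k_bounded_col_eq_0[OF assms(2), of t]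
    by (cases "t < k") auto
qed

text \<open>The elements are \<open>y - n\<close>, \<open>y - 2 n\<close> and so on, as long as they
  exceed \<open>x\<close>. If \<open>x\<close> were congruent to \<open>y\<close>, the quotient
  could count \<open>x\<close> itself as well.\<close>

lemma card_cong_interval:
  fixes x y :: int
  assumes "0 < n" "\<not> [x = y] (mod int n)"
  shows "card {b. x < b \<and> b < y \<and> [b = y] (mod int n)} = nat ((y - x) div int n)"
proof -
  have "bij_betw (\<lambda>j. y - int n * int j) {1..nat ((y - x) div int n)} 
      {b. x < b \<and> b < y \<and> [b = y] (mod int n)}"
  proof (rule bij_betw_imageI)
    show "inj_on (\<lambda>j. y - int n * int j) {1..nat ((y - x) div int n)}"
      using assms(1) by (auto intro!: inj_onI)
    have nd: "int n * c \<noteq> y - x" for c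
      using assms(2) by (metis cong_iff_dvd_diff cong_sym_eq dvd_triv_left)
    have lt: "int n * c < y - x \<longleftrightarrow> c \<le> (y - x) div int n" for c
    proof -
      let ?d = "(y - x) div int n"
      have d: "y - x = int n * ?d + (y - x) mod int n" "0 \<le> (y - x) mod int n" "(y - x) mod int n < int n"
        using assms(1) by simp_all
      have "int n * c \<le> int n * ?d" if "c \<le> ?d" using that by (simp add: mult_left_mono)
      moreover have "int n * (?d + 1) \<le> int n * c" if "\<not> c \<le> ?d" using that by (intro mult_left_mono) auto
      moreover have "int n * (?d + 1) = int n * ?d + int n" by (simp add: algebra_simps)
      ultimately have "c \<le> ?d \<longleftrightarrow> int n * c \<le> y - x"
        using d by linarith
      then show ?thesis using nd[of c] by linarith
    qed
    show "(\<lambda>j. y - int n * int j) ` {1..nat ((y - x) div int n)} =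
        {b. x < b \<and> b < y \<and> [b = y] (mod int n)}"
    proof (intro equalityI subsetI)
      fix b assume "b \<in> (\<lambda>j. y - int n * int j) ` {1..nat ((y - x) div int n)}"
      then obtain j where "b = y - int n * int j" "j \<in> {1..nat ((y - x) div int n)}" by blast
      then have j: "b = y - int n * int j" "1 \<le> j" "int j \<le> (y - x) div int n" by auto
      then have "x < b" using lt[of "int j"] by simp
      moreover have "b < y" using j assms(1) by simp
      ultimately show "b \<in> {b. x < b \<and> b < y \<and> [b = y] (mod int n)}"
        using j by (simp add: cong_iff_dvd_diff)
    next
      fix b assume b: "b \<in> {b. x < b \<and> b < y \<and> [b = y] (mod int n)}"
      then obtain c where c: "y - b = int n * c"
        by (metis (mono_tags, lifting) cong_iff_dvd_diff cong_sym_eq dvd_def mem_Collect_eq)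
      then have "0 < int n * c" using b by simp
      then have "0 < c" using assms(1) by (simp add: zero_less_mult_iff)
      moreover have "c \<le> (y - x) div int n" using lt[of c] c b by auto
      ultimately show "b \<in> (\<lambda>j. y - int n * int j) ` {1..nat ((y - x) div int n)}"
        using c by (intro image_eqI[of _ _ "nat c"]) auto
    qed
  qed
  then show ?thesis using bij_betw_same_card by fastforce
qed

text \<open>The number of beads above \<open>g t\<close>, sorted by residue class: the class of
  \<open>g q\<close> contributes those between \<open>g t\<close> and \<open>g q\<close>. Only
  differences occur, so translations leave it alone.\<close>

definition window_col :: "nat \<Rightarrow> (nat \<Rightarrow> int) \<Rightarrow> nat \<Rightarrow> nat" where
  "window_col n g t = (\<Sum>q\<in>{t<..<n}. nat ((g q - g t) div int n))"

lemma card_below_gt: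
  assumes w: "window n g" and t: "t < n"
  shows "finite {b \<in> below n g. g t < b}" "card {b \<in> below n g. g t < b} = window_col n g t"
proof -
  let ?A = "\<lambda>q. {b. g t < b \<and> b < g q \<and> [b = g q] (mod int n)}"
  have eq: "{b \<in> below n g. g t < b} = (\<Union>q\<in>{t<..<n}. ?A q)"
  proof (intro equalityI subsetI)
    fix b assume "b \<in> {b \<in> below n g. g t < b}"
    then obtain q where q: "q < n" "b < g q" "[b = g q] (mod int n)" "g t < b" by (auto simp: below_def)
    then have "t < q" using window_less_iff[OF w t q(1)] by simp
    then show "b \<in> (\<Union>q\<in>{t<..<n}. ?A q)" using q by auto
  qed (auto simp: below_def)
  have fin: "finite (?A q)" for q by (rule finite_subset[of _ "{g t..g q}"]) auto
  show "finite {b \<in> below n g. g t < b}" unfolding eq using fin by simp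
  have "card (\<Union>q\<in>{t<..<n}. ?A q) = (\<Sum>q\<in>{t<..<n}. card (?A q))"
  proof (rule card_UN_disjoint)
    show "\<forall>i\<in>{t<..<n}. \<forall>j\<in>{t<..<n}. i \<noteq> j \<longrightarrow> ?A i \<inter> ?A j = {}"
    proof (intro ballI impI)
      fix i j assume ij: "i \<in> {t<..<n}" "j \<in> {t<..<n}" "i \<noteq> j"
      have "\<not> ([b = g i] (mod int n) \<and> [b = g j] (mod int n))" for b
        using window_cong[OF w, of i j] ij cong_trans[OF cong_sym, of b "g i" "int n" "g j"] by auto
      then show "?A i \<inter> ?A j = {}" by blast
    qed
  qed (use fin in auto)
  also have "\<dots> = window_col n g t" unfolding window_col_def
    using window_cong[OF w t] t
    by (intro sum.cong refl card_cong_interval) (auto dest: less_imp_neq)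
  finally show "card {b \<in> below n g. g t < b} = window_col n g t" unfolding eq .
qed

lemma col_core_to_bounded':
  assumes w: "window (k + 1) g" and b: "below (k + 1) g = beads \<kappa>" and t: "t < k + 1"
  shows "col (core_to_bounded k \<kappa>) t = window_col (k + 1) g t"
proof -
  have "bij_betw (bead \<kappa>) {i. 1 \<le> i \<and> g t < bead \<kappa> i} {b \<in> below (k + 1) g. g t < b}"
    unfolding b by (rule bij_betw_imageI) (auto intro: inj_on_subset[OF bead_inj] simp: beads_def)
  then show ?thesis
    using col_core_to_bounded[OF assms] card_below_gt(2)[OF w t] bij_betw_same_card by metis
qed

section \<open>Horizontal strips as bead moves\<close>

lemma beads_inj:
  assumes "is_partition \<mu>" "is_partition \<nu>" "\<And>i. 1 \<le> i \<Longrightarrow> bead \<mu> i = bead \<nu> i"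
  shows "\<mu> = \<nu>"
  using partition_eqI[OF assms(1,2)] assms(3) by (simp add: bead_def)

lemma row_count_antimono:
  assumes "window n g" "below n g = beads \<nu>" "1 \<le> i" "i \<le> j"
  shows "row_count n \<nu> j \<le> row_count n \<nu> i"
proof -
  have "bead \<nu> j \<le> bead \<nu> i" using bead_le assms by blast
  then have "{q. q < n \<and> g q < bead \<nu> j} \<subseteq> {q. q < n \<and> g q < bead \<nu> i}" by auto
  then have "card {q. q < n \<and> g q < bead \<nu> j} \<le> card {q. q < n \<and> g q < bead \<nu> i}"
    by (intro card_mono) auto
  then show ?thesis using row_count_window[OF assms(1,2)] assms(3,4) by simp
qed

lemma part_core_to_bounded:
  assumes "\<kappa> \<in> cores k" "1 \<le> i" "i \<le> size \<kappa>"
  shows "part (core_to_bounded k \<kappa>) i = row_count (k + 1) \<kappa> i"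
proof -
  obtain g where g: "window (k + 1) g" "below (k + 1) g = beads \<kappa>"
    using core_window_exists[OF assms(1)] .
  show ?thesis unfolding core_to_bounded_eq
    by (rule part_of_antimono) (use row_count_antimono[OF g] assms in auto)
qed

text \<open>Raising the bead from \<open>b\<close> to \<open>b'\<close> over fixed lower beads gains
  the \<open>b' - b\<close> gaps from \<open>b\<close> to \<open>b' - 1\<close>. It loses the gaps
  in the \<open>b' - b\<close> positions ending at \<open>b' - n\<close>, which are fewer because
  periodicity puts a bead at \<open>b' - n\<close>.\<close>

lemma row_count_less_if_bead_less:
  assumes n: "0 < n" and per: "periodic n (beads \<kappa>')" and i: "1 \<le> i"
    and eq: "\<And>j. i < j \<Longrightarrow> bead \<kappa> j = bead \<kappa>' j" and less: "bead \<kappa> i < bead \<kappa>' i"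
  shows "row_count n \<kappa> i < row_count n \<kappa>' i"
proof -
  define b b' A where "b = bead \<kappa> i" and "b' = bead \<kappa>' i" and "A = bead \<kappa> ` {i<..}"
  have A': "A = bead \<kappa>' ` {i<..}" unfolding A_def using eq by auto
  have Ab: "x < b" if "x \<in> A" for x using that i bead_less by (auto simp: A_def b_def)
  have bl: "x \<in> beads \<nu> \<longleftrightarrow> x \<in> bead \<nu> ` {i<..}" if "x < bead \<nu> i" for x \<nu>
    using that bead_le[of _ i \<nu>] i by (force simp: beads_def not_le[symmetric])
  have B: "{b - int n<..b} - beads \<kappa> = {b - int n<..<b} - A"
  proof (rule set_eqI)
    fix x
    have "x \<noteq> b" if "x \<notin> beads \<kappa>" using that bead_in_beads[OF i] b_def by metis
    then show "x \<in> {b - int n<..b} - beads \<kappa> \<longleftrightarrow> x \<in> {b - int n<..<b} - A"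
      using bl[of x \<kappa>] unfolding A_def b_def by force
  qed
  have B': "{b' - int n<..b'} - beads \<kappa>' = {b' - int n<..<b'} - A"
  proof (rule set_eqI)
    fix x
    have "x \<noteq> b'" if "x \<notin> beads \<kappa>'" using that bead_in_beads[OF i] b'_def by metis
    then show "x \<in> {b' - int n<..b'} - beads \<kappa>' \<longleftrightarrow> x \<in> {b' - int n<..<b'} - A"
      using bl[of x \<kappa>'] unfolding A' b'_def by force
  qed
  have bn: "b' - int n \<in> A"
  proof -
    have "b' - int n \<in> beads \<kappa>'"
      using per bead_in_beads[OF i, of \<kappa>'] unfolding periodic_def b'_def by blast
    then show ?thesis using bl[of "b' - int n" \<kappa>'] n unfolding A' b'_def by simp
  qed
  then have lt: "b' - int n < b" by (rule Ab)
  define C where "C = {b' - int n<..<b} - A"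
  have "{b - int n<..<b} - A \<subseteq> C \<union> {b - int n<..<b' - int n}"
  proof
    fix x assume x: "x \<in> {b - int n<..<b} - A"
    then have "x \<noteq> b' - int n" using bn by auto
    then show "x \<in> C \<union> {b - int n<..<b' - int n}" using x by (auto simp: C_def)
  qed
  then have "card ({b - int n<..<b} - A) \<le> card (C \<union> {b - int n<..<b' - int n})"
    by (intro card_mono) (auto simp: C_def)
  also have "\<dots> \<le> card C + card {b - int n<..<b' - int n}" by (rule card_Un_le)
  also have "\<dots> < card C + card {b..<b'}" using less by (simp add: b_def b'_def)
  also have "\<dots> = card (C \<union> {b..<b'})" by (rule card_Un_disjoint[symmetric]) (auto simp: C_def)
  also have "\<dots> \<le> card ({b' - int n<..<b'} - A)"
    by (rule card_mono) (use lt less Ab in \<open>auto simp: C_def b_def[symmetric] b'_def[symmetric] dest!: Ab\<close>)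
  finally show ?thesis unfolding row_count_def using B B' by (simp add: b_def b'_def)
qed

text \<open>The number of rows is visible in the image, and beyond it the beads are fixed. The
  remaining beads are recovered in order of decreasing row index, since the row count is strictly
  increasing in the bead once the later ones are known.\<close>

lemma core_to_bounded_inj: "inj_on (core_to_bounded k) (cores k)"
proof (rule inj_onI)
  fix \<kappa> \<kappa>' assume c: "\<kappa> \<in> cores k" "\<kappa>' \<in> cores k" and e: "core_to_bounded k \<kappa> = core_to_bounded k \<kappa>'"
  define m where "m = size \<kappa>"
  have m: "size \<kappa>' = m" using arg_cong[OF e, of size] by (simp add: m_def core_to_bounded_eq)
  have per: "periodic (k + 1) (beads \<kappa>)" "periodic (k + 1) (beads \<kappa>')"
    and p: "is_partition \<kappa>" "is_partition \<kappa>'"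
    using c core_iff_periodic by auto
  have rc: "row_count (k + 1) \<kappa> i = row_count (k + 1) \<kappa>' i" if "1 \<le> i" "i \<le> m" for i
    using part_core_to_bounded[OF c(1) that(1)] part_core_to_bounded[OF c(2) that(1)] that e m m_def
    by simp
  have "\<forall>j>m - d. bead \<kappa> j = bead \<kappa>' j" for d
  proof (induction d)
    case 0
    then show ?case using bead_beyond[of \<kappa>] bead_beyond[of \<kappa>'] m m_def by auto
  next
    case (Suc d)
    show ?case
    proof (cases "d < m")
      case True
      define i where "i = m - d"
      have i: "1 \<le> i" "i \<le> m" "m - Suc d = i - 1" using True by (auto simp: i_def)
      have eq: "\<And>j. i < j \<Longrightarrow> bead \<kappa> j = bead \<kappa>' j" using Suc by (simp add: i_def)
      have "bead \<kappa> i = bead \<kappa>' i"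
        using row_count_less_if_bead_less[of "k + 1" \<kappa>' i \<kappa>, OF _ per(2) i(1) eq]
          row_count_less_if_bead_less[of "k + 1" \<kappa> i \<kappa>', OF _ per(1) i(1) eq[symmetric]] rc[OF i(1,2)]
        by (metis add_gr_0 less_irrefl linorder_neqE zero_less_one)
      then have "bead \<kappa> j = bead \<kappa>' j" if "i - 1 < j" for j
        using that eq by (cases "j = i") auto
      then show ?thesis using i(3) by simp
    next
      case False
      then show ?thesis using Suc by simp
    qed
  qed
  from this[of m] show "\<kappa> = \<kappa>'" using beads_inj[OF p] by simp
qed

lemma bounded_to_core_eq:
  "\<kappa> \<in> cores k \<Longrightarrow> bounded_to_core k (core_to_bounded k \<kappa>) = \<kappa>"
  unfolding bounded_to_core_def by (rule inv_into_f_f[OF core_to_bounded_inj])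

text \<open>Two new cells in one column arise iff row \<open>i + 1\<close> of \<kappa> reaches
  beyond row \<open>i\<close> of \<tau> for some \<open>i\<close>; the row number in
  \<open>bead\<close> turns the weak interlacing of parts into a strict one.\<close>

lemma horizontal_strip_iff:
  "horizontal_strip \<kappa> \<tau> \<longleftrightarrow> (\<forall>i\<ge>1. bead \<tau> i \<le> bead \<kappa> i \<and> bead \<kappa> (i + 1) < bead \<tau> i)"
proof
  assume h: "horizontal_strip \<kappa> \<tau>"
  have sub: "part \<tau> i \<le> part \<kappa> i" if "1 \<le> i" for i
  proof (cases "part \<tau> i = 0")
    case False
    then have "(i, part \<tau> i) \<in> diagram \<tau>" using that by (simp add: mem_diagram)
    then have "(i, part \<tau> i) \<in> diagram \<kappa>" using h unfolding horizontal_strip_def by blast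
    then show ?thesis by (simp add: mem_diagram)
  qed simp
  have "part \<kappa> (i + 1) \<le> part \<tau> i" if "1 \<le> i" for i
  proof (rule ccontr)
    assume n: "\<not> part \<kappa> (i + 1) \<le> part \<tau> i"
    let ?j = "part \<kappa> (i + 1)"
    have "?j \<le> part \<kappa> i" "part \<tau> (i + 1) \<le> part \<tau> i" using that by (auto intro: part_antimono)
    then have "(i, ?j) \<in> diagram \<kappa> - diagram \<tau>" "(i + 1, ?j) \<in> diagram \<kappa> - diagram \<tau>"
      using n that by (auto simp: mem_diagram)
    then have "(i, ?j) = (i + 1, ?j)"
      using h unfolding horizontal_strip_def by (metis inj_onD snd_conv)
    then show False by simp
  qed
  then show "\<forall>i\<ge>1. bead \<tau> i \<le> bead \<kappa> i \<and> bead \<kappa> (i + 1) < bead \<tau> i"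
    using sub by (fastforce simp: bead_def)
next
  assume h: "\<forall>i\<ge>1. bead \<tau> i \<le> bead \<kappa> i \<and> bead \<kappa> (i + 1) < bead \<tau> i"
  have sub: "part \<tau> i \<le> part \<kappa> i" and int: "part \<kappa> (i + 1) \<le> part \<tau> i" if "1 \<le> i" for i
  proof -
    have "bead \<tau> i \<le> bead \<kappa> i" "bead \<kappa> (i + 1) < bead \<tau> i" using h that by blast+
    then show "part \<tau> i \<le> part \<kappa> i" "part \<kappa> (i + 1) \<le> part \<tau> i" by (auto simp: bead_def)
  qed
  have ne: False if "(i, j) \<in> diagram \<kappa> - diagram \<tau>" "(i', j) \<in> diagram \<kappa> - diagram \<tau>" "i < i'" for i i' j
  proof -
    have "part \<kappa> i' \<le> part \<kappa> (i + 1)" using that by (intro part_antimono) auto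
    then show False using that int[of i] by (auto simp: mem_diagram)
  qed
  show "horizontal_strip \<kappa> \<tau>"
    unfolding horizontal_strip_def
  proof
    show "diagram \<tau> \<subseteq> diagram \<kappa>" using sub le_trans unfolding diagram_def by blast
    show "inj_on snd (diagram \<kappa> - diagram \<tau>)"
    proof (rule inj_onI)
      fix c c' assume "c \<in> diagram \<kappa> - diagram \<tau>" "c' \<in> diagram \<kappa> - diagram \<tau>" "snd c = snd c'"
      then show "c = c'" using ne by (metis linorder_neqE_nat prod.collapse)
    qed
  qed
qed

section \<open>Contents of the added cells and the change of the core size\<close>

lemma finite_int_interval_Collect: "finite {x :: int. a < x \<and> x \<le> b \<and> P x}"
  by (rule finite_subset[of _ "{a<..b}"]) auto

text \<open>The contents of the cells added in row \<open>i\<close> are the positions that its bead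
  passes on the way up, the new position included.\<close>

definition hop :: "nat multiset \<Rightarrow> nat multiset \<Rightarrow> int set" where
  "hop \<kappa> \<tau> = (\<Union>i\<in>{1..}. {bead \<tau> i<..bead \<kappa> i})"

lemma residue_image: "residue k ` (diagram \<kappa> - diagram \<tau>) = (\<lambda>x. x mod int (k + 1)) ` hop \<kappa> \<tau>"
proof (intro equalityI subsetI)
  fix r assume "r \<in> residue k ` (diagram \<kappa> - diagram \<tau>)"
  then obtain i j where ij: "(i, j) \<in> diagram \<kappa> - diagram \<tau>" "r = residue k (i, j)" by auto
  then have "bead \<tau> i < int j - int i" "int j - int i \<le> bead \<kappa> i" "1 \<le> i"
    by (auto simp: bead_def mem_diagram)
  then have "int j - int i \<in> hop \<kappa> \<tau>" unfolding hop_def by auto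
  then show "r \<in> (\<lambda>x. x mod int (k + 1)) ` hop \<kappa> \<tau>" using ij(2) by (auto simp: add.commute)
next
  fix r assume "r \<in> (\<lambda>x. x mod int (k + 1)) ` hop \<kappa> \<tau>"
  then obtain x i where x: "r = x mod int (k + 1)" "1 \<le> i" "bead \<tau> i < x" "x \<le> bead \<kappa> i"
    by (auto simp: hop_def)
  define j where "j = nat (x + int i)"
  have j: "int j = x + int i" using x by (simp add: j_def bead_def)
  have "(i, j) \<in> diagram \<kappa> - diagram \<tau>" using x j by (auto simp: mem_diagram bead_def)
  moreover have "residue k (i, j) = r" using j x by (simp add: add.commute)
  ultimately show "r \<in> residue k ` (diagram \<kappa> - diagram \<tau>)" by (metis image_eqI)
qed

text \<open>The configuration after every bead has climbed as long as the next position lies in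
  \<open>H\<close>: a position ends up occupied if it was occupied or reached and the climb does not
  continue from it. It recovers the new beads from the set of contents alone.\<close>

definition flow :: "int set \<Rightarrow> int set \<Rightarrow> int set" where
  "flow B H = {x. x + 1 \<notin> H \<and> (x \<in> B \<or> x \<in> H)}"

context
  fixes \<kappa> \<tau> :: "nat multiset"
  assumes strip: "horizontal_strip \<kappa> \<tau>"
begin

lemma strip_le: "1 \<le> i \<Longrightarrow> bead \<tau> i \<le> bead \<kappa> i"
  and strip_less: "1 \<le> i \<Longrightarrow> bead \<kappa> (i + 1) < bead \<tau> i"
  using strip unfolding horizontal_strip_iff by auto

lemma hop_iff: "x \<in> hop \<kappa> \<tau> \<longleftrightarrow> (\<exists>i\<ge>1. bead \<tau> i < x \<and> x \<le> bead \<kappa> i)"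
  by (auto simp: hop_def)

lemma hop_notin:
  assumes "x \<in> hop \<kappa> \<tau>" shows "x \<notin> beads \<tau>"
proof
  assume "x \<in> beads \<tau>"
  then obtain j where j: "1 \<le> j" "x = bead \<tau> j" by (rule beadsE)
  obtain i where i: "1 \<le> i" "bead \<tau> i < x" "x \<le> bead \<kappa> i" using assms hop_iff by auto
  then have "j < i" using bead_less_iff[of i j \<tau>] bead_less_iff[of j i \<tau>] j by auto
  then have "bead \<kappa> i \<le> bead \<kappa> (j + 1)" using j by (intro bead_le) auto
  then show False using strip_less[OF j(1)] i j by simp
qed

lemma hop_Suc_notin:
  assumes "x + 1 \<in> hop \<kappa> \<tau>" shows "x \<notin> beads \<kappa>"
proof
  assume "x \<in> beads \<kappa>"
  then obtain j where j: "1 \<le> j" "x = bead \<kappa> j" by (rule beadsE)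
  obtain i where i: "1 \<le> i" "bead \<tau> i < x + 1" "x + 1 \<le> bead \<kappa> i" using assms hop_iff by auto
  then have "i < j" using bead_less_iff[of i j \<kappa>] j by auto
  then have "bead \<kappa> j \<le> bead \<kappa> (i + 1)" using i by (intro bead_le) auto
  then show False using strip_less[OF i(1)] i j by simp
qed

lemma hop_path:
  assumes "x \<in> hop \<kappa> \<tau>"
  obtains \<beta> where "\<beta> \<in> beads \<tau>" "\<beta> < x" "{\<beta><..x} \<subseteq> hop \<kappa> \<tau>"
proof -
  obtain i where i: "1 \<le> i" "bead \<tau> i < x" "x \<le> bead \<kappa> i" using assms hop_iff by auto
  then have "{bead \<tau> i<..x} \<subseteq> hop \<kappa> \<tau>" unfolding hop_iff subset_iff by auto
  then show ?thesis using that bead_in_beads[OF i(1)] i by blast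
qed

lemma beads_flow: "beads \<kappa> = flow (beads \<tau>) (hop \<kappa> \<tau>)"
proof (rule set_eqI)
  fix x
  show "x \<in> beads \<kappa> \<longleftrightarrow> x \<in> flow (beads \<tau>) (hop \<kappa> \<tau>)"
  proof
    assume x: "x \<in> beads \<kappa>"
    then obtain i where i: "1 \<le> i" "x = bead \<kappa> i" by (rule beadsE)
    have "x \<in> beads \<tau> \<or> x \<in> hop \<kappa> \<tau>"
      using i strip_le[OF i(1)] bead_in_beads[OF i(1), of \<tau>] by (cases "bead \<tau> i = x") (auto simp: hop_iff)
    then show "x \<in> flow (beads \<tau>) (hop \<kappa> \<tau>)" using x hop_Suc_notin by (auto simp: flow_def)
  next
    assume "x \<in> flow (beads \<tau>) (hop \<kappa> \<tau>)"
    then have n: "x + 1 \<notin> hop \<kappa> \<tau>" and o: "x \<in> beads \<tau> \<or> x \<in> hop \<kappa> \<tau>" by (auto simp: flow_def)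
    from o have "\<exists>i\<ge>1. bead \<tau> i \<le> x \<and> x \<le> bead \<kappa> i"
    proof
      assume "x \<in> beads \<tau>"
      then obtain i where "1 \<le> i" "x = bead \<tau> i" by (rule beadsE)
      then show ?thesis using strip_le by auto
    next
      assume "x \<in> hop \<kappa> \<tau>"
      then show ?thesis unfolding hop_iff using less_imp_le by blast
    qed
    then obtain i where i: "1 \<le> i" "bead \<tau> i \<le> x" "x \<le> bead \<kappa> i" by blast
    then have "x = bead \<kappa> i" using n unfolding hop_iff by force
    then show "x \<in> beads \<kappa>" using bead_in_beads[OF i(1)] by simp
  qed
qed

lemma hop_finite_union:
  assumes "size \<kappa> \<le> m" "size \<tau> \<le> m"
  shows "hop \<kappa> \<tau> = (\<Union>i\<in>{1..m}. {bead \<tau> i<..bead \<kappa> i})"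
proof -
  have "{bead \<tau> i<..bead \<kappa> i} = {}" if "\<not> i \<le> m" for i
    using bead_beyond[of \<kappa> i] bead_beyond[of \<tau> i] assms that by simp
  then show ?thesis unfolding hop_def by fastforce
qed

lemma finite_hop: "finite (hop \<kappa> \<tau>)"
  using hop_finite_union[of "max (size \<kappa>) (size \<tau>)"] by simp

text \<open>Two changes are separated: first the interval of \<open>n\<close> positions climbs with
  bead \<open>i\<close> over the old beads, then the beads inside the interval are moved.\<close>

lemma row_count_strip:
  assumes n: "0 < n" and i: "1 \<le> i"
  shows "row_count n \<kappa> i + (if bead \<kappa> i - int n + 1 \<in> hop \<kappa> \<tau> then 1 else 0) =
    row_count n \<tau> i + card {x \<in> {bead \<tau> i<..bead \<kappa> i}. x - int n \<in> beads \<tau>}"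
proof -
  define B H where "B = beads \<tau>" and "H = hop \<kappa> \<tau>"
  \<comment> \<open>The old gaps among the \<open>n\<close> positions ending at \<open>x\<close>. A
    step onto the gap \<open>x + 1\<close> gains one gap at the top and loses one at the bottom
    unless \<open>x + 1 - n\<close> is a bead, so it grows exactly for the positions counted on the
    right.\<close>
  define \<Gamma> where "\<Gamma> x = card ({x - int n<..x} - B)" for x
  have step: "\<Gamma> (x + 1) = \<Gamma> x + (if x + 1 - int n \<in> B then 1 else 0)" if "x + 1 \<notin> B" for x
  proof -
    let ?C = "{x + 1 - int n<..x} - B"
    have 1: "{x + 1 - int n<..x + 1} - B = insert (x + 1) ?C" using that n by auto
    have 2: "{x - int n<..x} - B = (if x + 1 - int n \<in> B then ?C else insert (x + 1 - int n) ?C)"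
    proof -
      have "{x - int n<..x} = insert (x + 1 - int n) {x + 1 - int n<..x}" using n by auto
      then show ?thesis by auto
    qed
    show ?thesis unfolding \<Gamma>_def 1 2 by simp
  qed
  have up: "\<Gamma> (bead \<tau> i + int d) = \<Gamma> (bead \<tau> i) + card {x \<in> {bead \<tau> i<..bead \<tau> i + int d}. x - int n \<in> B}"
    if "bead \<tau> i + int d \<le> bead \<kappa> i" for d
    using that
  proof (induction d)
    case (Suc d)
    let ?x = "bead \<tau> i + int d"
    have "?x + 1 \<in> H" using Suc.prems i by (auto simp: H_def hop_iff)
    then have "?x + 1 \<notin> B" using hop_notin by (simp add: H_def B_def)
    have "{x \<in> {bead \<tau> i<..?x + 1}. x - int n \<in> B} =
      {x \<in> {bead \<tau> i<..?x}. x - int n \<in> B} \<union> (if ?x + 1 - int n \<in> B then {?x + 1} else {})"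
      by auto (smt (verit))+
    then have "card {x \<in> {bead \<tau> i<..?x + 1}. x - int n \<in> B} =
      card {x \<in> {bead \<tau> i<..?x}. x - int n \<in> B} + (if ?x + 1 - int n \<in> B then 1 else 0)"
      by (simp add: card_insert_if finite_int_interval_Collect)
    then show ?case using step[OF \<open>?x + 1 \<notin> B\<close>] Suc by (simp add: add.assoc add.commute[of 1])
  qed simp
  have 1: "\<Gamma> (bead \<kappa> i) = row_count n \<tau> i + card {x \<in> {bead \<tau> i<..bead \<kappa> i}. x - int n \<in> beads \<tau>}"
    using up[of "nat (bead \<kappa> i - bead \<tau> i)"] strip_le[OF i] by (simp add: \<Gamma>_def row_count_def B_def)
  define x where "x = bead \<kappa> i"
  define W where "W = {x - int n<..x}"
  have xH: "x + 1 \<notin> H" using hop_Suc_notin[of x] bead_in_beads[OF i, of \<kappa>] by (auto simp: x_def H_def)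
  \<comment> \<open>The gaps untouched by the move. Besides them, the old gaps are the positions of
    \<open>H\<close> and the new gaps are the positions directly below one of
    \<open>H\<close>.\<close>
  define D where "D = W - B - H"
  have e1: "W - beads \<kappa> = {y \<in> W. y + 1 \<in> H} \<union> D"
    unfolding beads_flow flow_def D_def B_def H_def by auto
  have dj1: "{y \<in> W. y + 1 \<in> H} \<inter> D = {}"
  proof -
    have "y \<in> B \<or> y \<in> H" if y: "y + 1 \<in> H" for y
    proof -
      obtain \<beta> where \<beta>: "\<beta> \<in> B" "\<beta> < y + 1" "{\<beta><..y + 1} \<subseteq> H"
        using hop_path[of "y + 1"] y unfolding H_def B_def by metis
      then have "y = \<beta> \<or> y \<in> {\<beta><..y + 1}" by auto
      then show ?thesis using \<beta> by blast
    qed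
    then show ?thesis by (auto simp: D_def)
  qed
  have e2: "W - B = {y \<in> W. y \<in> H} \<union> D" using hop_notin by (auto simp: D_def H_def B_def)
  have dj2: "{y \<in> W. y \<in> H} \<inter> D = {}" by (auto simp: D_def)
  have fin: "finite W" by (simp add: W_def)
  \<comment> \<open>These two sets differ by a translation by one, so only the ends matter:
    \<open>x + 1\<close> is not in \<open>H\<close>, and \<open>x - n + 1\<close> is the possible
    surplus of the old gaps.\<close>
  have c1: "card {y \<in> W. y + 1 \<in> H} = card {z \<in> {x - int n + 1<..x}. z \<in> H}"
  proof (rule bij_betw_same_card[of "\<lambda>y. y + 1"], rule bij_betw_imageI)
    show "(\<lambda>y. y + 1) ` {y \<in> W. y + 1 \<in> H} = {z \<in> {x - int n + 1<..x}. z \<in> H}"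
    proof (intro equalityI subsetI)
      fix z assume "z \<in> (\<lambda>y. y + 1) ` {y \<in> W. y + 1 \<in> H}"
      then show "z \<in> {z \<in> {x - int n + 1<..x}. z \<in> H}"
        using xH by (auto simp: W_def) (metis add.commute le_less not_le zle_add1_eq_le)
    next
      fix z assume "z \<in> {z \<in> {x - int n + 1<..x}. z \<in> H}"
      then show "z \<in> (\<lambda>y. y + 1) ` {y \<in> W. y + 1 \<in> H}"
        by (intro image_eqI[of _ _ "z - 1"]) (auto simp: W_def)
    qed
  qed (auto intro: inj_onI)
  have "{y \<in> W. y \<in> H} = {z \<in> {x - int n + 1<..x}. z \<in> H} \<union> (if x - int n + 1 \<in> H then {x - int n + 1} else {})"
    unfolding W_def using n by auto (smt (verit))+
  then have c2: "card {y \<in> W. y \<in> H} = card {z \<in> {x - int n + 1<..x}. z \<in> H} + (if x - int n + 1 \<in> H then 1 else 0)"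
    by (simp add: card_insert_if finite_int_interval_Collect)
  have "card (W - beads \<kappa>) + (if x - int n + 1 \<in> H then 1 else 0) = card (W - B)"
    unfolding e1 e2 using fin dj1 dj2 c1 c2 by (subst (1 2) card_Un_disjoint) (auto simp: D_def)
  then show ?thesis using 1 unfolding row_count_def \<Gamma>_def W_def x_def H_def B_def by simp
qed

text \<open>The last term counts residues of added contents, each at most once. Hence a strip with as many
  residues as its size has no added content \<open>x\<close> with a bead at \<open>x + k\<close>, and starts each of its
  residue classes at the window.\<close>

lemma core_size_strip:
  "core_size k \<kappa> + card {x \<in> hop \<kappa> \<tau>. x + int k \<in> beads \<kappa>} =
    core_size k \<tau> + card {x \<in> hop \<kappa> \<tau>. x - int (k + 1) \<in> beads \<tau>}"
proof -
  define m where "m = max (size \<kappa>) (size \<tau>)"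
  have m: "size \<kappa> \<le> m" "size \<tau> \<le> m" by (auto simp: m_def)
  let ?n = "k + 1"
  have "(\<Sum>i\<in>{1..m}. row_count ?n \<kappa> i) + (\<Sum>i\<in>{1..m}. if bead \<kappa> i - int ?n + 1 \<in> hop \<kappa> \<tau> then 1 else 0) =
    (\<Sum>i\<in>{1..m}. row_count ?n \<tau> i) + (\<Sum>i\<in>{1..m}. card {x \<in> {bead \<tau> i<..bead \<kappa> i}. x - int ?n \<in> beads \<tau>})"
    unfolding sum.distrib[symmetric] by (rule sum.cong) (use row_count_strip[of ?n] in auto)
  moreover have "(\<Sum>i\<in>{1..m}. if bead \<kappa> i - int ?n + 1 \<in> hop \<kappa> \<tau> then 1 else 0) =
      card {x \<in> hop \<kappa> \<tau>. x + int k \<in> beads \<kappa>}"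
  proof -
    have "(\<Sum>i\<in>{1..m}. if bead \<kappa> i - int ?n + 1 \<in> hop \<kappa> \<tau> then 1 else 0) =
      card {i \<in> {1..m}. bead \<kappa> i - int k \<in> hop \<kappa> \<tau>}"
      by (simp add: sum.If_cases Int_def)
    also have "\<dots> = card {x \<in> hop \<kappa> \<tau>. x + int k \<in> beads \<kappa>}"
    proof (rule bij_betw_same_card[of "\<lambda>i. bead \<kappa> i - int k"], rule bij_betw_imageI)
      show "inj_on (\<lambda>i. bead \<kappa> i - int k) {i \<in> {1..m}. bead \<kappa> i - int k \<in> hop \<kappa> \<tau>}"
        using bead_inj[of \<kappa>] unfolding inj_on_def by simp
      show "(\<lambda>i. bead \<kappa> i - int k) ` {i \<in> {1..m}. bead \<kappa> i - int k \<in> hop \<kappa> \<tau>} =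
          {x \<in> hop \<kappa> \<tau>. x + int k \<in> beads \<kappa>}"
      proof (intro equalityI subsetI)
        fix x assume x: "x \<in> {x \<in> hop \<kappa> \<tau>. x + int k \<in> beads \<kappa>}"
        then obtain i where i: "1 \<le> i" "x + int k = bead \<kappa> i" by (auto elim: beadsE)
        have "i \<le> m"
        proof (rule ccontr)
          assume "\<not> i \<le> m"
          then have "x < - int (size \<tau>)" using i m bead_beyond[of \<kappa> i] by simp
          then show False using low_in_beads hop_notin x by blast
        qed
        then show "x \<in> (\<lambda>i. bead \<kappa> i - int k) ` {i \<in> {1..m}. bead \<kappa> i - int k \<in> hop \<kappa> \<tau>}"
          using i x by (intro image_eqI[of _ _ i]) (auto simp: i(2)[symmetric])
      qed (auto simp: bead_in_beads)
    qed
    finally show ?thesis .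
  qed
  moreover have "(\<Sum>i\<in>{1..m}. card {x \<in> {bead \<tau> i<..bead \<kappa> i}. x - int ?n \<in> beads \<tau>}) =
      card {x \<in> hop \<kappa> \<tau>. x - int ?n \<in> beads \<tau>}"
  proof -
    have "{x \<in> hop \<kappa> \<tau>. x - int ?n \<in> beads \<tau>} =
      (\<Union>i\<in>{1..m}. {x \<in> {bead \<tau> i<..bead \<kappa> i}. x - int ?n \<in> beads \<tau>})"
      unfolding hop_finite_union[OF m] by auto
    also have "card \<dots> = (\<Sum>i\<in>{1..m}. card {x \<in> {bead \<tau> i<..bead \<kappa> i}. x - int ?n \<in> beads \<tau>})"
    proof (rule card_UN_disjoint)
      have "{bead \<tau> i<..bead \<kappa> i} \<inter> {bead \<tau> j<..bead \<kappa> j} = {}" if "1 \<le> i" "i < j" for i j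
        using strip_less[OF that(1)] bead_le[of "i + 1" j \<kappa>] that by fastforce
      then have "{bead \<tau> i<..bead \<kappa> i} \<inter> {bead \<tau> j<..bead \<kappa> j} = {}" if "1 \<le> i" "1 \<le> j" "i \<noteq> j" for i j
        using that by (metis Int_commute linorder_neqE_nat)
      then show "\<forall>i\<in>{1..m}. \<forall>j\<in>{1..m}. i \<noteq> j \<longrightarrow> {x \<in> {bead \<tau> i<..bead \<kappa> i}. x - int ?n \<in> beads \<tau>} \<inter>
          {x \<in> {bead \<tau> j<..bead \<kappa> j}. x - int ?n \<in> beads \<tau>} = {}"
        by fastforce
    qed (auto simp: finite_int_interval_Collect)
    finally show ?thesis by simp
  qed
  ultimately show ?thesis using core_size_eq[OF m(1)] core_size_eq[OF m(2)] by simp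
qed

end

section \<open>Weak strips as moves of windows\<close>

text \<open>Let each bead climb through \<open>H\<close> as far as it can. It stops since
  \<open>H\<close> is finite, it stays below the former place of the next bead since
  \<open>H\<close> avoids beads, and the paths ensure that all of \<open>H\<close> is swept.\<close>

lemma horizontal_strip_of_hops:
  assumes dj: "H \<inter> beads \<tau> = {}" and fin: "finite H"
    and path: "\<And>x. x \<in> H \<Longrightarrow> \<exists>\<beta>\<in>beads \<tau>. \<beta> < x \<and> {\<beta><..x} \<subseteq> H"
  obtains \<kappa> where "is_partition \<kappa>" "horizontal_strip \<kappa> \<tau>" "hop \<kappa> \<tau> = H"
proof -
  \<comment> \<open>The number of steps that bead \<open>i\<close> can climb.\<close>
  define d where "d i = (LEAST d. bead \<tau> i + int d + 1 \<notin> H)" for i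
  define b where "b i = bead \<tau> i + int (d i)" for i
  have ex: "\<exists>d. bead \<tau> i + int d + 1 \<notin> H" for i
  proof (rule ccontr)
    assume "\<not> ?thesis"
    then have "range (\<lambda>d. bead \<tau> i + int d + 1) \<subseteq> H" by auto
    then have "finite (range (\<lambda>d. bead \<tau> i + int d + 1))" using fin finite_subset by blast
    then show False by (subst (asm) finite_image_iff) (auto intro: inj_onI)
  qed
  have nH: "b i + 1 \<notin> H" for i using LeastI_ex[OF ex] by (simp add: b_def d_def)
  have sub: "x \<in> H" if "bead \<tau> i < x" "x \<le> b i" for x i
  proof -
    define e where "e = nat (x - bead \<tau> i - 1)"
    have e: "x = bead \<tau> i + int e + 1" using that by (simp add: e_def)
    then have "e < d i" using that by (simp add: b_def)
    then show ?thesis using not_less_Least[of e "\<lambda>d. bead \<tau> i + int d + 1 \<notin> H"] e by (simp add: d_def)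
  qed
  have ge: "bead \<tau> i \<le> b i" for i by (simp add: b_def)
  have lt: "b (i + 1) < bead \<tau> i" if "1 \<le> i" for i
  proof (rule ccontr)
    assume "\<not> b (i + 1) < bead \<tau> i"
    then have "bead \<tau> i \<in> H" using sub[of "i + 1"] bead_less[of i "i + 1" \<tau>] that by simp
    then show False using dj bead_in_beads[OF that] by blast
  qed
  have ev: "b i = - int i" if "size \<tau> + 1 < i" for i
  proof -
    have "- int i + 1 \<in> beads \<tau>" using that by (intro low_in_beads) auto
    then have "bead \<tau> i + int 0 + 1 \<notin> H" using dj bead_beyond[of \<tau> i] that by auto
    then have "d i = 0" unfolding d_def by (rule Least_eq_0)
    then show ?thesis using bead_beyond[of \<tau> i] that by (simp add: b_def)
  qed
  have dec: "b (Suc i) < b i" if "1 \<le> i" for i using lt[OF that] ge[of i] by simp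
  obtain \<kappa> where \<kappa>: "is_partition \<kappa>" "\<And>i. 1 \<le> i \<Longrightarrow> bead \<kappa> i = b i"
    using partition_of_beads[of b "size \<tau> + 1"] dec ev by blast
  have "horizontal_strip \<kappa> \<tau>" unfolding horizontal_strip_iff using \<kappa>(2) ge lt by simp
  moreover have "hop \<kappa> \<tau> = H"
  proof (intro equalityI subsetI)
    fix x assume "x \<in> hop \<kappa> \<tau>"
    then show "x \<in> H" using sub \<kappa>(2) by (auto simp: hop_def)
  next
    fix x assume x: "x \<in> H"
    obtain \<beta> where \<beta>: "\<beta> \<in> beads \<tau>" "\<beta> < x" "{\<beta><..x} \<subseteq> H" using path[OF x] by auto
    then obtain i where i: "1 \<le> i" "\<beta> = bead \<tau> i" by (auto elim: beadsE)
    have "x \<le> b i"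
    proof (rule ccontr)
      assume "\<not> x \<le> b i"
      then have "b i + 1 \<in> {\<beta><..x}" using ge[of i] i by simp
      then show False using nH \<beta> by blast
    qed
    then show "x \<in> hop \<kappa> \<tau>" using i \<beta> \<kappa>(2)[OF i(1)] unfolding hop_def by auto
  qed
  ultimately show ?thesis using that \<kappa>(1) by blast
qed

definition moved :: "nat \<Rightarrow> (nat \<Rightarrow> int) \<Rightarrow> nat set \<Rightarrow> int \<Rightarrow> bool" where
  "moved n g T x \<longleftrightarrow> (\<exists>u\<in>T. [x = g u] (mod int n))"

text \<open>The part of \<open>strip_step\<close> that involves only \<open>g\<close> and
  \<open>T\<close>: for a proper subset \<open>T\<close> it decides whether a move exists
  (\<open>strip_step_exists\<close>, \<open>step_valid\<close>).\<close>

definition valid :: "nat \<Rightarrow> (nat \<Rightarrow> int) \<Rightarrow> nat set \<Rightarrow> bool" where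
  "valid n g T \<longleftrightarrow> (\<forall>t<n. t \<notin> T \<longrightarrow> (\<forall>i::nat. 1 \<le> i \<longrightarrow>
    (\<forall>j::nat. 1 \<le> j \<longrightarrow> j \<le> i \<longrightarrow> moved n g T (g t + int j)) \<longrightarrow>
    (\<exists>u\<in>T. u < t \<and> [g t + int i = g u] (mod int n))))"

text \<open>The window entries with index in \<open>T\<close> go down by one; every other entry jumps over the maximal run
  of residue classes of \<open>T\<close> that follows it, and has to be larger than the entries in that run.\<close>

definition strip_step :: "nat \<Rightarrow> (nat \<Rightarrow> int) \<Rightarrow> nat set \<Rightarrow> (nat \<Rightarrow> int) \<Rightarrow> bool" where
  "strip_step n g T g' \<longleftrightarrow> T \<subset> {..<n} \<and> (\<forall>t\<in>T. g' t = g t - 1) \<and>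
    (\<forall>t<n. t \<notin> T \<longrightarrow> (\<exists>l::nat. g' t = g t + int l \<and>
      (\<forall>i::nat. 1 \<le> i \<longrightarrow> i \<le> l \<longrightarrow> (\<exists>u\<in>T. u < t \<and> [g t + int i = g u] (mod int n))) \<and>
      \<not> moved n g T (g t + int l + 1)))"

text \<open>The positions reached when beads are pushed up as far as the moved residue classes allow: the
  contents of the cells of the strip.\<close>

definition push :: "nat \<Rightarrow> (nat \<Rightarrow> int) \<Rightarrow> nat set \<Rightarrow> int set" where
  "push n g T = {x. \<exists>\<beta>\<in>below n g. \<beta> < x \<and> (\<forall>y. \<beta> < y \<longrightarrow> y \<le> x \<longrightarrow> moved n g T y \<and> y \<notin> below n g)}"

lemma moved_cong: "[x = y] (mod int n) \<Longrightarrow> moved n g T x \<longleftrightarrow> moved n g T y"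
  unfolding moved_def using cong_trans cong_sym by blast

lemma push_notin: "x \<in> push n g T \<Longrightarrow> x \<notin> below n g"
  and push_moved: "x \<in> push n g T \<Longrightarrow> moved n g T x"
  unfolding push_def by auto

lemma push_path: "x \<in> push n g T \<Longrightarrow> \<exists>\<beta>\<in>below n g. \<beta> < x \<and> {\<beta><..x} \<subseteq> push n g T"
proof -
  assume "x \<in> push n g T"
  then obtain \<beta> where \<beta>: "\<beta> \<in> below n g" "\<beta> < x"
    "\<And>y. \<beta> < y \<Longrightarrow> y \<le> x \<Longrightarrow> moved n g T y \<and> y \<notin> below n g" unfolding push_def by blast
  have "y \<in> push n g T" if "\<beta> < y" "y \<le> x" for y
    unfolding push_def mem_Collect_eq using \<beta> that by (intro bexI[of _ \<beta>]) auto
  then show ?thesis using \<beta> by (intro bexI[of _ \<beta>]) auto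
qed

section \<open>Runs of moved residue classes and the existence of a move\<close>

context
  fixes n :: nat and g :: "nat \<Rightarrow> int" and T :: "nat set"
  assumes w: "window n g" and T: "T \<subset> {..<n}"
begin

lemma window_n_pos: "0 < n" using w by (simp add: window_def)

lemma moved_window:
  assumes "q < n" shows "moved n g T (g q) \<longleftrightarrow> q \<in> T"
proof
  assume "moved n g T (g q)"
  then obtain u where u: "u \<in> T" "[g q = g u] (mod int n)" by (auto simp: moved_def)
  moreover have "u < n" using u(1) T by auto
  ultimately show "q \<in> T" using window_cong[OF w assms] by blast
next
  assume "q \<in> T"
  then show "moved n g T (g q)" unfolding moved_def by (intro bexI[of _ q] cong_refl)
qed

lemma moved_shift: "moved n g T (x + int n) \<longleftrightarrow> moved n g T x"
  by (rule moved_cong) (simp add: cong_iff_dvd_diff)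

text \<open>As \<open>T\<close> is a proper subset, descending from \<open>x\<close> meets an
  unmoved class in fewer than \<open>n\<close> steps. The first one met belongs to some
  \<open>g q\<close>, and \<open>x\<close> lies \<open>i\<close> places into the run that follows
  it.\<close>

lemma anchor:
  assumes "moved n g T x"
  obtains q i where "q < n" "q \<notin> T" "1 \<le> i" "i < n" "[x = g q + int i] (mod int n)"
    "\<And>j. 1 \<le> j \<Longrightarrow> j \<le> i \<Longrightarrow> moved n g T (g q + int j)"
proof -
  obtain q0 where q0: "q0 < n" "q0 \<notin> T" using T by blast
  define d where "d = nat ((x - g q0) mod int n)"
  have d: "int d = (x - g q0) mod int n" using window_n_pos by (simp add: d_def)
  have "x - int d - g q0 = int n * ((x - g q0) div int n)"
    unfolding d minus_mod_eq_mult_div[symmetric] by simp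
  then have "[x - int d = g q0] (mod int n)" by (simp add: cong_iff_dvd_diff)
  then have nd: "\<not> moved n g T (x - int d)" using moved_cong moved_window q0 by blast
  define i where "i = (LEAST i. \<not> moved n g T (x - int i))"
  have ni: "\<not> moved n g T (x - int i)" unfolding i_def by (rule LeastI[of "\<lambda>i. \<not> moved n g T (x - int i)" d]) (rule nd)
  have "i \<le> d" unfolding i_def by (rule Least_le[of "\<lambda>i. \<not> moved n g T (x - int i)" d]) (rule nd)
  moreover have "d < n" using d window_n_pos by (metis of_nat_0_less_iff of_nat_less_iff pos_mod_bound)
  ultimately have i: "i < n" by simp
  have mv: "moved n g T (x - int j)" if "j < i" for j
    using not_less_Least[of j "\<lambda>i. \<not> moved n g T (x - int i)"] that by (simp add: i_def)
  have "i \<noteq> 0" using ni assms by (metis diff_zero of_nat_0)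
  obtain q where q: "q < n" "[x - int i = g q] (mod int n)" using window_cover[OF w] .
  have "q \<notin> T" using ni moved_cong[OF q(2)] moved_window[OF q(1)] by blast
  moreover have c: "[x = g q + int i] (mod int n)" using q(2) cong_move by blast
  moreover have "moved n g T (g q + int j)" if "1 \<le> j" "j \<le> i" for j
  proof -
    have "moved n g T (x - int (i - j))" using that by (intro mv) auto
    moreover have "[x - int (i - j) = g q + int j] (mod int n)"
      using c that by (simp add: cong_iff_dvd_diff of_nat_diff algebra_simps)
    ultimately show ?thesis using moved_cong by blast
  qed
  ultimately show ?thesis using that[OF q(1) _ _ i] \<open>i \<noteq> 0\<close> by (metis One_nat_def Suc_leI gr0I)
qed

lemma strip_step_exists:
  assumes "valid n g T" obtains g' where "strip_step n g T g'"
proof -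
  have ex: "\<exists>l. \<not> moved n g T (g t + int l + 1)" if "t < n" "t \<notin> T" for t
  \<comment> \<open>After \<open>n\<close> positions the class of \<open>g t\<close> returns, and it
    is not moved, so no jump is longer than \<open>n - 1\<close>.\<close>
  proof (rule exI[of _ "n - 1"])
    have "g t + int (n - 1) + 1 = g t + int n" using window_n_pos by simp
    then show "\<not> moved n g T (g t + int (n - 1) + 1)" using moved_shift moved_window that by simp
  qed
  define l where "l t = (LEAST l. \<not> moved n g T (g t + int l + 1))" for t
  define g' where "g' t = (if t \<in> T then g t - 1 else g t + int (l t))" for t
  have "strip_step n g T g'"
    unfolding strip_step_def
  proof (intro conjI allI impI ballI T)
    fix t assume t: "t < n" "t \<notin> T"
    have mv: "moved n g T (g t + int j)" if "1 \<le> j" "j \<le> l t" for j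
      using not_less_Least[of "j - 1" "\<lambda>l. \<not> moved n g T (g t + int l + 1)"] that by (simp add: l_def of_nat_diff)
    show "\<exists>l::nat. g' t = g t + int l \<and>
      (\<forall>i::nat. 1 \<le> i \<longrightarrow> i \<le> l \<longrightarrow> (\<exists>u\<in>T. u < t \<and> [g t + int i = g u] (mod int n))) \<and>
      \<not> moved n g T (g t + int l + 1)"
    proof (intro exI[of _ "l t"] conjI allI impI)
      show "\<not> moved n g T (g t + int (l t) + 1)" unfolding l_def by (rule LeastI_ex[OF ex[OF t]])
      fix i assume "1 \<le> i" "i \<le> l t"
      then show "\<exists>u\<in>T. u < t \<and> [g t + int i = g u] (mod int n)"
        using assms t mv unfolding valid_def by simp
    qed (use t in \<open>simp add: g'_def\<close>)
  qed (simp add: g'_def)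
  then show ?thesis by (rule that)
qed

end

section \<open>A move produces a window whose beads are the old ones pushed upwards\<close>

context
  fixes n :: nat and g g' :: "nat \<Rightarrow> int" and T :: "nat set"
  assumes w: "window n g" and st: "strip_step n g T g'"
begin

lemma step_T: "T \<subset> {..<n}" using st by (simp add: strip_step_def)

lemma step_in: "t \<in> T \<Longrightarrow> g' t = g t - 1" using st by (simp add: strip_step_def)

lemma step_out:
  assumes "t < n" "t \<notin> T"
  obtains l where "g' t = g t + int l"
    "\<And>i. 1 \<le> i \<Longrightarrow> i \<le> l \<Longrightarrow> \<exists>u\<in>T. u < t \<and> [g t + int i = g u] (mod int n)"
    "\<not> moved n g T (g t + int l + 1)"
proof -
  have "\<exists>l::nat. g' t = g t + int l \<and>
      (\<forall>i::nat. 1 \<le> i \<longrightarrow> i \<le> l \<longrightarrow> (\<exists>u\<in>T. u < t \<and> [g t + int i = g u] (mod int n))) \<and>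
      \<not> moved n g T (g t + int l + 1)"
    using st assms unfolding strip_step_def by simp
  then show ?thesis using that by metis
qed

lemma step_out_ge:
  assumes "t < n" "t \<notin> T" shows "g t \<le> g' t"
  by (rule step_out[OF assms]) simp

lemma step_ge: "t < n \<Longrightarrow> g t - 1 \<le> g' t"
  using step_in[of t] step_out_ge[of t] by (cases "t \<in> T") auto

lemma step_valid: "valid n g T"
  unfolding valid_def
proof (intro allI impI)
  fix t i :: nat
  assume t: "t < n" "t \<notin> T" and i: "1 \<le> i"
    and mv: "\<forall>j::nat. 1 \<le> j \<longrightarrow> j \<le> i \<longrightarrow> moved n g T (g t + int j)"
  obtain l where l: "\<And>i. 1 \<le> i \<Longrightarrow> i \<le> l \<Longrightarrow> \<exists>u\<in>T. u < t \<and> [g t + int i = g u] (mod int n)"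
    "\<not> moved n g T (g t + int l + 1)"
    using step_out[OF t] by metis
  have "i \<le> l"
  proof (rule ccontr)
    assume "\<not> i \<le> l"
    then have "moved n g T (g t + int (l + 1))" using mv by (metis le_add2 not_less_eq_eq Suc_eq_plus1)
    moreover have "g t + int (l + 1) = g t + int l + 1" by simp
    ultimately show False using l(2) by metis
  qed
  then show "\<exists>u\<in>T. u < t \<and> [g t + int i = g u] (mod int n)" using l(1) i by blast
qed

text \<open>If \<open>x - i\<close> is a bead, the highest bead from there up to \<open>x\<close>
  climbs to \<open>x\<close> through moved classes. Conversely, a bead reaching \<open>x\<close>
  cannot start below \<open>x - i\<close>, whose class is unmoved; if it starts above,
  \<open>valid\<close> puts it in the class of some \<open>u < q\<close>, hence below
  \<open>g u < g q\<close>.\<close>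

lemma push_iff:
  assumes q: "q < n" "q \<notin> T" and i: "1 \<le> i" and x: "[x = g q + int i] (mod int n)"
    and mv: "\<And>j. 1 \<le> j \<Longrightarrow> j \<le> i \<Longrightarrow> moved n g T (g q + int j)" and xB: "x \<notin> below n g"
  shows "x \<in> push n g T \<longleftrightarrow> x - int i < g q"
proof
  have xi: "[x - int i = g q] (mod int n)" using x cong_move by blast
  {
    assume lt: "x - int i < g q"
    let ?A = "{y \<in> below n g. x - int i \<le> y \<and> y < x}"
    have fin: "finite ?A" by (rule finite_subset[of _ "{x - int i..x}"]) auto
    have ne: "x - int i \<in> ?A" using below_iff[OF w q(1) xi] lt i by simp
    define \<beta> where "\<beta> = Max ?A"
    have \<beta>: "\<beta> \<in> ?A" unfolding \<beta>_def using fin ne by (intro Max_in) auto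
    have "moved n g T y \<and> y \<notin> below n g" if y: "\<beta> < y" "y \<le> x" for y
    proof
      show "y \<notin> below n g"
      proof
        assume "y \<in> below n g"
        then have "y \<in> ?A" using y \<beta> xB by (auto simp: le_less)
        then have "y \<le> \<beta>" unfolding \<beta>_def using fin by (intro Max_ge)
        then show False using y by simp
      qed
      define j where "j = nat (y - (x - int i))"
      have j: "int j = y - (x - int i)" "1 \<le> j" "j \<le> i" using y \<beta> by (auto simp: j_def)
      have "y - (g q + int j) = x - int i - g q" using j(1) by linarith
      then have "[y = g q + int j] (mod int n)" using xi unfolding cong_iff_dvd_diff by (simp only:)
      then show "moved n g T y" using mv[OF j(2,3)] moved_cong by blast
    qed
    then show "x \<in> push n g T" unfolding push_def using \<beta> by blast
  }
  {
    assume "x \<in> push n g T"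
    then obtain \<beta> where \<beta>: "\<beta> \<in> below n g" "\<beta> < x"
      "\<And>y. \<beta> < y \<Longrightarrow> y \<le> x \<Longrightarrow> moved n g T y \<and> y \<notin> below n g" unfolding push_def by blast
    consider "\<beta> < x - int i" | "\<beta> = x - int i" | "x - int i < \<beta>" by linarith
    then show "x - int i < g q"
    proof cases
      case 1
      then have "moved n g T (x - int i)" using \<beta>(3) by simp
      then have "moved n g T (g q)" using moved_cong[OF xi] by simp
      then show ?thesis using moved_window[OF w step_T q(1)] q(2) by simp
    next
      case 2
      then show ?thesis using \<beta>(1) below_iff[OF w q(1) xi] by simp
    next
      case 3
      define j where "j = nat (\<beta> - (x - int i))"
      have j: "int j = \<beta> - (x - int i)" "1 \<le> j" "j \<le> i" using 3 \<beta>(2) by (auto simp: j_def)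
      obtain u where u: "u \<in> T" "u < q" "[g q + int j = g u] (mod int n)"
        using step_valid q j mv unfolding valid_def by (meson le_trans)
      have "\<beta> - (g q + int j) = x - int i - g q" using j(1) by linarith
      then have "[\<beta> = g q + int j] (mod int n)" using xi unfolding cong_iff_dvd_diff by (simp only:)
      then have "[\<beta> = g u] (mod int n)" using cong_trans u(3) by blast
      then have "\<beta> < g u" using below_iff[OF w _, of u \<beta>] \<beta>(1) u(2) q(1) by simp
      then show ?thesis using 3 window_less_iff[OF w, of u q] u(2) q(1) by simp
    qed
  }
qed

text \<open>A jump over \<open>g t'\<close> would pass a position in its class, but all positions of
  the jump belong to classes of indices \<open>u < t < t'\<close>.\<close>

lemma step_less:
  assumes "t < t'" "t' < n" shows "g' t < g t'"
proof (cases "t \<in> T")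
  case True
  then show ?thesis using step_in window_less_iff[OF w, of t t'] assms by simp
next
  case False
  have tn: "t < n" using assms by simp
  obtain l where l: "g' t = g t + int l"
    "\<And>i. 1 \<le> i \<Longrightarrow> i \<le> l \<Longrightarrow> \<exists>u\<in>T. u < t \<and> [g t + int i = g u] (mod int n)"
    using step_out[OF tn False] by metis
  have gt: "g t < g t'" using window_less_iff[OF w tn assms(2)] assms by simp
  show ?thesis
  proof (rule ccontr)
    assume h: "\<not> g' t < g t'"
    define i where "i = nat (g t' - g t)"
    have i: "int i = g t' - g t" "1 \<le> i" "i \<le> l" using gt h l(1) by (auto simp: i_def)
    then obtain u where u: "u \<in> T" "u < t" "[g t + int i = g u] (mod int n)" using l(2) by blast
    then have "[g t' = g u] (mod int n)" using i by simp
    then have "t' = u" using window_cong[OF w assms(2), of u] u(2) tn by simp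
    then show False using u(2) assms by simp
  qed
qed

text \<open>Only the case of an unmoved \<open>t\<close> and a moved \<open>t'\<close> goes beyond
  \<open>step_less\<close>: there \<open>g' t = g t' - 1\<close> is impossible, because a jump does
  not stop directly below a moved class.\<close>

lemma step_strict:
  assumes "t < t'" "t' < n" shows "g' t < g' t'"
proof (cases "t' \<in> T")
  case False
  then show ?thesis using step_less[OF assms] step_out_ge[OF assms(2)] by simp
next
  case t': True
  show ?thesis
  proof (cases "t \<in> T")
    case True
    then show ?thesis using step_in t' window_less_iff[OF w, of t t'] assms by simp
  next
    case False
    obtain l where l: "g' t = g t + int l" "\<not> moved n g T (g t + int l + 1)"
      using step_out[of t] False assms by (metis less_trans)
    have "g t' \<noteq> g' t + 1"
      using l t' moved_window[OF w step_T assms(2)] by metis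
    then show ?thesis using step_less[OF assms] step_in[OF t'] by simp
  qed
qed

text \<open>For \<open>t\<close> in \<open>T\<close>, the place \<open>x + 1\<close> is in a moved
  class, so \<open>x\<close> stays occupied iff the bead that would leave it finds
  \<open>x + 1\<close> already occupied. For other \<open>t\<close> nothing moves on from the class
  of \<open>g' t\<close>, and \<open>push_iff\<close> with the jump length as distance tells which
  of its members are reached.\<close>

lemma flow_iff:
  assumes t: "t < n" and x: "[x = g' t] (mod int n)"
  shows "x \<in> flow (below n g) (push n g T) \<longleftrightarrow> x < g' t"
proof (cases "t \<in> T")
  case True
  have x1: "[x + 1 = g t] (mod int n)" using x step_in[OF True] by (simp add: cong_iff_dvd_diff algebra_simps)
  have mv1: "moved n g T (x + 1)" unfolding moved_def using True x1 by blast
  have "x \<in> flow (below n g) (push n g T) \<longleftrightarrow> x + 1 \<in> below n g"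
  proof
    assume f: "x \<in> flow (below n g) (push n g T)"
    show "x + 1 \<in> below n g"
    proof (rule ccontr)
      assume nb: "x + 1 \<notin> below n g"
      have "\<exists>\<beta>\<in>below n g. \<beta> \<le> x \<and> (\<forall>y. \<beta> < y \<longrightarrow> y \<le> x \<longrightarrow> moved n g T y \<and> y \<notin> below n g)"
        using f unfolding flow_def push_def by fastforce
      then obtain \<beta> where \<beta>: "\<beta> \<in> below n g" "\<beta> \<le> x"
        "\<forall>y. \<beta> < y \<longrightarrow> y \<le> x \<longrightarrow> moved n g T y \<and> y \<notin> below n g" by blast
      have "moved n g T y \<and> y \<notin> below n g" if "\<beta> < y" "y \<le> x + 1" for y
        using \<beta>(3) that nb mv1 by (cases "y = x + 1") auto
      then have "x + 1 \<in> push n g T" unfolding push_def using \<beta>(1,2) by force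
      then show False using f by (simp add: flow_def)
    qed
  next
    assume b: "x + 1 \<in> below n g"
    have nH: "x + 1 \<notin> push n g T" using push_notin b by blast
    moreover have "x \<in> push n g T" if xB: "x \<notin> below n g"
    proof -
      obtain q i where q: "q < n" "q \<notin> T" "1 \<le> i" "i < n" "[x + 1 = g q + int i] (mod int n)"
        "\<And>j. 1 \<le> j \<Longrightarrow> j \<le> i \<Longrightarrow> moved n g T (g q + int j)"
        by (rule anchor[OF w step_T mv1]) blast
      obtain u where u: "u \<in> T" "u < q" "[g q + int i = g u] (mod int n)"
        using step_valid q unfolding valid_def by meson
      \<comment> \<open>The position \<open>x + 1\<close> lies in the run of \<open>q\<close>, so
        \<open>valid\<close> assigns its class to an index below \<open>q\<close>, and this class is
        that of \<open>g t\<close>.\<close>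
      have "u = t" using window_cong[OF w t, of u] cong_trans[OF cong_sym[OF x1] cong_trans[OF q(5) u(3)]] u q by simp
      then have lt: "x + 1 < g q"
        using below_iff[OF w t x1] b window_less_iff[OF w t q(1)] u(2) by simp
      have xi: "[x = g q + int (i - 1)] (mod int n)"
        using q(3,5) by (simp add: cong_iff_dvd_diff of_nat_diff algebra_simps)
      have "i \<noteq> 1"
      proof
        assume "i = 1"
        then have "x \<in> below n g" using below_iff[OF w q(1), of x] xi lt by simp
        then show False using xB by simp
      qed
      then show ?thesis using push_iff[OF q(1,2) _ xi _ xB] q(3,6) lt by simp
    qed
    ultimately show "x \<in> flow (below n g) (push n g T)" by (auto simp: flow_def)
  qed
  also have "\<dots> \<longleftrightarrow> x < g' t" using below_iff[OF w t x1] step_in[OF True] by auto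
  finally show ?thesis .
next
  case False
  obtain l where l: "g' t = g t + int l"
    "\<And>i. 1 \<le> i \<Longrightarrow> i \<le> l \<Longrightarrow> \<exists>u\<in>T. u < t \<and> [g t + int i = g u] (mod int n)"
    "\<not> moved n g T (g t + int l + 1)"
    using step_out[OF t False] by metis
  have xl: "[x = g t + int l] (mod int n)" using x l(1) by simp
  have "[x + 1 = g t + int l + 1] (mod int n)" using xl by (simp add: cong_iff_dvd_diff algebra_simps)
  then have "x + 1 \<notin> push n g T" using push_moved l(3) moved_cong by blast
  then have fl: "x \<in> flow (below n g) (push n g T) \<longleftrightarrow> x \<in> below n g \<or> x \<in> push n g T"
    by (simp add: flow_def)
  show ?thesis
  proof (cases "l = 0")
    case True
    then have xt: "[x = g t] (mod int n)" using xl by simp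
    have "\<not> moved n g T x" using moved_cong[OF xt] moved_window[OF w step_T t] False by simp
    then have "x \<notin> push n g T" using push_moved by blast
    then show ?thesis using fl below_iff[OF w t xt] l(1) True by simp
  next
    case l0: False
    have mv: "moved n g T (g t + int j)" if "1 \<le> j" "j \<le> l" for j
      using l(2)[OF that] unfolding moved_def by blast
    obtain u where u: "u \<in> T" "u < t" "[g t + int l = g u] (mod int n)" using l(2)[of l] l0 by auto
    have xu: "[x = g u] (mod int n)" using cong_trans[OF xl u(3)] .
    show ?thesis
    proof (cases "x \<in> below n g")
      case True
      then have "x < g u" using below_iff[OF w _ xu] u(2) t by simp
      moreover have "g u < g t" using window_less_iff[OF w _ t, of u] u(2) t by simp
      ultimately show ?thesis using fl True l(1) by simp
    next
      case nb: False
      then have "x \<in> push n g T \<longleftrightarrow> x - int l < g t"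
        using push_iff[OF t False _ xl mv] l0 by simp
      then show ?thesis using fl nb l(1) by auto
    qed
  qed
qed

text \<open>Two different entries in one class would, by \<open>flow_iff\<close>, give two different
  half-lines for the same set of new beads.\<close>

lemma step_window: "window n g'"
  unfolding window_def
proof (intro conjI allI impI)
  show "0 < n" using w by (simp add: window_def)
  fix p q assume pq: "p < n" "q < n" and c: "[g' p = g' q] (mod int n)"
  have "\<not> g' p < g' q" using flow_iff[OF pq(1), of "g' p"] flow_iff[OF pq(2) c] by simp
  moreover have "\<not> g' q < g' p" using flow_iff[OF pq(2), of "g' q"] flow_iff[OF pq(1) cong_sym[OF c]] by simp
  ultimately show "p = q" using step_strict[of p q] step_strict[of q p] pq by (metis linorder_neqE_nat)
qed (rule step_strict)

lemma below_step: "below n g' = flow (below n g) (push n g T)"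
proof (rule set_eqI)
  fix x
  obtain t where t: "t < n" "[x = g' t] (mod int n)" using window_cover[OF step_window] .
  show "x \<in> below n g' \<longleftrightarrow> x \<in> flow (below n g) (push n g T)"
    using below_iff[OF step_window t] flow_iff[OF t] by simp
qed

lemma push_bounds:
  assumes x: "x \<in> push n g T"
  shows "g 0 \<le> x" "x \<le> g (n - 1) + int n"
proof -
  have n: "0 < n" using w by (simp add: window_def)
  obtain q where q: "q < n" "[x = g q] (mod int n)" using window_cover[OF w] .
  have "g q \<le> x" using below_iff[OF w q] push_notin[OF x] by simp
  then show "g 0 \<le> x" using window_le_iff[OF w n q(1)] by simp
  obtain p i where p: "p < n" "p \<notin> T" "1 \<le> i" "i < n" "[x = g p + int i] (mod int n)"
    "\<And>j. 1 \<le> j \<Longrightarrow> j \<le> i \<Longrightarrow> moved n g T (g p + int j)"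
    by (rule anchor[OF w step_T push_moved[OF x]]) blast
  have "x - int i < g p" using push_iff[OF p(1,2,3,5,6) push_notin[OF x]] x by simp
  moreover have "g p \<le> g (n - 1)" using window_le_iff[OF w p(1), of "n - 1"] p(1) by simp
  ultimately show "x \<le> g (n - 1) + int n" using p(4) by simp
qed

lemma finite_push: "finite (push n g T)"
  by (rule finite_subset[of _ "{g 0..g (n - 1) + int n}"]) (use push_bounds in auto)

text \<open>The anchor \<open>q\<close> of a moved \<open>g t\<close> satisfies \<open>t < q\<close>
  by \<open>valid\<close>, so the position of the class of \<open>g q\<close> in front of the run is
  below \<open>g q\<close>, hence a bead that can climb.\<close>

lemma window_in_push: 
  assumes "t \<in> T" shows "g t \<in> push n g T"
proof -
  have t: "t < n" using assms step_T by auto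
  have "moved n g T (g t)" using moved_window[OF w step_T t] assms by simp
  from anchor[OF w step_T this] obtain q i where q: "q < n" "q \<notin> T" "1 \<le> i" "i < n" "[g t = g q + int i] (mod int n)"
    "\<And>j. 1 \<le> j \<Longrightarrow> j \<le> i \<Longrightarrow> moved n g T (g q + int j)"
    by blast
  obtain u where u: "u \<in> T" "u < q" "[g q + int i = g u] (mod int n)"
    using step_valid q unfolding valid_def by meson
  have "u = t" using window_cong[OF w t, of u] cong_trans[OF q(5) u(3)] u q by simp
  then have "g t - int i < g q" using window_less_iff[OF w t q(1)] u(2) by simp
  then show ?thesis using push_iff[OF q(1,2,3,5,6) window_notin_below[OF w t]] by simp
qed

end

lemma weak_strip_of_step:
  assumes \<tau>: "\<tau> \<in> cores k" and w: "window (k + 1) g" and b: "below (k + 1) g = beads \<tau>"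
    and st: "strip_step (k + 1) g T g'"
  obtains \<kappa> where "\<kappa> \<in> cores k" "beads \<kappa> = below (k + 1) g'" "weak_strip k (card T) \<kappa> \<tau>"
    "hop \<kappa> \<tau> = push (k + 1) g T"
proof -
  let ?n = "k + 1"
  define H where "H = push ?n g T"
  have T: "T \<subset> {..<?n}" using step_T[OF w st] .
  have finT: "finite T" using T finite_subset by blast
  obtain \<kappa> where \<kappa>: "is_partition \<kappa>" "horizontal_strip \<kappa> \<tau>" "hop \<kappa> \<tau> = H"
  proof (rule horizontal_strip_of_hops)
    show "H \<inter> beads \<tau> = {}" using push_notin b unfolding H_def by blast
    show "finite H" unfolding H_def by (rule finite_push[OF w st])
    show "\<exists>\<beta>\<in>beads \<tau>. \<beta> < x \<and> {\<beta><..x} \<subseteq> H" if "x \<in> H" for x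
      using push_path that b unfolding H_def by metis
  qed
  have bk: "beads \<kappa> = below ?n g'"
    using beads_flow[OF \<kappa>(2)] below_step[OF w st] \<kappa>(3) b H_def by simp
  have core: "\<kappa> \<in> cores k"
    unfolding core_iff_periodic using \<kappa>(1) bk below_periodic by metis
  have w': "window ?n g'" by (rule step_window[OF w st])
  have Hcase: "\<exists>t\<in>T. [x = g t] (mod int ?n) \<and> g t \<le> x" if x: "x \<in> H" for x
  proof -
    obtain t where t: "t \<in> T" "[x = g t] (mod int ?n)"
      using push_moved[of x ?n g T] x unfolding H_def moved_def by blast
    then have "t < ?n" using T by auto
    then have "g t \<le> x" using below_iff[OF w _ t(2)] push_notin[of x ?n g T] x unfolding H_def by auto
    then show ?thesis using t by blast
  qed
  have gT: "g t \<in> H" if "t \<in> T" for t unfolding H_def by (rule window_in_push[OF w st that])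
  have res: "residue k ` (diagram \<kappa> - diagram \<tau>) = (\<lambda>t. g t mod int ?n) ` T"
  proof -
    have "(\<lambda>x. x mod int ?n) ` H = (\<lambda>t. g t mod int ?n) ` T"
    proof (intro equalityI subsetI)
      fix r assume "r \<in> (\<lambda>x. x mod int ?n) ` H"
      then obtain x where x: "x \<in> H" "r = x mod int ?n" by blast
      then obtain t where "t \<in> T" "[x = g t] (mod int ?n)" using Hcase by blast
      then show "r \<in> (\<lambda>t. g t mod int ?n) ` T" using x(2) unfolding cong_def by blast
    qed (use gT in blast)
    then show ?thesis using residue_image[of k \<kappa> \<tau>] \<kappa>(3) by simp
  qed
  have inj: "inj_on (\<lambda>t. g t mod int ?n) T"
    using window_cong[OF w] T unfolding cong_def by (intro inj_onI) blast
  have c1: "card (residue k ` (diagram \<kappa> - diagram \<tau>)) = card T"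
    unfolding res by (rule card_image[OF inj])
  have e1: "{x \<in> hop \<kappa> \<tau>. x + int k \<in> beads \<kappa>} = {}"
  proof -
    have "x + int k \<notin> beads \<kappa>" if x: "x \<in> H" for x
    proof -
      obtain t where t: "t \<in> T" "[x = g t] (mod int ?n)" "g t \<le> x" using Hcase[OF x] by blast
      have tn: "t < ?n" using t T by auto
      \<comment> \<open>Since \<open>k = n - 1\<close> and \<open>g' t = g t - 1\<close>, the place
        \<open>x + k\<close> is in the class of \<open>g' t\<close>, and it is not below
        \<open>g' t\<close>.\<close>
      have "x + int k - g' t = x - g t + int ?n" using step_in[OF w st t(1)] by simp
      then have "[x + int k = g' t] (mod int ?n)"
        using t(2) unfolding cong_iff_dvd_diff by (metis dvd_add_triv_right_iff)
      then show ?thesis using below_iff[OF w' tn] bk step_in[OF w st t(1)] t(3) by simp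
    qed
    then show ?thesis using \<kappa>(3) by blast
  qed
  have e2: "{x \<in> hop \<kappa> \<tau>. x - int ?n \<in> beads \<tau>} = g ` T"
  proof (intro equalityI subsetI)
    fix x assume x: "x \<in> {x \<in> hop \<kappa> \<tau>. x - int ?n \<in> beads \<tau>}"
    then have "x \<in> H" using \<kappa>(3) by simp
    then obtain t where t: "t \<in> T" "[x = g t] (mod int ?n)" "g t \<le> x" using Hcase by blast
    have tn: "t < ?n" using t T by auto
    have "[x - int ?n = g t] (mod int ?n)" using t(2) cong_trans[OF cong_self_minus] by blast
    then have "x - int ?n < g t" using below_iff[OF w tn] x b by simp
    then have "x = g t" using cong_less_step[OF cong_sym[OF t(2)]] t(3) by force
    then show "x \<in> g ` T" using t(1) by simp
  next
    fix x assume "x \<in> g ` T"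
    then obtain t where t: "t \<in> T" "x = g t" by blast
    have tn: "t < ?n" using t T by auto
    have "g t - int ?n \<in> beads \<tau>" using below_iff[OF w tn cong_self_minus] b by simp
    then show "x \<in> {x \<in> hop \<kappa> \<tau>. x - int ?n \<in> beads \<tau>}" using gT t \<kappa>(3) by simp
  qed
  have "inj_on g T" using inj by (auto simp: inj_on_def)
  then have c2: "core_size k \<kappa> = core_size k \<tau> + card T"
    using core_size_strip[OF \<kappa>(2), of k] unfolding e1 e2 by (simp add: card_image)
  have "weak_strip k (card T) \<kappa> \<tau>"
    unfolding weak_strip_def using core \<tau> \<kappa>(2) c1 c2 by simp
  then show ?thesis using that core bk \<kappa>(3) H_def by blast
qed

text \<open>\<open>T\<close> collects the indices whose window entry is an added content. Equality
  in the size count shows that \<open>T\<close> carries all residues of the strip; it remains to see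
  that beads climb as far as these residues permit and that \<open>T\<close> is valid.\<close>

lemma step_of_weak_strip:
  assumes ws: "weak_strip k s \<kappa> \<tau>" and s: "s \<le> k" and w: "window (k + 1) g"
    and b: "below (k + 1) g = beads \<tau>"
  obtains T g' where "strip_step (k + 1) g T g'" "card T = s" "below (k + 1) g' = beads \<kappa>"
    "hop \<kappa> \<tau> = push (k + 1) g T"
proof -
  let ?n = "k + 1"
  define H where "H = hop \<kappa> \<tau>"
  have hs: "horizontal_strip \<kappa> \<tau>" and cs: "core_size k \<kappa> = core_size k \<tau> + s"
    and rs: "card (residue k ` (diagram \<kappa> - diagram \<tau>)) = s" and core: "\<kappa> \<in> cores k"
    using ws by (auto simp: weak_strip_def)
  have per: "periodic ?n (beads \<kappa>)" using core core_iff_periodic by blast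
  define T where "T = {t. t < ?n \<and> g t \<in> H}"
  define R where "R = (\<lambda>x. x mod int ?n) ` H"
  have finH: "finite H" unfolding H_def by (rule finite_hop[OF hs])
  have cR: "card R = s" using rs residue_image[of k \<kappa> \<tau>] by (simp add: R_def H_def)
  have inj: "inj_on (\<lambda>t. g t mod int ?n) {..<?n}"
    using window_cong[OF w] unfolding cong_def by (intro inj_onI) blast
  have injT: "inj_on (\<lambda>t. g t mod int ?n) T" by (rule inj_on_subset[OF inj]) (auto simp: T_def)
  have TR: "(\<lambda>t. g t mod int ?n) ` T \<subseteq> R" by (auto simp: T_def R_def)
  have finR: "finite R" using finH by (simp add: R_def)
  have cT: "card T \<le> s" using card_mono[OF finR TR] card_image[OF injT] cR by simp
  have Y: "{x \<in> hop \<kappa> \<tau>. x - int ?n \<in> beads \<tau>} = g ` T"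
  proof (intro equalityI subsetI)
    fix x assume x: "x \<in> {x \<in> hop \<kappa> \<tau>. x - int ?n \<in> beads \<tau>}"
    obtain t where t: "t < ?n" "[x = g t] (mod int ?n)" using window_cover[OF w] .
    have "g t \<le> x" using below_iff[OF w t] hop_notin[OF hs] x b by auto
    moreover have "[x - int ?n = g t] (mod int ?n)" using t(2) cong_trans[OF cong_self_minus] by blast
    then have "x - int ?n < g t" using below_iff[OF w t(1)] x b by simp
    ultimately have "x = g t" using cong_less_step[OF cong_sym[OF t(2)]] by force
    then show "x \<in> g ` T" using t(1) x by (auto simp: T_def H_def)
  next
    fix x assume "x \<in> g ` T"
    then obtain t where t: "t < ?n" "x = g t" "x \<in> H" by (auto simp: T_def)
    have "g t - int ?n \<in> beads \<tau>" using below_iff[OF w t(1) cong_self_minus] b by simp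
    then show "x \<in> {x \<in> hop \<kappa> \<tau>. x - int ?n \<in> beads \<tau>}" using t by (simp add: H_def)
  qed
  have "inj_on g T" using injT by (auto simp: inj_on_def)
  then have sum: "s + card {x \<in> H. x + int k \<in> beads \<kappa>} = card T"
    using core_size_strip[OF hs, of k] unfolding Y cs by (simp add: card_image H_def)
  then have c0: "card T = s" "card {x \<in> H. x + int k \<in> beads \<kappa>} = 0" using cT by auto
  then have X: "x + int k \<notin> beads \<kappa>" if "x \<in> H" for x using that finH by auto
  have RT: "R = (\<lambda>t. g t mod int ?n) ` T"
    using card_subset_eq[OF finR TR] card_image[OF injT] cR c0 by simp
  have mvH: "moved ?n g T x" if "x \<in> H" for x
  proof -
    have "x mod int ?n \<in> R" using that by (simp add: R_def)
    then show ?thesis unfolding RT moved_def cong_def by blast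
  qed
  \<comment> \<open>At most \<open>k\<close> of the \<open>k + 1\<close> classes move, so one is
    left to start the runs.\<close>
  have Tsub: "T \<subset> {..<?n}"
  proof -
    have "T \<noteq> {..<?n}" using c0(1) s by auto
    then show ?thesis by (auto simp: T_def)
  qed
  have gH: "g u \<in> H" if "u \<in> T" for u using that by (simp add: T_def)
  have HB: "x \<notin> below ?n g" if "x \<in> H" for x using hop_notin[OF hs] that b by (simp add: H_def)
  have Hpath: "\<exists>\<beta>\<in>below ?n g. \<beta> < x \<and> {\<beta><..x} \<subseteq> H" if x: "x \<in> H" for x
    using hop_path[OF hs, of x] x b unfolding H_def by metis
  have Hpush: "H = push ?n g T"
  proof (intro equalityI subsetI)
    fix x assume x: "x \<in> H"
    then obtain \<beta> where \<beta>: "\<beta> \<in> below ?n g" "\<beta> < x" "{\<beta><..x} \<subseteq> H" using Hpath by blast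
    have "y \<in> H" if "\<beta> < y" "y \<le> x" for y using \<beta>(3) that by auto
    then show "x \<in> push ?n g T" unfolding push_def using \<beta>(1,2) mvH HB by blast
  next
    fix x assume "x \<in> push ?n g T"
    then obtain \<beta> where \<beta>: "\<beta> \<in> below ?n g" "\<beta> < x"
      "\<And>y. \<beta> < y \<Longrightarrow> y \<le> x \<Longrightarrow> moved ?n g T y \<and> y \<notin> below ?n g" unfolding push_def by blast
    \<comment> \<open>Had the climb stopped at \<open>y - 1\<close>, this would be a new bead. The
      entry \<open>g u\<close> of the class of \<open>y\<close> lies at least \<open>n\<close> below
      \<open>y\<close>, so by periodicity \<open>g u + k\<close> would be a new bead too, which
      \<open>X\<close> forbids.\<close>
    have step: "y \<in> H" if y: "\<beta> < y" "y \<le> x" "y - 1 \<in> beads \<tau> \<or> y - 1 \<in> H" for y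
    proof (rule ccontr)
      assume ny: "y \<notin> H"
      then have "y - 1 \<in> flow (beads \<tau>) (hop \<kappa> \<tau>)" using y(3) by (simp add: flow_def H_def)
      then have pk: "y - 1 \<in> beads \<kappa>" using beads_flow[OF hs] by simp
      have my: "moved ?n g T y" "y \<notin> below ?n g" using \<beta>(3)[OF y(1,2)] by auto
      then obtain u where u: "u \<in> T" "[y = g u] (mod int ?n)" unfolding moved_def by blast
      have un: "u < ?n" using u(1) by (simp add: T_def)
      have "g u \<le> y" using below_iff[OF w un u(2)] my(2) by simp
      moreover have "g u \<noteq> y" using gH[OF u(1)] ny by auto
      ultimately have "g u + int ?n \<le> y" using cong_less_step[OF cong_sym[OF u(2)]] by simp
      then have "g u + int k \<le> y - 1" by simp
      moreover have "[g u + int k = y - 1] (mod int ?n)"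
      proof -
        have "g u + int k - (y - 1) = int ?n - (y - g u)" by simp
        then show ?thesis using u(2) unfolding cong_iff_dvd_diff by (metis dvd_diff dvd_refl)
      qed
      ultimately have "g u + int k \<in> beads \<kappa>" using periodic_multiple[OF per pk] by blast
      then show False using X[OF gH[OF u(1)]] by blast
    qed
    have "\<beta> + 1 + int d \<le> x \<longrightarrow> \<beta> + 1 + int d \<in> H" for d
    proof (induction d)
      case 0
      show ?case using step[of "\<beta> + 1"] \<beta>(1) b by simp
    next
      case (Suc d)
      have "\<beta> + 1 + int (Suc d) - 1 = \<beta> + 1 + int d" by simp
      moreover have "\<beta> + 1 + int d \<in> H" if "\<beta> + 1 + int (Suc d) \<le> x" using Suc that by simp
      moreover have "\<beta> < \<beta> + 1 + int (Suc d)" by simp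
      ultimately show ?case using step[of "\<beta> + 1 + int (Suc d)"] by metis
    qed
    from this[of "nat (x - \<beta> - 1)"] show "x \<in> H" using \<beta>(2) by simp
  qed
  have "valid ?n g T"
    unfolding valid_def
  proof (intro allI impI)
    fix t i :: nat assume t: "t < ?n" "t \<notin> T"
      and "1 \<le> i" "\<forall>j::nat. 1 \<le> j \<longrightarrow> j \<le> i \<longrightarrow> moved ?n g T (g t + int j)"
    then show "\<exists>u\<in>T. u < t \<and> [g t + int i = g u] (mod int ?n)"
    proof (induction i rule: less_induct)
      case (less i)
      have nt: "\<not> moved ?n g T (g t)" using moved_window[OF w Tsub t(1)] t(2) by simp
      then have "\<not> moved ?n g T (g t + int ?n)" using moved_shift[OF w Tsub] by blast
      then have i: "i < ?n" using less.prems(4) by (metis le_add2 not_le)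
      obtain u where u: "u \<in> T" "[g t + int i = g u] (mod int ?n)"
        using less.prems unfolding moved_def by auto
      have un: "u < ?n" using u(1) by (simp add: T_def)
      \<comment> \<open>The bead that climbs to \<open>g u\<close> starts at \<open>g u - i\<close>
        or above, as the class of \<open>g u - i\<close> is unmoved. If it starts higher, the
        induction hypothesis puts its class at an index below \<open>t\<close>. In both cases
        \<open>g u - i < g t\<close>, and \<open>i < n\<close> improves this to
        \<open>g u < g t\<close>.\<close>
      obtain \<beta> where \<beta>: "\<beta> \<in> below ?n g" "\<beta> < g u" "{\<beta><..g u} \<subseteq> H"
        using Hpath[OF gH[OF u(1)]] by blast
      have ci: "[g u - int i = g t] (mod int ?n)" using cong_sym[OF u(2)] cong_move by blast
      have "g u - int i \<notin> H" using mvH moved_cong[OF ci] nt by blast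
      then have "g u - int i \<notin> {\<beta><..g u}" using \<beta>(3) by blast
      then have ge: "g u - int i \<le> \<beta>" by auto
      have "g u - int i < g t"
      proof (cases "\<beta> = g u - int i")
        case True
        then show ?thesis using below_iff[OF w t(1) ci] \<beta>(1) by simp
      next
        case False
        define j where "j = nat (\<beta> - (g u - int i))"
        have j: "int j = \<beta> - (g u - int i)" "1 \<le> j" "j < i" using False ge \<beta>(2) by (auto simp: j_def)
        obtain v where v: "v \<in> T" "v < t" "[g t + int j = g v] (mod int ?n)"
          using less.IH[OF j(3) t j(2)] less.prems(4) j(3) by auto
        have "\<beta> - (g t + int j) = g u - int i - g t" using j(1) by linarith
        then have "[\<beta> = g t + int j] (mod int ?n)" using ci unfolding cong_iff_dvd_diff by (simp only:)
        then have bv: "[\<beta> = g v] (mod int ?n)" using v(3) cong_trans by blast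
        have "v < ?n" using v(2) t(1) by simp
        then have "\<beta> < g v" "g v < g t"
          using below_iff[OF w _ bv] \<beta>(1) window_less_iff[OF w _ t(1)] v(2) by auto
        then show ?thesis using ge by simp
      qed
      then have "g u - int i + int ?n \<le> g t" by (rule cong_less_step[OF ci])
      then have "g u < g t" using i by simp
      then have "u < t" using window_less_iff[OF w un t(1)] by simp
      then show ?case using u by blast
    qed
  qed
  then obtain g' where g': "strip_step ?n g T g'" using strip_step_exists[OF w Tsub] by blast
  have "below ?n g' = beads \<kappa>"
    using below_step[OF w g'] beads_flow[OF hs] Hpush b by (simp add: H_def)
  then show ?thesis using that g' c0(1) Hpush by (simp add: H_def)
qed

text \<open>A bead rises from below \<open>x\<close> to at least \<open>x\<close> exactly when its
  row adds a cell of content \<open>x\<close>, and by interlacing at most one row does.\<close>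

lemma card_bead_ge_strip:
  assumes hs: "horizontal_strip \<kappa> \<tau>"
  shows "card {i. 1 \<le> i \<and> x \<le> bead \<kappa> i} = card {i. 1 \<le> i \<and> x \<le> bead \<tau> i} + (if x \<in> hop \<kappa> \<tau> then 1 else 0)"
proof -
  let ?A = "{i. 1 \<le> i \<and> x \<le> bead \<tau> i}" and ?D = "{i. 1 \<le> i \<and> bead \<tau> i < x \<and> x \<le> bead \<kappa> i}"
  have fin: "finite {i. 1 \<le> i \<and> x \<le> bead \<nu> i}" for \<nu>
  proof -
    have "{i. 1 \<le> i \<and> x \<le> bead \<nu> i} = {i. 1 \<le> i \<and> x - 1 < bead \<nu> i}" by auto
    then show ?thesis using finite_beads_above[of "x - 1" \<nu>] by simp
  qed
  have eq: "{i. 1 \<le> i \<and> x \<le> bead \<kappa> i} = ?A \<union> ?D"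
  proof (rule set_eqI)
    fix i
    show "i \<in> {i. 1 \<le> i \<and> x \<le> bead \<kappa> i} \<longleftrightarrow> i \<in> ?A \<union> ?D"
      using strip_le[OF hs, of i] by auto
  qed
  have finD: "finite ?D" by (rule finite_subset[OF _ fin[of \<kappa>]]) auto
  have "card (?A \<union> ?D) = card ?A + card ?D"
    by (rule card_Un_disjoint) (use fin finD in auto)
  moreover have "card ?D = (if x \<in> hop \<kappa> \<tau> then 1 else 0)"
  proof (cases "x \<in> hop \<kappa> \<tau>")
    case True
    then obtain i where i: "i \<in> ?D" using hop_iff[OF hs] by auto
    have "i = j" if j: "j \<in> ?D" for j
    proof -
      have "False" if "a \<in> ?D" "c \<in> ?D" "a < c" for a c
        using that strip_less[OF hs, of a] bead_le[of "a + 1" c \<kappa>] by auto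
      from this[OF i j] this[OF j i] show ?thesis by (rule_tac linorder_cases[of i j]) auto
    qed
    then have D: "?D = {i}" using i by blast
    show ?thesis unfolding D using True by simp
  next
    case False
    then have D: "?D = {}" using hop_iff[OF hs] by blast
    show ?thesis unfolding D using False by simp
  qed
  ultimately show ?thesis using eq by simp
qed

text \<open>The column length counts the beads above the window entry. For \<open>t\<close> in
  \<open>T\<close> one bead crosses the place \<open>g t\<close>, and lowering the threshold to
  \<open>g t - 1\<close> does not affect the count. For other \<open>t\<close> the threshold jumps
  over places without old beads and lands where no bead has passed. So \<open>T\<close> is the set
  of columns in which the bounded partition grows.\<close>

lemma col_strip_step:
  assumes \<tau>: "\<tau> \<in> cores k" and \<kappa>: "\<kappa> \<in> cores k" and hs: "horizontal_strip \<kappa> \<tau>"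
    and w: "window (k + 1) g" and b: "below (k + 1) g = beads \<tau>"
    and st: "strip_step (k + 1) g T g'" and b': "below (k + 1) g' = beads \<kappa>"
    and H: "hop \<kappa> \<tau> = push (k + 1) g T" and t: "t < k + 1"
  shows "col (core_to_bounded k \<kappa>) t = col (core_to_bounded k \<tau>) t + (if t \<in> T then 1 else 0)"
proof -
  let ?n = "k + 1"
  have w': "window ?n g'" by (rule step_window[OF w st])
  define N where "N \<nu> x = card {i. 1 \<le> i \<and> x \<le> bead \<nu> i}" for \<nu> x
  have NN: "N \<kappa> x = N \<tau> x + (if x \<in> push ?n g T then 1 else 0)" for x
    using card_bead_ge_strip[OF hs] H by (simp add: N_def)
  have gt: "{i. 1 \<le> i \<and> x < bead \<nu> i} = {i. 1 \<le> i \<and> x \<le> bead \<nu> i}" if "x \<notin> beads \<nu>" for x \<nu>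
    using that bead_in_beads[of _ \<nu>] by (auto simp: le_less)
  have nb: "g t \<notin> beads \<tau>" "g' t \<notin> beads \<kappa>"
    using window_notin_below[OF w t] window_notin_below[OF w' t] b b' by auto
  have c: "col (core_to_bounded k \<tau>) t = N \<tau> (g t)" "col (core_to_bounded k \<kappa>) t = N \<kappa> (g' t)"
    using col_core_to_bounded[OF w b t] col_core_to_bounded[OF w' b' t] gt nb by (auto simp: N_def)
  show ?thesis
  proof (cases "t \<in> T")
    case True
    have e: "g' t = g t - 1" by (rule step_in[OF w st True])
    have "{i. 1 \<le> i \<and> g' t \<le> bead \<kappa> i} = {i. 1 \<le> i \<and> g t \<le> bead \<kappa> i}"
    proof -
      have "{i. 1 \<le> i \<and> g' t < bead \<kappa> i} = {i. 1 \<le> i \<and> g t \<le> bead \<kappa> i}" unfolding e by auto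
      then show ?thesis using gt[OF nb(2)] by simp
    qed
    then have "N \<kappa> (g' t) = N \<kappa> (g t)" by (simp add: N_def)
    also have "\<dots> = N \<tau> (g t) + 1" using NN window_in_push[OF w st True] by simp
    finally show ?thesis using c True by simp
  next
    case False
    obtain l where l: "g' t = g t + int l"
      "\<And>i. 1 \<le> i \<Longrightarrow> i \<le> l \<Longrightarrow> \<exists>u\<in>T. u < t \<and> [g t + int i = g u] (mod int ?n)"
      "\<not> moved ?n g T (g t + int l + 1)"
      using step_out[OF w st t False] by metis
    have "g' t + 1 \<notin> push ?n g T" using l(1,3) push_moved by metis
    moreover have "g' t \<notin> flow (below ?n g) (push ?n g T)"
      using below_step[OF w st] nb(2) b' by simp
    ultimately have "g' t \<notin> push ?n g T" by (simp add: flow_def)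
    then have 1: "N \<kappa> (g' t) = N \<tau> (g' t)" using NN by simp
    \<comment> \<open>Each place of the jump is in the class of an entry \<open>g u < g t\<close>,
      hence above the half-line of beads of that class.\<close>
    have "y \<notin> beads \<tau>" if y: "g t \<le> y" "y < g' t" for y
    proof (cases "y = g t")
      case False
      define i where "i = nat (y - g t)"
      have i: "int i = y - g t" "1 \<le> i" "i \<le> l" using False y l(1) by (auto simp: i_def)
      obtain u where u: "u \<in> T" "u < t" "[g t + int i = g u] (mod int ?n)" using l(2)[OF i(2,3)] by blast
      have yu: "[y = g u] (mod int ?n)" using u(3) i(1) by simp
      have "g u < g t" using window_less_iff[OF w _ t] u(2) t by simp
      then show ?thesis using below_iff[OF w _ yu] u(2) t y b by simp
    qed (use nb in simp)
    then have nbt: "bead \<tau> i < g t \<or> g' t \<le> bead \<tau> i" if "1 \<le> i" for i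
      using bead_in_beads[OF that, of \<tau>] by (meson not_le)
    have "g' t \<le> bead \<tau> i \<longleftrightarrow> g t \<le> bead \<tau> i" if "1 \<le> i" for i
      using nbt[OF that] l(1) by auto
    then have "{i. 1 \<le> i \<and> g' t \<le> bead \<tau> i} = {i. 1 \<le> i \<and> g t \<le> bead \<tau> i}" by blast
    then show ?thesis using c 1 False by (simp add: N_def)
  qed
qed

text \<open>The end of row \<open>i\<close> is a removable corner iff
  \<open>bead \<tau> i - 1\<close> is not a bead of \<tau>, and it is unblocked iff this place is
  not a bead of \<kappa>. Within a residue class periodicity carries both absences upwards, so the
  highest bead \<open>g p - n\<close> of the class decides.\<close>

lemma num_residues_eq:
  assumes \<tau>: "\<tau> \<in> cores k" and \<kappa>: "\<kappa> \<in> cores k" and hs: "horizontal_strip \<kappa> \<tau>"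
    and w: "window (k + 1) g" and b: "below (k + 1) g = beads \<tau>"
  shows "num_residues k \<kappa> \<tau> =
    card {p. p < k + 1 \<and> g p - int (k + 1) - 1 \<notin> beads \<tau> \<and> g p - int (k + 1) - 1 \<notin> beads \<kappa>}"
proof -
  let ?n = "k + 1"
  define F where "F = {p. p < ?n \<and> g p - int ?n - 1 \<notin> beads \<tau> \<and> g p - int ?n - 1 \<notin> beads \<kappa>}"
  have per: "periodic ?n (beads \<tau>)" "periodic ?n (beads \<kappa>)" using \<tau> \<kappa> core_iff_periodic by auto
  have corner: "(i, j) \<in> removable_corners \<tau> \<and> \<not> blocked \<kappa> (i, j) \<longleftrightarrow>
    1 \<le> i \<and> int j - int i = bead \<tau> i \<and> bead \<tau> i - 1 \<notin> beads \<tau> \<and> bead \<tau> i - 1 \<notin> beads \<kappa>" for i j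
  proof (cases "1 \<le> i \<and> int j - int i = bead \<tau> i")
    case True
    then have i: "1 \<le> i" and j: "j = part \<tau> i" by (auto simp: bead_def)
    have "(i, j) \<in> removable_corners \<tau> \<longleftrightarrow> part \<tau> (i + 1) < j"
      using i j by (auto simp: removable_corners_def mem_diagram)
    also have "\<dots> \<longleftrightarrow> bead \<tau> (i + 1) \<noteq> bead \<tau> i - 1"
      using bead_less[of i "i + 1" \<tau>] i j by (auto simp: bead_def)
    also have "\<dots> \<longleftrightarrow> bead \<tau> i - 1 \<notin> beads \<tau>"
    proof
      assume ne: "bead \<tau> (i + 1) \<noteq> bead \<tau> i - 1"
      show "bead \<tau> i - 1 \<notin> beads \<tau>"
      proof
        assume "bead \<tau> i - 1 \<in> beads \<tau>"
        then obtain c where c: "1 \<le> c" "bead \<tau> i - 1 = bead \<tau> c" by (rule beadsE)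
        then have "i < c" using bead_less_iff[OF i c(1), of \<tau>] by simp
        then have "bead \<tau> c \<le> bead \<tau> (i + 1)" by (intro bead_le) auto
        then show False using c ne bead_less[of i "i + 1" \<tau>] i by simp
      qed
    next
      assume "bead \<tau> i - 1 \<notin> beads \<tau>"
      then show "bead \<tau> (i + 1) \<noteq> bead \<tau> i - 1" using bead_in_beads[of "i + 1" \<tau>] by force
    qed
    finally have 1: "(i, j) \<in> removable_corners \<tau> \<longleftrightarrow> bead \<tau> i - 1 \<notin> beads \<tau>" .
    have 2: "\<not> blocked \<kappa> (i, j) \<longleftrightarrow> bead \<tau> i - 1 \<notin> beads \<kappa>" if rc: "(i, j) \<in> removable_corners \<tau>"
    proof -
      have "1 \<le> j" using rc by (auto simp: removable_corners_def mem_diagram)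
      then have "\<not> blocked \<kappa> (i, j) \<longleftrightarrow> part \<kappa> (i + 1) < j"
        by (auto simp: blocked_def mem_diagram)
      also have "\<dots> \<longleftrightarrow> bead \<kappa> (i + 1) \<noteq> bead \<tau> i - 1"
        using strip_less[OF hs i] j by (auto simp: bead_def)
      also have "\<dots> \<longleftrightarrow> bead \<tau> i - 1 \<notin> beads \<kappa>"
      proof
        assume ne: "bead \<kappa> (i + 1) \<noteq> bead \<tau> i - 1"
        show "bead \<tau> i - 1 \<notin> beads \<kappa>"
        proof
          assume "bead \<tau> i - 1 \<in> beads \<kappa>"
          then obtain c where c: "1 \<le> c" "bead \<tau> i - 1 = bead \<kappa> c" by (rule beadsE)
          then have "i < c" using bead_less_iff[OF i c(1), of \<kappa>] strip_le[OF hs i] by simp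
          then have "bead \<kappa> c \<le> bead \<kappa> (i + 1)" by (intro bead_le) auto
          then show False using c ne strip_less[OF hs i] by simp
        qed
      next
        assume "bead \<tau> i - 1 \<notin> beads \<kappa>"
        then show "bead \<kappa> (i + 1) \<noteq> bead \<tau> i - 1" using bead_in_beads[of "i + 1" \<kappa>] by force
      qed
      finally show ?thesis .
    qed
    show ?thesis using 1 2 True by blast
  next
    case False
    have "1 \<le> i \<and> int j - int i = bead \<tau> i" if "(i, j) \<in> removable_corners \<tau>"
      using that by (auto simp: removable_corners_def mem_diagram bead_def)
    then show ?thesis using False by blast
  qed
  have "residue k ` {c \<in> removable_corners \<tau>. \<not> blocked \<kappa> c} = (\<lambda>p. g p mod int ?n) ` F"
  proof (intro equalityI subsetI)
    fix r assume "r \<in> residue k ` {c \<in> removable_corners \<tau>. \<not> blocked \<kappa> c}"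
    then obtain i j where ij: "r = residue k (i, j)" "(i, j) \<in> removable_corners \<tau> \<and> \<not> blocked \<kappa> (i, j)"
      by auto
    then have i: "1 \<le> i" "int j - int i = bead \<tau> i" "bead \<tau> i - 1 \<notin> beads \<tau>" "bead \<tau> i - 1 \<notin> beads \<kappa>"
      using corner by auto
    obtain p where p: "p < ?n" "[bead \<tau> i = g p] (mod int ?n)" using window_cover[OF w] .
    have "bead \<tau> i < g p" using below_iff[OF w p] b bead_in_beads[OF i(1)] by simp
    then have le: "bead \<tau> i - 1 \<le> g p - int ?n - 1" using cong_less_step[OF p(2)] by simp
    have "bead \<tau> i - 1 - (g p - int ?n - 1) = bead \<tau> i - g p + int ?n" by simp
    then have cg: "[bead \<tau> i - 1 = g p - int ?n - 1] (mod int ?n)"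
      using p(2) unfolding cong_iff_dvd_diff by (metis dvd_add_triv_right_iff)
    have "g p - int ?n - 1 \<notin> beads \<tau>" "g p - int ?n - 1 \<notin> beads \<kappa>"
      using periodic_multiple[OF per(1) _ cg le] periodic_multiple[OF per(2) _ cg le] i(3,4) by auto
    then have "p \<in> F" using p(1) by (simp add: F_def)
    moreover have "r = g p mod int ?n" using ij(1) i(2) p(2) by (simp add: cong_def add.commute)
    ultimately show "r \<in> (\<lambda>p. g p mod int ?n) ` F" by blast
  next
    fix r assume "r \<in> (\<lambda>p. g p mod int ?n) ` F"
    then obtain p where p: "p < ?n" "g p - int ?n - 1 \<notin> beads \<tau>" "g p - int ?n - 1 \<notin> beads \<kappa>"
      "r = g p mod int ?n" by (auto simp: F_def)
    have "g p - int ?n \<in> beads \<tau>" using below_iff[OF w p(1) cong_self_minus] b by simp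
    then obtain i where i: "1 \<le> i" "g p - int ?n = bead \<tau> i" by (rule beadsE)
    have "int (part \<tau> i) - int i = bead \<tau> i" by (simp add: bead_def)
    then have "(i, part \<tau> i) \<in> removable_corners \<tau> \<and> \<not> blocked \<kappa> (i, part \<tau> i)"
      using corner i p by simp
    moreover have "r = residue k (i, part \<tau> i)"
    proof -
      have "residue k (i, part \<tau> i) = (g p - int ?n) mod int ?n" unfolding i(2) by (simp add: bead_def add.commute)
      then show ?thesis using p(4) by simp
    qed
    ultimately show "r \<in> residue k ` {c \<in> removable_corners \<tau>. \<not> blocked \<kappa> c}" by blast
  qed
  moreover have "inj_on (\<lambda>p. g p mod int ?n) F"
    using window_cong[OF w] unfolding F_def cong_def by (intro inj_onI) blast
  ultimately show ?thesis unfolding num_residues_def F_def[symmetric] by (simp add: card_image)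
qed

section \<open>Unions with rectangles\<close>

lemma beads_empty: "beads {#} = {x. x < 0}"
proof -
  have "bead {#} i = - int i" for i by (simp add: bead_def part_def)
  then have "beads {#} = (\<lambda>i. - int i) ` {1..}" by (simp add: beads_def)
  also have "\<dots> = {x. x < 0}"
  proof (intro equalityI subsetI)
    fix x :: int assume "x \<in> {x. x < 0}"
    then show "x \<in> (\<lambda>i. - int i) ` {1..}" by (intro image_eqI[of _ _ "nat (- x)"]) auto
  qed auto
  finally show ?thesis .
qed

lemma empty_core: "{#} \<in> cores k" "core_to_bounded k {#} = {#}"
  by (auto simp: core_iff_periodic is_partition_def beads_empty periodic_def core_to_bounded_eq)

text \<open>Move the first \<open>r\<close> window entries: every unmoved index exceeds all moved
  ones, so \<open>valid\<close> is automatic, and by \<open>col_strip_step\<close> the columns of a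
  new part \<open>r\<close> are filled.\<close>

lemma add_part_core:
  assumes \<tau>: "\<tau> \<in> cores k" and r: "1 \<le> r" "r \<le> k"
  obtains \<kappa> where "\<kappa> \<in> cores k" "weak_strip k r \<kappa> \<tau>"
    "core_to_bounded k \<kappa> = core_to_bounded k \<tau> + {#r#}"
proof -
  let ?n = "k + 1"
  obtain g where w: "window ?n g" and b: "below ?n g = beads \<tau>" using core_window_exists[OF \<tau>] .
  have T: "{..<r} \<subset> {..<?n}" using r by auto
  have "valid ?n g {..<r}"
    unfolding valid_def
  proof (intro allI impI)
    fix t i :: nat assume t: "t < ?n" "t \<notin> {..<r}" "1 \<le> i"
      "\<forall>j::nat. 1 \<le> j \<longrightarrow> j \<le> i \<longrightarrow> moved ?n g {..<r} (g t + int j)"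
    then obtain u where "u < r" "[g t + int i = g u] (mod int ?n)" unfolding moved_def by blast
    then show "\<exists>u\<in>{..<r}. u < t \<and> [g t + int i = g u] (mod int ?n)" using t(2) by auto
  qed
  then obtain g' where st: "strip_step ?n g {..<r} g'" using strip_step_exists[OF w T] by blast
  obtain \<kappa> where \<kappa>: "\<kappa> \<in> cores k" "beads \<kappa> = below ?n g'" "weak_strip k (card {..<r}) \<kappa> \<tau>"
    "hop \<kappa> \<tau> = push ?n g {..<r}"
    using weak_strip_of_step[OF \<tau> w b st] .
  have hs: "horizontal_strip \<kappa> \<tau>" using \<kappa>(3) by (simp add: weak_strip_def)
  have "core_to_bounded k \<tau> + {#r#} \<in> k_bounded k"
    using core_to_bounded_in[OF \<tau>] r by (simp add: k_bounded_iff)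
  moreover have "col (core_to_bounded k \<kappa>) t = col (core_to_bounded k \<tau> + {#r#}) t" if "t < k" for t
    using col_strip_step[OF \<tau> \<kappa>(1) hs w b st \<kappa>(2)[symmetric] \<kappa>(4), of t] that
    unfolding col_add col_single by simp
  ultimately have "core_to_bounded k \<kappa> = core_to_bounded k \<tau> + {#r#}"
    using k_bounded_eqI core_to_bounded_in[OF \<kappa>(1)] by blast
  then show ?thesis using that \<kappa> by simp
qed

lemma core_to_bounded_surj: "\<nu> \<in> k_bounded k \<Longrightarrow> \<exists>\<kappa>\<in>cores k. core_to_bounded k \<kappa> = \<nu>"
proof (induction \<nu>)
  case empty
  then show ?case using empty_core by blast
next
  case (add r \<nu>)
  then obtain \<tau> where \<tau>: "\<tau> \<in> cores k" "core_to_bounded k \<tau> = \<nu>" by (auto simp: k_bounded_iff)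
  have "1 \<le> r" "r \<le> k" using add.prems by (auto simp: k_bounded_iff)
  then obtain \<kappa> where "\<kappa> \<in> cores k" "core_to_bounded k \<kappa> = core_to_bounded k \<tau> + {#r#}"
    using add_part_core[OF \<tau>(1)] by blast
  then show ?case using \<tau>(2) by auto
qed

lemma
  assumes "\<nu> \<in> k_bounded k"
  shows bounded_to_core_in: "bounded_to_core k \<nu> \<in> cores k"
    and core_to_bounded_to_core: "core_to_bounded k (bounded_to_core k \<nu>) = \<nu>"
  using core_to_bounded_surj[OF assms] bounded_to_core_eq by auto

section \<open>Weak strips between bounded partitions\<close>

definition strips :: "nat \<Rightarrow> nat \<Rightarrow> nat multiset \<Rightarrow> nat multiset set" where
  "strips k s \<nu> = {\<mu> \<in> k_bounded k. weak_strip k s (bounded_to_core k \<mu>) (bounded_to_core k \<nu>)}"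

lemma strips_bounded: "\<mu> \<in> strips k s \<nu> \<Longrightarrow> \<mu> \<in> k_bounded k"
  by (simp add: strips_def)

lemma strips_step:
  assumes \<nu>: "\<nu> \<in> k_bounded k" and s: "s \<le> k" and \<mu>: "\<mu> \<in> strips k s \<nu>"
    and w: "window (k + 1) g" and b: "below (k + 1) g = beads (bounded_to_core k \<nu>)"
  obtains T g' where "strip_step (k + 1) g T g'" "card T = s"
    "below (k + 1) g' = beads (bounded_to_core k \<mu>)"
    "\<And>t. t < k + 1 \<Longrightarrow> col \<mu> t = col \<nu> t + (if t \<in> T then 1 else 0)"
proof -
  have ws: "weak_strip k s (bounded_to_core k \<mu>) (bounded_to_core k \<nu>)" and \<mu>k: "\<mu> \<in> k_bounded k"
    using \<mu> by (auto simp: strips_def)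
  have hs: "horizontal_strip (bounded_to_core k \<mu>) (bounded_to_core k \<nu>)"
    using ws by (simp add: weak_strip_def)
  obtain T g' where st: "strip_step (k + 1) g T g'" "card T = s"
    "below (k + 1) g' = beads (bounded_to_core k \<mu>)"
    "hop (bounded_to_core k \<mu>) (bounded_to_core k \<nu>) = push (k + 1) g T"
    using step_of_weak_strip[OF ws s w b] .
  have "col \<mu> t = col \<nu> t + (if t \<in> T then 1 else 0)" if "t < k + 1" for t
    using col_strip_step[OF bounded_to_core_in[OF \<nu>] bounded_to_core_in[OF \<mu>k] hs w b st(1,3,4) that]
    by (simp add: core_to_bounded_to_core[OF \<nu>] core_to_bounded_to_core[OF \<mu>k])
  then show ?thesis using that st by blast
qed

lemma strips_col:
  assumes \<nu>: "\<nu> \<in> k_bounded k" and s: "s \<le> k" and \<mu>: "\<mu> \<in> strips k s \<nu>"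
  obtains T where "T \<subseteq> {..<k}" "card T = s" "\<And>t. col \<mu> t = col \<nu> t + (if t \<in> T then 1 else 0)"
proof -
  obtain g where g: "window (k + 1) g" "below (k + 1) g = beads (bounded_to_core k \<nu>)"
    using core_window_exists[OF bounded_to_core_in[OF \<nu>]] .
  obtain T g' where st: "strip_step (k + 1) g T g'" "card T = s"
    "\<And>t. t < k + 1 \<Longrightarrow> col \<mu> t = col \<nu> t + (if t \<in> T then 1 else 0)"
    using strips_step[OF \<nu> s \<mu> g] by blast
  have \<mu>k: "\<mu> \<in> k_bounded k" using \<mu> by (rule strips_bounded)
  have "k \<notin> T" using st(3)[of k] k_bounded_col_eq_0[OF \<mu>k, of k] by (auto split: if_splits)
  moreover have "T \<subseteq> {..<k + 1}" using step_T[OF g(1) st(1)] by blast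
  ultimately have T: "T \<subseteq> {..<k}" by (auto simp: less_Suc_eq)
  have "col \<mu> t = col \<nu> t + (if t \<in> T then 1 else 0)" for t
  proof (cases "t < k + 1")
    case False
    then show ?thesis using k_bounded_col_eq_0[OF \<mu>k, of t] k_bounded_col_eq_0[OF \<nu>, of t] T by auto
  qed (rule st(3))
  then show ?thesis using that T st(2) by blast
qed

lemma finite_strips:
  assumes "\<nu> \<in> k_bounded k" "s \<le> k" shows "finite (strips k s \<nu>)"
proof -
  have "\<forall>\<mu>. \<exists>T. \<mu> \<in> strips k s \<nu> \<longrightarrow> T \<subseteq> {..<k} \<and> (\<forall>t. col \<mu> t = col \<nu> t + (if t \<in> T then 1 else 0))"
    using strips_col[OF assms] by metis
  then obtain T where T: "\<And>\<mu>. \<mu> \<in> strips k s \<nu> \<Longrightarrow> T \<mu> \<subseteq> {..<k}"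
    "\<And>\<mu> t. \<mu> \<in> strips k s \<nu> \<Longrightarrow> col \<mu> t = col \<nu> t + (if t \<in> T \<mu> then 1 else 0)" by metis
  show ?thesis
  proof (rule inj_on_finite[of T])
    show "inj_on T (strips k s \<nu>)"
    proof (rule inj_onI)
      fix \<mu> \<mu>' assume h: "\<mu> \<in> strips k s \<nu>" "\<mu>' \<in> strips k s \<nu>" "T \<mu> = T \<mu>'"
      show "\<mu> = \<mu>'"
        by (rule k_bounded_eqI[OF strips_bounded[OF h(1)] strips_bounded[OF h(2)]])
          (simp only: T(2)[OF h(1)] T(2)[OF h(2)] h(3))
    qed
    show "T ` strips k s \<nu> \<subseteq> Pow {..<k}" using T(1) by blast
  qed simp
qed

lemma strips_add:
  assumes \<nu>: "\<nu> \<in> k_bounded k" and r: "1 \<le> r" "r \<le> k"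
  shows "\<nu> + {#r#} \<in> strips k r \<nu>"
proof -
  obtain \<kappa> where \<kappa>: "\<kappa> \<in> cores k" "weak_strip k r \<kappa> (bounded_to_core k \<nu>)"
    "core_to_bounded k \<kappa> = core_to_bounded k (bounded_to_core k \<nu>) + {#r#}"
    using add_part_core[OF bounded_to_core_in[OF \<nu>] r] .
  have "core_to_bounded k \<kappa> = \<nu> + {#r#}" using \<kappa>(3) core_to_bounded_to_core[OF \<nu>] by simp
  moreover from this have "bounded_to_core k (\<nu> + {#r#}) = \<kappa>" using bounded_to_core_eq[OF \<kappa>(1)] by simp
  ultimately show ?thesis using \<kappa> core_to_bounded_in[OF \<kappa>(1)] by (simp add: strips_def)
qed

text \<open>Entry \<open>q\<close> is raised by \<sigma> \<open>q\<close> multiples of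
  \<open>n\<close>, and \<open>c\<close> is the common translation that restores charge zero.
  Differences of residues stay the same; the order of the entries is preserved for weakly increasing
  \<sigma>.\<close>

definition shift :: "nat \<Rightarrow> (nat \<Rightarrow> int) \<Rightarrow> int \<Rightarrow> (nat \<Rightarrow> int) \<Rightarrow> nat \<Rightarrow> int" where
  "shift n \<sigma> c g q = g q + int n * \<sigma> q + c"

definition weakly_mono :: "nat \<Rightarrow> (nat \<Rightarrow> int) \<Rightarrow> bool" where
  "weakly_mono n \<sigma> \<longleftrightarrow> (\<forall>p q. p \<le> q \<longrightarrow> q < n \<longrightarrow> \<sigma> p \<le> \<sigma> q)"

lemma shift_shift: "shift n (\<lambda>q. - \<sigma> q) (- c) (shift n \<sigma> c g) = g"
  "shift n \<sigma> c (shift n (\<lambda>q. - \<sigma> q) (- c) g) = g"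
  by (auto simp: shift_def fun_eq_iff)

lemma shift_cong:
  "[shift n \<sigma> c g p + x = shift n \<sigma> c g' q + y] (mod int n) \<longleftrightarrow> [g p + x = g' q + y] (mod int n)"
proof -
  have "shift n \<sigma> c g p + x - (shift n \<sigma> c g' q + y) = (g p + x - (g' q + y)) + int n * (\<sigma> p - \<sigma> q)"
    by (simp add: shift_def algebra_simps)
  then show ?thesis unfolding cong_iff_dvd_diff by (metis dvd_add_left_iff dvd_triv_left)
qed

lemma window_shift:
  assumes "window n g" "weakly_mono n \<sigma>" shows "window n (shift n \<sigma> c g)"
  unfolding window_def
proof (intro conjI allI impI)
  show "0 < n" using assms by (simp add: window_def)
next
  fix p q assume "p < q" "q < n"
  then have "g p < g q" "int n * \<sigma> p \<le> int n * \<sigma> q"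
    using assms by (auto simp: window_def weakly_mono_def intro!: mult_left_mono)
  then show "shift n \<sigma> c g p < shift n \<sigma> c g q" by (simp add: shift_def)
next
  fix p q assume "p < n" "q < n" "[shift n \<sigma> c g p = shift n \<sigma> c g q] (mod int n)"
  then show "p = q" using window_cong[OF assms(1)] shift_cong[of n \<sigma> c g p 0 g q 0] by simp
qed

text \<open>A move is described by congruences between entries up to offsets, by comparisons of
  indices, and by the differences \<open>g' t - g t\<close>; none of these changes.\<close>

lemma strip_step_shift:
  assumes "strip_step n g T g'" shows "strip_step n (shift n \<sigma> c g) T (shift n \<sigma> c g')"
proof -
  have mv: "moved n (shift n \<sigma> c g) T (shift n \<sigma> c g t + x) \<longleftrightarrow> moved n g T (g t + x)" for t x
    unfolding moved_def using shift_cong[of n \<sigma> c g t x g _ 0] by simp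
  have mv1: "moved n (shift n \<sigma> c g) T (shift n \<sigma> c g t + x + 1) \<longleftrightarrow> moved n g T (g t + x + 1)" for t x
    using mv[of t "x + 1"] by (simp add: add.assoc)
  have cg: "[shift n \<sigma> c g t + x = shift n \<sigma> c g u] (mod int n) \<longleftrightarrow> [g t + x = g u] (mod int n)" for t x u
    using shift_cong[of n \<sigma> c g t x g u 0] by simp
  have e1: "shift n \<sigma> c g' t = shift n \<sigma> c g t - 1 \<longleftrightarrow> g' t = g t - 1" for t by (auto simp: shift_def)
  have e2: "shift n \<sigma> c g' t = shift n \<sigma> c g t + x \<longleftrightarrow> g' t = g t + x" for t x by (auto simp: shift_def)
  show ?thesis using assms unfolding strip_step_def mv1 cg e1 e2 .
qed

text \<open>The sum is the number of beads that the shift by \<sigma> creates above entry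
  \<open>t\<close>. The condition is additive in \<open>P\<close> and \<sigma>, so unions of
  rectangles can be assembled from single ones.\<close>

definition rect_shift :: "nat \<Rightarrow> nat multiset \<Rightarrow> (nat \<Rightarrow> int) \<Rightarrow> bool" where
  "rect_shift k P \<sigma> \<longleftrightarrow> P \<in> k_bounded k \<and> weakly_mono (k + 1) \<sigma> \<and>
    (\<forall>t<k + 1. col P t = (\<Sum>q\<in>{t<..<k + 1}. nat (\<sigma> q - \<sigma> t)))"

lemma window_col_shift:
  assumes w: "window (k + 1) g" and P: "rect_shift k P \<sigma>" and t: "t < k + 1"
  shows "window_col (k + 1) (shift (k + 1) \<sigma> c g) t = col P t + window_col (k + 1) g t"
proof -
  have "nat ((shift (k + 1) \<sigma> c g q - shift (k + 1) \<sigma> c g t) div int (k + 1)) =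
    nat (\<sigma> q - \<sigma> t) + nat ((g q - g t) div int (k + 1))" if q: "q \<in> {t<..<k + 1}" for q
  proof -
    have "shift (k + 1) \<sigma> c g q - shift (k + 1) \<sigma> c g t = (g q - g t) + (\<sigma> q - \<sigma> t) * int (k + 1)"
      by (simp add: shift_def algebra_simps)
    then have "(shift (k + 1) \<sigma> c g q - shift (k + 1) \<sigma> c g t) div int (k + 1) =
        (\<sigma> q - \<sigma> t) + (g q - g t) div int (k + 1)"
      by (simp only: div_mult_self1)
    moreover have "0 \<le> \<sigma> q - \<sigma> t" using P q by (simp add: rect_shift_def weakly_mono_def)
    moreover have "0 \<le> g q - g t" using window_less_iff[OF w t, of q] q by simp
    then have "0 \<le> (g q - g t) div int (k + 1)" by (simp add: pos_imp_zdiv_nonneg_iff)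
    ultimately show ?thesis by (simp add: nat_add_distrib)
  qed
  then have "window_col (k + 1) (shift (k + 1) \<sigma> c g) t =
    (\<Sum>q\<in>{t<..<k + 1}. nat (\<sigma> q - \<sigma> t) + nat ((g q - g t) div int (k + 1)))"
    unfolding window_col_def by (rule sum.cong[OF refl])
  then show ?thesis using P t by (simp add: rect_shift_def sum.distrib window_col_def)
qed

text \<open>All positions below \<open>h 0\<close> are beads, and \<open>window_col\<close> counts
  those above it; the assumption on \<open>h 0\<close> is therefore charge zero.\<close>

lemma core_of_window:
  assumes w: "window (k + 1) h" and h0: "h 0 = - int (window_col (k + 1) h 0)"
  obtains \<kappa> where "\<kappa> \<in> cores k" "beads \<kappa> = below (k + 1) h"
proof -
  let ?m = "window_col (k + 1) h 0" and ?B = "below (k + 1) h"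
  have "{b \<in> ?B. h 0 < b} = ?B \<inter> {- int ?m..}"
    using window_notin_below[OF w, of 0] h0 by (auto simp: le_less)
  then have "finite (?B \<inter> {- int ?m..})" "card (?B \<inter> {- int ?m..}) = ?m"
    using card_below_gt[OF w, of 0] by auto
  moreover have "x \<in> ?B" if "x < - int ?m" for x
  proof -
    obtain q where q: "q < k + 1" "[x = h q] (mod int (k + 1))" using window_cover[OF w] .
    have "h 0 \<le> h q" using window_le_iff[OF w _ q(1), of 0] by simp
    then show ?thesis using below_iff[OF w q] that h0 by simp
  qed
  ultimately obtain \<kappa> where "is_partition \<kappa>" "beads \<kappa> = ?B"
    using partition_of_bead_set[of ?m ?B] by blast
  then show ?thesis using that below_periodic core_iff_periodic by metis
qed

lemma bounded_to_core_eqI: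
  assumes \<kappa>: "\<kappa> \<in> cores k" and \<mu>: "\<mu> \<in> k_bounded k" and w: "window (k + 1) g"
    and b: "beads \<kappa> = below (k + 1) g" and c: "\<And>t. t < k + 1 \<Longrightarrow> window_col (k + 1) g t = col \<mu> t"
  shows "bounded_to_core k \<mu> = \<kappa>"
proof -
  have "core_to_bounded k \<kappa> = \<mu>"
    by (rule k_bounded_eqI[OF core_to_bounded_in[OF \<kappa>] \<mu>])
      (use col_core_to_bounded'[OF w b[symmetric]] c in simp)
  then show ?thesis using bounded_to_core_eq[OF \<kappa>] by simp
qed

lemma window_col_eq:
  assumes "\<mu> \<in> k_bounded k" "window (k + 1) g" "below (k + 1) g = beads (bounded_to_core k \<mu>)" "t < k + 1"
  shows "window_col (k + 1) g t = col \<mu> t"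
  using col_core_to_bounded'[OF assms(2,3,4)] core_to_bounded_to_core[OF assms(1)] by simp

lemma k_bounded_add: "\<mu> \<in> k_bounded k \<Longrightarrow> \<nu> \<in> k_bounded k \<Longrightarrow> \<mu> + \<nu> \<in> k_bounded k"
  by (auto simp: k_bounded_iff)

lemma core_shift:
  assumes \<nu>: "\<nu> \<in> k_bounded k" and P: "rect_shift k P \<sigma>" and w: "window (k + 1) g"
    and b: "below (k + 1) g = beads (bounded_to_core k \<nu>)"
  obtains c where "below (k + 1) (shift (k + 1) \<sigma> c g) = beads (bounded_to_core k (P + \<nu>))"
proof -
  have m: "weakly_mono (k + 1) \<sigma>" and Pk: "P \<in> k_bounded k" using P by (auto simp: rect_shift_def)
  define M where "M = col P 0 + window_col (k + 1) g 0"
  \<comment> \<open>The only translation for which the lowest entry becomes minus the number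
    \<open>M\<close> of beads above it.\<close>
  define c where "c = - int M - g 0 - int (k + 1) * \<sigma> 0"
  let ?h = "shift (k + 1) \<sigma> c g"
  have wh: "window (k + 1) ?h" by (rule window_shift[OF w m])
  have wc: "window_col (k + 1) ?h t = col P t + window_col (k + 1) g t" if "t < k + 1" for t
    by (rule window_col_shift[OF w P that])
  have "?h 0 = - int (window_col (k + 1) ?h 0)"
    using wc[of 0] by (simp add: M_def c_def shift_def)
  then obtain \<kappa> where \<kappa>: "\<kappa> \<in> cores k" "beads \<kappa> = below (k + 1) ?h" using core_of_window[OF wh] by blast
  have "bounded_to_core k (P + \<nu>) = \<kappa>"
    by (rule bounded_to_core_eqI[OF \<kappa>(1) k_bounded_add[OF Pk \<nu>] wh \<kappa>(2)])
      (simp only: wc window_col_eq[OF \<nu> w b] col_add)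
  then show ?thesis using that \<kappa>(2) by simp
qed

lemma strip_shift:
  assumes \<nu>: "\<nu> \<in> k_bounded k" and \<mu>: "\<mu> \<in> k_bounded k" and P: "rect_shift k P \<sigma>"
    and w: "window (k + 1) g" and b: "below (k + 1) g = beads (bounded_to_core k \<nu>)"
    and st: "strip_step (k + 1) g T g'" and b': "below (k + 1) g' = beads (bounded_to_core k \<mu>)"
  obtains c where "below (k + 1) (shift (k + 1) \<sigma> c g) = beads (bounded_to_core k (P + \<nu>))"
    "below (k + 1) (shift (k + 1) \<sigma> c g') = beads (bounded_to_core k (P + \<mu>))"
    "weak_strip k (card T) (bounded_to_core k (P + \<mu>)) (bounded_to_core k (P + \<nu>))"
proof -
  have m: "weakly_mono (k + 1) \<sigma>" and Pk: "P \<in> k_bounded k" using P by (auto simp: rect_shift_def)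
  obtain c where c: "below (k + 1) (shift (k + 1) \<sigma> c g) = beads (bounded_to_core k (P + \<nu>))"
    using core_shift[OF \<nu> P w b] .
  let ?h = "shift (k + 1) \<sigma> c g" and ?h' = "shift (k + 1) \<sigma> c g'"
  have wh: "window (k + 1) ?h" by (rule window_shift[OF w m])
  have sth: "strip_step (k + 1) ?h T ?h'" by (rule strip_step_shift[OF st])
  have w': "window (k + 1) g'" by (rule step_window[OF w st])
  have wh': "window (k + 1) ?h'" by (rule step_window[OF wh sth])
  obtain \<kappa> where \<kappa>: "\<kappa> \<in> cores k" "beads \<kappa> = below (k + 1) ?h'"
    "weak_strip k (card T) \<kappa> (bounded_to_core k (P + \<nu>))"
    "hop \<kappa> (bounded_to_core k (P + \<nu>)) = push (k + 1) ?h T"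
    using weak_strip_of_step[OF bounded_to_core_in[OF k_bounded_add[OF Pk \<nu>]] wh c sth] .
  have "bounded_to_core k (P + \<mu>) = \<kappa>"
    by (rule bounded_to_core_eqI[OF \<kappa>(1) k_bounded_add[OF Pk \<mu>] wh' \<kappa>(2)])
      (simp only: window_col_shift[OF w' P] window_col_eq[OF \<mu> w' b'] col_add)
  then show ?thesis using that c \<kappa> by simp
qed

lemma strips_shift:
  assumes \<nu>: "\<nu> \<in> k_bounded k" and P: "rect_shift k P \<sigma>" and s: "s \<le> k"
  shows "strips k s (P + \<nu>) = (+) P ` strips k s \<nu>"
proof (intro equalityI subsetI)
  let ?n = "k + 1"
  have m: "weakly_mono ?n \<sigma>" and Pk: "P \<in> k_bounded k" using P by (auto simp: rect_shift_def)
  obtain g where w: "window ?n g" and b: "below ?n g = beads (bounded_to_core k \<nu>)"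
    using core_window_exists[OF bounded_to_core_in[OF \<nu>]] .
  {
    fix \<xi> assume "\<xi> \<in> (+) P ` strips k s \<nu>"
    then obtain \<mu> where \<mu>: "\<mu> \<in> strips k s \<nu>" "\<xi> = P + \<mu>" by blast
    have \<mu>k: "\<mu> \<in> k_bounded k" using \<mu>(1) by (rule strips_bounded)
    obtain T g' where st: "strip_step ?n g T g'" "card T = s" "below ?n g' = beads (bounded_to_core k \<mu>)"
      using strips_step[OF \<nu> s \<mu>(1) w b] by blast
    have "weak_strip k s (bounded_to_core k (P + \<mu>)) (bounded_to_core k (P + \<nu>))"
      using strip_shift[OF \<nu> \<mu>k P w b st(1,3)] st(2) by metis
    then show "\<xi> \<in> strips k s (P + \<nu>)" using \<mu>(2) k_bounded_add[OF Pk \<mu>k] by (simp add: strips_def)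
  }
  {
    fix \<xi> assume \<xi>: "\<xi> \<in> strips k s (P + \<nu>)"
    have \<xi>k: "\<xi> \<in> k_bounded k" using \<xi> by (rule strips_bounded)
    obtain c where c: "below ?n (shift ?n \<sigma> c g) = beads (bounded_to_core k (P + \<nu>))"
      using core_shift[OF \<nu> P w b] .
    let ?h = "shift ?n \<sigma> c g"
    have wh: "window ?n ?h" by (rule window_shift[OF w m])
    obtain T h' where st: "strip_step ?n ?h T h'" "card T = s" "below ?n h' = beads (bounded_to_core k \<xi>)"
      using strips_step[OF k_bounded_add[OF Pk \<nu>] s \<xi> wh c] by blast
    \<comment> \<open>Undoing the shift. As \<open>- \<sigma>\<close> need not be weakly increasing,
      the window property of \<open>g'\<close> is obtained from the move over \<open>g\<close> and
      not from \<open>window_shift\<close>.\<close>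
    define g' where "g' = shift ?n (\<lambda>q. - \<sigma> q) (- c) h'"
    have h': "h' = shift ?n \<sigma> c g'" by (simp add: g'_def shift_shift)
    have stg: "strip_step ?n g T g'"
      using strip_step_shift[OF st(1), of "\<lambda>q. - \<sigma> q" "- c"] by (simp only: shift_shift g'_def)
    have w': "window ?n g'" by (rule step_window[OF w stg])
    have wh': "window ?n h'" by (rule step_window[OF wh st(1)])
    obtain \<kappa> where \<kappa>: "\<kappa> \<in> cores k" "beads \<kappa> = below ?n g'" "weak_strip k (card T) \<kappa> (bounded_to_core k \<nu>)"
      "hop \<kappa> (bounded_to_core k \<nu>) = push ?n g T"
      using weak_strip_of_step[OF bounded_to_core_in[OF \<nu>] w b stg] .
    define \<mu> where "\<mu> = core_to_bounded k \<kappa>"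
    have \<mu>k: "\<mu> \<in> k_bounded k" unfolding \<mu>_def by (rule core_to_bounded_in[OF \<kappa>(1)])
    have c\<mu>: "bounded_to_core k \<mu> = \<kappa>" unfolding \<mu>_def by (rule bounded_to_core_eq[OF \<kappa>(1)])
    have "\<mu> \<in> strips k s \<nu>" using \<mu>k \<kappa>(3) c\<mu> st(2) by (simp add: strips_def)
    moreover have "\<xi> = P + \<mu>"
    proof (rule k_bounded_eqI[OF \<xi>k k_bounded_add[OF Pk \<mu>k]])
      fix t assume t: "t < k"
      have "col \<xi> t = window_col ?n h' t" using window_col_eq[OF \<xi>k wh' st(3)] t by simp
      also have "\<dots> = col P t + window_col ?n g' t" unfolding h' using window_col_shift[OF w' P] t by simp
      also have "window_col ?n g' t = col \<mu> t" using window_col_eq[OF \<mu>k w'] \<kappa>(2) c\<mu> t by simp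
      finally show "col \<xi> t = col (P + \<mu>) t" by simp
    qed
    ultimately show "\<xi> \<in> (+) P ` strips k s \<nu>" by blast
  }
qed

text \<open>Membership turns into nonnegativity of a sum of two terms: the distance from
  \<open>g p - 1\<close> to \<open>G q\<close> in units of \<open>n\<close>, and
  \<open>\<sigma> q - \<sigma> p\<close>. Both are nonnegative for \<open>p \<le> q\<close> and both
  are nonpositive for \<open>q < p\<close>, where both must vanish. Hence only the equality pattern
  of \<sigma> is left.\<close>

lemma shift_below_iff:
  assumes w: "window n h" and m: "weakly_mono n \<sigma>" and p: "p < n" and q: "q < n"
    and h: "h = shift n \<sigma> c G" and cg: "[g p - 1 = G q] (mod int n)"
    and ge: "p \<le> q \<Longrightarrow> g p - 1 \<le> G q" and le: "q < p \<Longrightarrow> G q \<le> g p - 1"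
  shows "shift n \<sigma> c g p - int n - 1 \<in> below n h \<longleftrightarrow> p \<le> q \<or> (G q = g p - 1 \<and> \<sigma> q = \<sigma> p)"
proof -
  have n: "0 < n" using w by (simp add: window_def)
  \<comment> \<open>The distance from \<open>g p - 1\<close> to \<open>G q\<close> in units of
    \<open>n\<close>.\<close>
  obtain e where e: "G q - (g p - 1) = int n * e"
    using cg by (metis cong_iff_dvd_diff cong_sym dvd_def)
  have x: "shift n \<sigma> c g p - int n - 1 - h q = - (int n * (e + (\<sigma> q - \<sigma> p) + 1))"
    using e by (simp add: h shift_def algebra_simps)
  then have "int n dvd shift n \<sigma> c g p - int n - 1 - h q" by simp
  then have "[shift n \<sigma> c g p - int n - 1 = h q] (mod int n)" by (simp add: cong_iff_dvd_diff)
  then have "shift n \<sigma> c g p - int n - 1 \<in> below n h \<longleftrightarrow> shift n \<sigma> c g p - int n - 1 < h q"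
    by (rule below_iff[OF w q])
  also have "\<dots> \<longleftrightarrow> 0 < int n * (e + (\<sigma> q - \<sigma> p) + 1)" using x by linarith
  also have "\<dots> \<longleftrightarrow> 0 \<le> e + (\<sigma> q - \<sigma> p)" using n by (auto simp: zero_less_mult_iff)
  also have "\<dots> \<longleftrightarrow> p \<le> q \<or> (G q = g p - 1 \<and> \<sigma> q = \<sigma> p)"
  proof (cases "p \<le> q")
    case True
    then have "0 \<le> int n * e" using ge e by simp
    then have "0 \<le> e" using n by (simp add: zero_le_mult_iff)
    moreover have "\<sigma> p \<le> \<sigma> q" using m True q by (simp add: weakly_mono_def)
    ultimately show ?thesis using True by simp
  next
    case False
    then have "int n * e \<le> 0" using le e by simp
    then have "e \<le> 0" using n by (simp add: mult_le_0_iff)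
    moreover have "\<sigma> q \<le> \<sigma> p" using m False p by (simp add: weakly_mono_def)
    moreover have "G q = g p - 1 \<longleftrightarrow> e = 0" using e n by auto
    ultimately show ?thesis using False by auto
  qed
  finally show ?thesis .
qed

lemma num_residues_shift:
  assumes \<nu>: "\<nu> \<in> k_bounded k" and s: "s \<le> k" and \<mu>: "\<mu> \<in> strips k s \<nu>"
    and P: "rect_shift k P \<sigma>" and Q: "rect_shift k Q \<rho>"
    and eq: "\<And>p q. p < k + 1 \<Longrightarrow> q < k + 1 \<Longrightarrow> \<sigma> p = \<sigma> q \<longleftrightarrow> \<rho> p = \<rho> q"
  shows "num_residues k (bounded_to_core k (P + \<mu>)) (bounded_to_core k (P + \<nu>)) =
    num_residues k (bounded_to_core k (Q + \<mu>)) (bounded_to_core k (Q + \<nu>))"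
proof -
  let ?n = "k + 1"
  obtain g where w: "window ?n g" and b: "below ?n g = beads (bounded_to_core k \<nu>)"
    using core_window_exists[OF bounded_to_core_in[OF \<nu>]] .
  have \<mu>k: "\<mu> \<in> k_bounded k" using \<mu> by (rule strips_bounded)
  obtain T g' where st: "strip_step ?n g T g'" "below ?n g' = beads (bounded_to_core k \<mu>)"
    using strips_step[OF \<nu> s \<mu> w b] by blast
  have w': "window ?n g'" by (rule step_window[OF w st(1)])
  \<comment> \<open>The first line is about old beads (is the corner removable), the second about
    new ones (is it unblocked). \<sigma> enters only through \<open>\<sigma> q = \<sigma> p\<close>,
    so it can be exchanged for \<rho>.\<close>
  define good where "good \<sigma> p \<longleftrightarrow>
    (\<forall>q<?n. [g p - 1 = g q] (mod int ?n) \<longrightarrow> \<not> (p \<le> q \<or> (g q = g p - 1 \<and> \<sigma> q = \<sigma> p))) \<and>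
    (\<forall>q<?n. [g p - 1 = g' q] (mod int ?n) \<longrightarrow> \<not> (p \<le> q \<or> (g' q = g p - 1 \<and> \<sigma> q = \<sigma> p)))"
    for \<sigma> :: "nat \<Rightarrow> int" and p
  have main: "num_residues k (bounded_to_core k (P + \<mu>)) (bounded_to_core k (P + \<nu>)) =
      card {p. p < ?n \<and> good \<sigma> p}" if P: "rect_shift k P \<sigma>" for P \<sigma>
  proof -
    have m: "weakly_mono ?n \<sigma>" and Pk: "P \<in> k_bounded k" using P by (auto simp: rect_shift_def)
    obtain c where c: "below ?n (shift ?n \<sigma> c g) = beads (bounded_to_core k (P + \<nu>))"
      "below ?n (shift ?n \<sigma> c g') = beads (bounded_to_core k (P + \<mu>))"
      "weak_strip k (card T) (bounded_to_core k (P + \<mu>)) (bounded_to_core k (P + \<nu>))"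
      using strip_shift[OF \<nu> \<mu>k P w b st] .
    let ?h = "shift ?n \<sigma> c g" and ?h' = "shift ?n \<sigma> c g'"
    have wh: "window ?n ?h" by (rule window_shift[OF w m])
    have wh': "window ?n ?h'" by (rule window_shift[OF w' m])
    have hs: "horizontal_strip (bounded_to_core k (P + \<mu>)) (bounded_to_core k (P + \<nu>))"
      using c(3) by (simp add: weak_strip_def)
    have "(?h p - int ?n - 1 \<notin> beads (bounded_to_core k (P + \<nu>)) \<and>
        ?h p - int ?n - 1 \<notin> beads (bounded_to_core k (P + \<mu>))) \<longleftrightarrow> good \<sigma> p" if p: "p < ?n" for p
    proof -
      have 1: "?h p - int ?n - 1 \<in> below ?n ?h \<longleftrightarrow> p \<le> q \<or> (g q = g p - 1 \<and> \<sigma> q = \<sigma> p)"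
        if q: "q < ?n" "[g p - 1 = g q] (mod int ?n)" for q
        by (rule shift_below_iff[where G = g and g = g, OF wh m p q(1) refl q(2)])
          (use window_le_iff[OF w p q(1)] window_less_iff[OF w q(1) p] in auto)
      have 2: "?h p - int ?n - 1 \<in> below ?n ?h' \<longleftrightarrow> p \<le> q \<or> (g' q = g p - 1 \<and> \<sigma> q = \<sigma> p)"
        if q: "q < ?n" "[g p - 1 = g' q] (mod int ?n)" for q
      proof (rule shift_below_iff[where G = g' and g = g, OF wh' m p q(1) refl q(2)])
        show "g p - 1 \<le> g' q" if "p \<le> q"
          using step_ge[OF w st(1) q(1)] window_le_iff[OF w p q(1)] that by simp
        show "g' q \<le> g p - 1" if "q < p" using step_less[OF w st(1) that p] by simp
      qed
      obtain q1 where q1: "q1 < ?n" "[g p - 1 = g q1] (mod int ?n)" using window_cover[OF w] .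
      obtain q2 where q2: "q2 < ?n" "[g p - 1 = g' q2] (mod int ?n)" using window_cover[OF w'] .
      show ?thesis unfolding c(1)[symmetric] c(2)[symmetric] good_def using 1 2 q1 q2 by blast
    qed
    then have "{p. p < ?n \<and> ?h p - int ?n - 1 \<notin> beads (bounded_to_core k (P + \<nu>)) \<and>
        ?h p - int ?n - 1 \<notin> beads (bounded_to_core k (P + \<mu>))} = {p. p < ?n \<and> good \<sigma> p}" by blast
    then show ?thesis
      using num_residues_eq[OF bounded_to_core_in[OF k_bounded_add[OF Pk \<nu>]]
        bounded_to_core_in[OF k_bounded_add[OF Pk \<mu>k]] hs wh c(1)] by simp
  qed
  have "good \<sigma> p \<longleftrightarrow> good \<rho> p" if "p < ?n" for p
    unfolding good_def using eq[OF _ that] by blast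
  then have "{p. p < ?n \<and> good \<sigma> p} = {p. p < ?n \<and> good \<rho> p}" by blast
  then show ?thesis using main[OF P] main[OF Q] by simp
qed

section \<open>Shifts that belong to unions of rectangles\<close>

lemma rect_shift_empty: "rect_shift k {#} (\<lambda>_. 0)"
  by (simp add: rect_shift_def k_bounded_iff weakly_mono_def)

lemma rect_shift_add:
  assumes "rect_shift k P \<sigma>" "rect_shift k Q \<rho>"
  shows "rect_shift k (P + Q) (\<lambda>q. \<sigma> q + \<rho> q)"
  unfolding rect_shift_def
proof (intro conjI allI impI)
  show "P + Q \<in> k_bounded k" using assms k_bounded_add by (auto simp: rect_shift_def)
  show "weakly_mono (k + 1) (\<lambda>q. \<sigma> q + \<rho> q)"
    using assms by (auto simp: rect_shift_def weakly_mono_def intro: add_mono)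
  fix t assume t: "t < k + 1"
  have "nat (\<sigma> q + \<rho> q - (\<sigma> t + \<rho> t)) = nat (\<sigma> q - \<sigma> t) + nat (\<rho> q - \<rho> t)" if "q \<in> {t<..<k + 1}" for q
  proof -
    have "\<sigma> t \<le> \<sigma> q" "\<rho> t \<le> \<rho> q" using assms that by (auto simp: rect_shift_def weakly_mono_def)
    then show ?thesis by simp
  qed
  then have "(\<Sum>q\<in>{t<..<k + 1}. nat (\<sigma> q + \<rho> q - (\<sigma> t + \<rho> t))) =
    (\<Sum>q\<in>{t<..<k + 1}. nat (\<sigma> q - \<sigma> t) + nat (\<rho> q - \<rho> t))" by (rule sum.cong[OF refl])
  then show "col (P + Q) t = (\<Sum>q\<in>{t<..<k + 1}. nat (\<sigma> q + \<rho> q - (\<sigma> t + \<rho> t)))"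
    using assms t by (simp add: rect_shift_def sum.distrib)
qed

lemma rect_shift_repeat:
  assumes "rect_shift k P \<sigma>" shows "rect_shift k (repeat_mset a P) (\<lambda>q. int a * \<sigma> q)"
proof (induction a)
  case 0
  then show ?case using rect_shift_empty by simp
next
  case (Suc a)
  then show ?case using rect_shift_add[OF assms Suc] by (simp add: algebra_simps)
qed

lemma rect_shift_sum:
  assumes "finite A" "\<And>i. i \<in> A \<Longrightarrow> rect_shift k (P i) (\<sigma> i)"
  shows "rect_shift k (\<Sum>i\<in>A. P i) (\<lambda>q. \<Sum>i\<in>A. \<sigma> i q)"
  using assms by (induction rule: finite_induct) (auto simp: rect_shift_empty rect_shift_add)

lemma col_replicate_mset: "col (replicate_mset n x) t = (if t < x then n else 0)"
  by (induction n) (auto simp: col_def)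

text \<open>Below \<open>t\<close> each entry gets the \<open>k + 1 - t\<close> raised entries above
  it, one new bead apiece, which is the number of rows of the rectangle; from \<open>t\<close> on
  nothing changes.\<close>

lemma rect_shift_rect:
  assumes "1 \<le> t" "t \<le> k"
  shows "rect_shift k (rect k t) (\<lambda>q. if t \<le> q then 1 else 0)"
  unfolding rect_shift_def
proof (intro conjI allI impI)
  show "rect k t \<in> k_bounded k" using assms by (auto simp: rect_def k_bounded_iff)
  show "weakly_mono (k + 1) (\<lambda>q. if t \<le> q then 1 else 0)" by (auto simp: weakly_mono_def)
  fix s assume s: "s < k + 1"
  have "(\<Sum>q\<in>{s<..<k + 1}. nat ((if t \<le> q then 1 else 0) - (if t \<le> s then 1 else 0))) =
      (\<Sum>q\<in>{s<..<k + 1}. if s < t \<and> t \<le> q then 1 else 0)"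
    by (rule sum.cong) auto
  also have "\<dots> = (if s < t then k + 1 - t else 0)"
  proof (cases "s < t")
    case True
    then have "{s<..<k + 1} \<inter> {q. t \<le> q} = {t..<k + 1}" by auto
    then show ?thesis using True by (simp add: sum.If_cases)
  qed simp
  finally show "col (rect k t) s = (\<Sum>q\<in>{s<..<k + 1}. nat ((if t \<le> q then 1 else 0) - (if t \<le> s then 1 else 0)))"
    by (simp only: rect_def col_replicate_mset)
qed

section \<open>Independence of the complete symmetric functions\<close>

definition prepend :: "nat \<Rightarrow> (nat \<Rightarrow>\<^sub>0 nat) \<Rightarrow> (nat \<Rightarrow>\<^sub>0 nat)" where
  "prepend r m = Abs_poly_mapping (case_nat r (Poly_Mapping.lookup m))"

lemma lookup_prepend: "Poly_Mapping.lookup (prepend r m) = case_nat r (Poly_Mapping.lookup m)"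
proof -
  have "{i. case_nat r (Poly_Mapping.lookup m) i \<noteq> 0} \<subseteq> insert 0 (Suc ` Poly_Mapping.keys m)"
  proof
    fix i assume "i \<in> {i. case_nat r (Poly_Mapping.lookup m) i \<noteq> 0}"
    then show "i \<in> insert 0 (Suc ` Poly_Mapping.keys m)" by (cases i) (auto simp: in_keys_iff)
  qed
  then have "finite {i. case_nat r (Poly_Mapping.lookup m) i \<noteq> 0}"
    by (rule finite_subset) simp
  then show ?thesis unfolding prepend_def by simp
qed

lemma lookup_prepend_simps [simp]:
  "Poly_Mapping.lookup (prepend r m) 0 = r"
  "Poly_Mapping.lookup (prepend r m) (Suc i) = Poly_Mapping.lookup m i"
  by (simp_all add: lookup_prepend)

lemma mdeg_prepend: "mdeg (prepend r m) = r + mdeg m"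
proof -
  obtain N where N: "Poly_Mapping.keys m \<subseteq> {..<N}"
    using finite_nat_set_iff_bounded[of "Poly_Mapping.keys m"] by auto
  have "Poly_Mapping.keys (prepend r m) \<subseteq> {..<Suc N}"
  proof
    fix i assume "i \<in> Poly_Mapping.keys (prepend r m)"
    then have "i = 0 \<or> i - 1 \<in> Poly_Mapping.keys m" by (cases i) (auto simp: in_keys_iff)
    then show "i \<in> {..<Suc N}" using N by auto
  qed
  then have "mdeg (prepend r m) = (\<Sum>i<Suc N. Poly_Mapping.lookup (prepend r m) i)"
    by (intro mdeg_superset) auto
  also have "\<dots> = r + (\<Sum>i<N. Poly_Mapping.lookup m i)"
    unfolding sum.lessThan_Suc_shift by simp
  also have "(\<Sum>i<N. Poly_Mapping.lookup m i) = mdeg m"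
    using N by (intro mdeg_superset[symmetric]) auto
  finally show ?thesis .
qed

lemma prepend_add: "prepend a m + prepend b m' = prepend (a + b) (m + m')"
  by (rule poly_mapping_eqI) (simp add: lookup_add lookup_prepend split: nat.splits)

lemma prepend_inject: "prepend a m = prepend b m' \<longleftrightarrow> a = b \<and> m = m'"
proof
  assume h: "prepend a m = prepend b m'"
  have "Poly_Mapping.lookup m i = Poly_Mapping.lookup m' i" for i
    using arg_cong[OF h, of "\<lambda>x. Poly_Mapping.lookup x (Suc i)"] by simp
  then show "a = b \<and> m = m'"
    using arg_cong[OF h, of "\<lambda>x. Poly_Mapping.lookup x 0"] by (simp add: poly_mapping_eqI)
qed simp

lemma prepend_lookup: "prepend (Poly_Mapping.lookup m 0) (Poly_Mapping.map_key Suc m) = m"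
proof (rule poly_mapping_eqI)
  fix i show "Poly_Mapping.lookup (prepend (Poly_Mapping.lookup m 0) (Poly_Mapping.map_key Suc m)) i = Poly_Mapping.lookup m i"
    by (cases i) (simp_all add: map_key.rep_eq)
qed

lemma prepend_map_key:
  assumes "bij \<pi>"
  shows "\<exists>\<pi>'. bij \<pi>' \<and> prepend r (Poly_Mapping.map_key \<pi> m) = Poly_Mapping.map_key \<pi>' (prepend r m)"
proof -
  let ?p = "case_nat 0 (\<lambda>i. Suc (\<pi> i))"
  have inj: "inj \<pi>" and surj: "surj \<pi>" using assms by (auto simp: bij_def)
  have injp: "inj ?p" 
  proof (rule injI)
    fix x y assume "?p x = ?p y"
    then show "x = y" using injD[OF inj] by (cases x; cases y) auto
  qed
  have "surj ?p"
  proof (rule surjI)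
    fix i show "?p (case_nat 0 (\<lambda>i. Suc (inv \<pi> i)) i) = i"
      using surj by (cases i) (simp_all add: surj_f_inv_f)
  qed
  then have "bij ?p" using injp by (simp add: bij_def)
  moreover have "prepend r (Poly_Mapping.map_key \<pi> m) = Poly_Mapping.map_key ?p (prepend r m)"
  proof (rule poly_mapping_eqI)
    fix i show "Poly_Mapping.lookup (prepend r (Poly_Mapping.map_key \<pi> m)) i =
        Poly_Mapping.lookup (Poly_Mapping.map_key ?p (prepend r m)) i"
      by (cases i) (simp_all add: map_key.rep_eq[OF inj] map_key.rep_eq[OF injp])
  qed
  ultimately show ?thesis by blast
qed

text \<open>\<open>hperp r\<close> extracts the coefficient of $x_0^r$; it is the adjoint of multiplication by $h_r$.\<close>

lift_definition hperp :: "nat \<Rightarrow> symfun \<Rightarrow> symfun" is "\<lambda>r f m. f (prepend r m)"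
proof (elim conjE exE, intro conjI exI allI impI)
  fix r d :: nat and f :: "(nat \<Rightarrow>\<^sub>0 nat) \<Rightarrow> int" and m
  assume "\<forall>m. f m \<noteq> 0 \<longrightarrow> mdeg m \<le> d" "f (prepend r m) \<noteq> 0"
  then have "mdeg (prepend r m) \<le> d" by blast
  then show "mdeg m \<le> d" by (simp add: mdeg_prepend)
next
  fix r :: nat and f :: "(nat \<Rightarrow>\<^sub>0 nat) \<Rightarrow> int" and \<pi> :: "nat \<Rightarrow> nat" and m
  assume "\<forall>\<pi> m. bij \<pi> \<longrightarrow> f (Poly_Mapping.map_key \<pi> m) = f m" "bij \<pi>"
  then show "f (prepend r (Poly_Mapping.map_key \<pi> m)) = f (prepend r m)"
    using prepend_map_key[of \<pi> r m] by metis
qed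

lemma hperp_add: "hperp r (f + g) = hperp r f + hperp r g"
  by transfer simp

lemma symfun_eqI: "(\<And>m. sym_coeff f m = sym_coeff g m) \<Longrightarrow> f = g"
  by (simp add: sym_coeff_inject[symmetric] fun_eq_iff)

lemma sym_coeff_sum: "sym_coeff (\<Sum>i\<in>A. f i) m = (\<Sum>i\<in>A. sym_coeff (f i) m)"
  by (induction A rule: infinite_finite_induct) (simp_all add: zero_symfun.rep_eq plus_symfun.rep_eq)

text \<open>The exponent \<open>r\<close> of the first variable is split between the two
  factors.\<close>

lemma hperp_mult: "hperp r (f * g) = (\<Sum>i\<le>r. hperp i f * hperp (r - i) g)"
proof (rule symfun_eqI)
  fix m
  have "sym_coeff (hperp r (f * g)) m = (\<Sum>(a, b)\<in>splits (prepend r m). sym_coeff f a * sym_coeff g b)"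
    by (simp add: hperp.rep_eq times_symfun.rep_eq)
  also have "\<dots> = (\<Sum>(i, a, b)\<in>{..r} \<times> splits m. sym_coeff f (prepend i a) * sym_coeff g (prepend (r - i) b))"
  proof (rule sum.reindex_bij_witness[where
      i = "\<lambda>(i, a, b). (prepend i a, prepend (r - i) b)" and
      j = "\<lambda>(a, b). (Poly_Mapping.lookup a 0, Poly_Mapping.map_key Suc a, Poly_Mapping.map_key Suc b)"])
    fix x assume "x \<in> splits (prepend r m)"
    then obtain a b where x: "x = (a, b)" and ab: "a + b = prepend r m" by (auto simp: splits_def)
    have l: "Poly_Mapping.lookup a 0 + Poly_Mapping.lookup b 0 = r"
      using arg_cong[OF ab, of "\<lambda>x. Poly_Mapping.lookup x 0"] by (simp add: lookup_add)
    then have b0: "r - Poly_Mapping.lookup a 0 = Poly_Mapping.lookup b 0" by simp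
    show "(case (case x of (a, b) \<Rightarrow> (Poly_Mapping.lookup a 0, Poly_Mapping.map_key Suc a, Poly_Mapping.map_key Suc b)) of
        (i, a, b) \<Rightarrow> (prepend i a, prepend (r - i) b)) = x"
      by (simp add: x b0 prepend_lookup)
    have "prepend r (Poly_Mapping.map_key Suc a + Poly_Mapping.map_key Suc b) = prepend r m"
      using prepend_add[of "Poly_Mapping.lookup a 0" "Poly_Mapping.map_key Suc a" "Poly_Mapping.lookup b 0" "Poly_Mapping.map_key Suc b"]
      by (simp add: prepend_lookup l ab)
    then show "(case x of (a, b) \<Rightarrow> (Poly_Mapping.lookup a 0, Poly_Mapping.map_key Suc a, Poly_Mapping.map_key Suc b))
        \<in> {..r} \<times> splits m"
      using l by (auto simp: x splits_def prepend_inject)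
    show "(case (case x of (a, b) \<Rightarrow> (Poly_Mapping.lookup a 0, Poly_Mapping.map_key Suc a, Poly_Mapping.map_key Suc b)) of
        (i, a, b) \<Rightarrow> sym_coeff f (prepend i a) * sym_coeff g (prepend (r - i) b)) =
        (case x of (a, b) \<Rightarrow> sym_coeff f a * sym_coeff g b)"
      by (simp add: x b0 prepend_lookup)
  next
    fix y assume "y \<in> {..r} \<times> splits m"
    then obtain i a b where y: "y = (i, a, b)" "i \<le> r" "a + b = m" by (auto simp: splits_def)
    have sh: "Poly_Mapping.map_key Suc (prepend j c) = c" for j c
      by (rule poly_mapping_eqI) (simp add: map_key.rep_eq)
    show "(case (case y of (i, a, b) \<Rightarrow> (prepend i a, prepend (r - i) b)) of
        (a, b) \<Rightarrow> (Poly_Mapping.lookup a 0, Poly_Mapping.map_key Suc a, Poly_Mapping.map_key Suc b)) = y"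
      by (simp add: y sh)
    show "(case y of (i, a, b) \<Rightarrow> (prepend i a, prepend (r - i) b)) \<in> splits (prepend r m)"
      using y by (simp add: splits_def prepend_add)
  qed
  also have "\<dots> = (\<Sum>i\<le>r. \<Sum>(a, b)\<in>splits m. sym_coeff f (prepend i a) * sym_coeff g (prepend (r - i) b))"
    by (simp add: sum.cartesian_product case_prod_unfold)
  also have "\<dots> = sym_coeff (\<Sum>i\<le>r. hperp i f * hperp (r - i) g) m"
    by (simp add: sym_coeff_sum hperp.rep_eq times_symfun.rep_eq)
  finally show "sym_coeff (hperp r (f * g)) m = sym_coeff (\<Sum>i\<le>r. hperp i f * hperp (r - i) g) m" .
qed

lemma hperp_hsym: "hperp r (hsym n) = (if r \<le> n then hsym (n - r) else 0)"
  by (rule symfun_eqI) (auto simp: hperp.rep_eq hsym.rep_eq mdeg_prepend zero_symfun.rep_eq)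

text \<open>A variable of exponent 0 in front can be rotated by symmetry past all variables that
  occur in \<open>m\<close>.\<close>

lemma hperp_0: "hperp 0 f = f"
proof (rule symfun_eqI)
  fix m :: "nat \<Rightarrow>\<^sub>0 nat"
  obtain N where N: "Poly_Mapping.keys m \<subseteq> {..<N}"
    using finite_nat_set_iff_bounded[of "Poly_Mapping.keys m"] by auto
  define \<pi> where "\<pi> i = (if i < N then Suc i else if i = N then 0 else i)" for i
  define \<rho> where "\<rho> i = (if i = 0 then N else if i \<le> N then i - 1 else i)" for i
  have "\<pi> (\<rho> i) = i" "\<rho> (\<pi> i) = i" for i by (auto simp: \<pi>_def \<rho>_def)
  then have bij: "bij \<pi>" by (intro o_bij[of \<rho>]) (auto simp: fun_eq_iff)
  then have inj: "inj \<pi>" by (rule bij_is_inj)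
  have out: "Poly_Mapping.lookup m i = 0" if "N \<le> i" for i
    using N that by (metis in_keys_iff lessThan_iff not_le subsetD)
  have "Poly_Mapping.map_key \<pi> (prepend 0 m) = m"
  proof (rule poly_mapping_eqI)
    fix i
    have "Poly_Mapping.lookup (prepend 0 m) i = 0" if "N < i"
      using that out[of "i - 1"] by (cases i) auto
    then show "Poly_Mapping.lookup (Poly_Mapping.map_key \<pi> (prepend 0 m)) i = Poly_Mapping.lookup m i"
      using out[of i] by (auto simp: map_key.rep_eq[OF inj] \<pi>_def)
  qed
  then show "sym_coeff (hperp 0 f) m = sym_coeff f m"
    using bij sym_coeff[of f] by (simp add: hperp.rep_eq) (metis (mono_tags, lifting))
qed

text \<open>The adjoint of multiplication by the power sum $p_r$, obtained from \<open>hperp\<close> through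
  Newton's identities. It is a derivation which acts on polynomials in $h_1, \ldots, h_r$
  as $\partial/\partial h_r$, whence the independence of the $h_i$.\<close>

function pperp :: "nat \<Rightarrow> symfun \<Rightarrow> symfun" where
  "pperp r f = of_nat r * hperp r f - (\<Sum>i\<in>{1..<r}. pperp i (hperp (r - i) f))"
  by auto
termination by (relation "measure fst") auto

declare pperp.simps [simp del]

lemma pperp_newton: "(\<Sum>i\<in>{1..r}. pperp i (hperp (r - i) f)) = of_nat r * hperp r f"
proof (cases "r = 0")
  case False
  then have "{1..r} = insert r {1..<r}" by auto
  then show ?thesis using pperp.simps[of r f] by (simp add: hperp_0)
qed simp

lemma pperp_add: "pperp r (f + g) = pperp r f + pperp r g"
proof (induction r arbitrary: f g rule: less_induct)
  case (less r)
  then show ?case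
    by (subst (1 2 3) pperp.simps) (simp add: hperp_add sum.distrib algebra_simps)
qed

lemma pperp_0_fun: "pperp r 0 = 0"
  using pperp_add[of r 0 0] by (metis add.right_neutral add_left_cancel)

lemma pperp_sum: "pperp r (\<Sum>i\<in>A. f i) = (\<Sum>i\<in>A. pperp r (f i))"
  by (induction A rule: infinite_finite_induct) (simp_all add: pperp_add pperp_0_fun)

text \<open>The sum over \<open>i\<close> of the product rule for \<open>pperp i\<close> after
  \<open>hperp (r - i)\<close> is computed by Newton's identity in each factor. The weights
  \<open>j\<close> and \<open>r - j\<close> add up to \<open>r\<close>, as Newton's identity for
  \<open>f * g\<close> demands. The rule holds for \<open>i < r\<close> by induction, so the
  remaining term \<open>i = r\<close> obeys it as well.\<close>

lemma pperp_mult: "1 \<le> r \<Longrightarrow> pperp r (f * g) = pperp r f * g + f * pperp r g"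
proof (induction r arbitrary: f g rule: less_induct)
  case (less r)
  define U where "U i j l = pperp i (hperp j f) * hperp l g" for i j l
  define V where "V i j l = hperp j f * pperp i (hperp l g)" for i j l
  define A where "A i = (\<Sum>j\<le>r - i. U i j (r - i - j) + V i j (r - i - j))" for i
  have IH: "pperp i (hperp (r - i) (f * g)) = A i" if "i \<in> {1..<r}" for i
    using less.IH[of i] that by (simp add: hperp_mult pperp_sum A_def U_def V_def)
  \<comment> \<open>Grouped by the index \<open>l\<close> on \<open>g\<close>, the inner sum is
    Newton's identity of degree \<open>r - l\<close> for \<open>f\<close>.\<close>
  have "(\<Sum>i\<in>{1..r}. \<Sum>j\<le>r - i. U i j (r - i - j)) = (\<Sum>l\<le>r. \<Sum>i\<in>{1..r - l}. U i (r - l - i) l)"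
    unfolding sum.Sigma[OF finite_atLeastAtMost ballI[OF finite_atMost]] sum.Sigma[OF finite_atMost ballI[OF finite_atLeastAtMost]]
    by (rule sum.reindex_bij_witness[where i = "\<lambda>(l, i). (i, r - l - i)" and j = "\<lambda>(i, j). (r - i - j, i)"]) auto
  also have "\<dots> = (\<Sum>l\<le>r. of_nat (r - l) * hperp (r - l) f * hperp l g)"
    unfolding U_def sum_distrib_right[symmetric] pperp_newton ..
  also have "\<dots> = (\<Sum>j\<le>r. of_nat j * (hperp j f * hperp (r - j) g))"
    by (rule sum.reindex_bij_witness[where i = "\<lambda>j. r - j" and j = "\<lambda>l. r - l"]) (auto simp: mult.assoc)
  finally have U: "(\<Sum>i\<in>{1..r}. \<Sum>j\<le>r - i. U i j (r - i - j)) = (\<Sum>j\<le>r. of_nat j * (hperp j f * hperp (r - j) g))" .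
  have "(\<Sum>i\<in>{1..r}. \<Sum>j\<le>r - i. V i j (r - i - j)) = (\<Sum>j\<le>r. \<Sum>i\<in>{1..r - j}. V i j (r - j - i))"
    unfolding sum.Sigma[OF finite_atLeastAtMost ballI[OF finite_atMost]] sum.Sigma[OF finite_atMost ballI[OF finite_atLeastAtMost]]
    by (rule sum.reindex_bij_witness[where i = "\<lambda>(j, i). (i, j)" and j = "\<lambda>(i, j). (j, i)"])
      (auto simp: add.commute)
  also have "\<dots> = (\<Sum>j\<le>r. of_nat (r - j) * (hperp j f * hperp (r - j) g))"
    unfolding V_def sum_distrib_left[symmetric] pperp_newton by (simp add: mult.left_commute)
  finally have V: "(\<Sum>i\<in>{1..r}. \<Sum>j\<le>r - i. V i j (r - i - j)) = (\<Sum>j\<le>r. of_nat (r - j) * (hperp j f * hperp (r - j) g))" .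
  have "(\<Sum>i\<in>{1..r}. A i) = (\<Sum>j\<le>r. of_nat j * (hperp j f * hperp (r - j) g) + of_nat (r - j) * (hperp j f * hperp (r - j) g))"
    unfolding A_def sum.distrib U V ..
  also have "\<dots> = (\<Sum>j\<le>r. of_nat r * (hperp j f * hperp (r - j) g))"
    by (rule sum.cong) (auto simp: distrib_right[symmetric] of_nat_add[symmetric] simp del: of_nat_add)
  also have "\<dots> = of_nat r * hperp r (f * g)" by (simp add: hperp_mult sum_distrib_left)
  also have "\<dots> = (\<Sum>i\<in>{1..r}. pperp i (hperp (r - i) (f * g)))" by (rule pperp_newton[symmetric])
  finally have eq: "(\<Sum>i\<in>{1..r}. A i) = (\<Sum>i\<in>{1..r}. pperp i (hperp (r - i) (f * g)))" .
  have last: "{1..r} = insert r {1..<r}" using less.prems by auto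
  have "A r = pperp r (hperp 0 (f * g))"
    using eq IH unfolding last by simp
  then show ?case by (simp add: A_def U_def V_def hperp_0)
qed

lemma pperp_one: "1 \<le> r \<Longrightarrow> pperp r 1 = 0"
  using pperp_mult[of r 1 1] by (metis add.right_neutral add_left_cancel mult.left_neutral mult.right_neutral)

lemma pperp_of_nat: "1 \<le> r \<Longrightarrow> pperp r (of_nat n) = 0"
  by (induction n) (simp_all add: pperp_0_fun pperp_add pperp_one)

lemma pperp_of_int:
  assumes "1 \<le> r" shows "pperp r (of_int c) = 0"
proof (cases c rule: int_cases2)
  case (nonneg n)
  then show ?thesis using pperp_of_nat[OF assms] by simp
next
  case (nonpos n)
  then show ?thesis using pperp_of_nat[OF assms, of n] pperp_add[of r "of_int c" "of_nat n"]
    by (simp add: pperp_0_fun)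
qed

text \<open>For \<open>r \<le> n\<close> the recursion reads \<open>r\<close> copies of
  \<open>hsym (n - r)\<close> minus one for each \<open>i\<close> in \<open>{1..<r}\<close>, so a
  single copy survives.\<close>

lemma pperp_hsym: "1 \<le> r \<Longrightarrow> pperp r (hsym n) = (if r \<le> n then hsym (n - r) else 0)"
proof (induction r arbitrary: n rule: less_induct)
  case (less r)
  have "pperp i (hperp (r - i) (hsym n)) = (if r \<le> n then hsym (n - r) else 0)" if "i \<in> {1..<r}" for i
  proof (cases "r - i \<le> n")
    case True
    have "pperp i (hsym (n - (r - i))) = (if i \<le> n - (r - i) then hsym (n - (r - i) - i) else 0)"
      using less.IH[of i "n - (r - i)"] that by simp
    moreover have "n - (r - i) - i = n - r" "i \<le> n - (r - i) \<longleftrightarrow> r \<le> n" using True that by auto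
    ultimately show ?thesis using True by (simp add: hperp_hsym)
  next
    case False
    then show ?thesis by (auto simp: hperp_hsym pperp_0_fun)
  qed
  then have "(\<Sum>i\<in>{1..<r}. pperp i (hperp (r - i) (hsym n))) = of_nat (r - 1) * (if r \<le> n then hsym (n - r) else 0)"
    by simp
  moreover have "of_nat r = 1 + (of_nat (r - 1) :: symfun)" using less.prems by (simp add: of_nat_diff)
  ultimately show ?case by (simp add: pperp.simps[of r] hperp_hsym algebra_simps)
qed

lemma hsym_0: "hsym 0 = 1"
proof (rule symfun_eqI)
  fix m :: "nat \<Rightarrow>\<^sub>0 nat"
  have "mdeg m = 0 \<longleftrightarrow> m = 0"
  proof
    assume "mdeg m = 0"
    then show "m = 0" using lookup_le_mdeg[of m] by (intro poly_mapping_eqI) simp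
  qed (simp add: mdeg_def)
  then show "sym_coeff (hsym 0) m = sym_coeff 1 m" by (simp add: hsym.rep_eq one_symfun.rep_eq)
qed

section \<open>Linear independence of the products of complete symmetric functions\<close>

definition hprod :: "nat multiset \<Rightarrow> symfun" where
  "hprod \<mu> = prod_mset (image_mset hsym \<mu>)"

lemma hprod_add: "hprod (\<mu> + {#r#}) = hsym r * hprod \<mu>"
  by (simp add: hprod_def mult.commute)

lemma pperp_hprod:
  assumes "1 \<le> r"
  shows "\<forall>x\<in>#\<mu>. x \<le> r \<Longrightarrow> pperp r (hprod \<mu>) = of_nat (count \<mu> r) * hprod (\<mu> - {#r#})"
proof (induction \<mu>)
  case empty
  then show ?case using pperp_one[OF assms] by (simp add: hprod_def)
next
  case (add x \<mu>)
  have IH: "pperp r (hprod \<mu>) = of_nat (count \<mu> r) * hprod (\<mu> - {#r#})" using add by simp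
  have "pperp r (hprod (add_mset x \<mu>)) = pperp r (hsym x) * hprod \<mu> + hsym x * pperp r (hprod \<mu>)"
    by (simp add: hprod_def pperp_mult[OF assms])
  also have "\<dots> = of_nat (count (add_mset x \<mu>) r) * hprod (add_mset x \<mu> - {#r#})"
  proof (cases "x = r")
    case True
    have "of_nat (count \<mu> r) * (hsym r * hprod (\<mu> - {#r#})) = of_nat (count \<mu> r) * hprod \<mu>"
    proof (cases "r \<in># \<mu>")
      case True
      then show ?thesis using hprod_add[of "\<mu> - {#r#}" r] by simp
    next
      case False
      then show ?thesis by (simp add: not_in_iff)
    qed
    then show ?thesis using True by (simp add: pperp_hsym[OF assms] hsym_0 IH distrib_right mult.left_commute)
  next
    case False
    then have "x < r" using add.prems by auto
    then have "pperp r (hsym x) = 0" using pperp_hsym[OF assms] by simp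
    moreover have "hprod (add_mset x \<mu> - {#r#}) = hsym x * hprod (\<mu> - {#r#})"
      using False by (simp add: hprod_def)
    ultimately show ?thesis using False by (simp add: IH mult.left_commute)
  qed
  finally show ?case .
qed

lemma of_int_symfun_eq_0: "of_int c = (0 :: symfun) \<Longrightarrow> c = 0"
proof -
  have n: "sym_coeff (of_nat n) 0 = int n" for n
    by (induction n) (simp_all add: zero_symfun.rep_eq one_symfun.rep_eq plus_symfun.rep_eq)
  assume h: "of_int c = (0 :: symfun)"
  show "c = 0"
  proof (cases c rule: int_cases2)
    case (nonneg j)
    then show ?thesis using h n[of j] by (simp add: zero_symfun.rep_eq)
  next
    case (nonpos j)
    then show ?thesis using h n[of j] by (simp add: zero_symfun.rep_eq)
  qed
qed

text \<open>Differentiating by the largest generator removes the terms without it and shortens the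
  others, which are then settled by induction on the size \<open>d\<close>. The terms without the
  largest generator fall to the outer induction on \<open>r\<close>.\<close>

lemma hprod_independent_aux:
  assumes "finite A" "\<And>\<mu>. \<mu> \<in> A \<Longrightarrow> (\<forall>x\<in>#\<mu>. 1 \<le> x \<and> x \<le> r) \<and> size \<mu> \<le> d"
    "(\<Sum>\<mu>\<in>A. of_int (c \<mu>) * hprod \<mu>) = 0"
  shows "\<forall>\<mu>\<in>A. c \<mu> = 0"
  using assms
proof (induction r arbitrary: d A c)
  case 0
  have sub: "A \<subseteq> {{#}}"
  proof
    fix \<mu> assume "\<mu> \<in> A"
    then have "\<forall>x\<in>#\<mu>. False" using 0(2) by force
    then show "\<mu> \<in> {{#}}" by auto
  qed
  then consider "A = {}" | "A = {{#}}" by blast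
  then show ?case using 0(3) of_int_symfun_eq_0 by cases (simp_all add: hprod_def)
next
  case (Suc r)
  note outer = Suc.IH
  show ?case using Suc.prems
  proof (induction d arbitrary: A c)
    case 0
    then have "A \<subseteq> {{#}}" by auto
    then consider "A = {}" | "A = {{#}}" by blast
    then show ?case using 0(3) of_int_symfun_eq_0 by cases (simp_all add: hprod_def)
  next
    case (Suc d)
    let ?R = "Suc r"
    define A1 where "A1 = {\<mu> \<in> A. ?R \<in># \<mu>}"
    define B where "B = (\<lambda>\<mu>. \<mu> - {#?R#}) ` A1"
    \<comment> \<open>The derivative multiplies a coefficient by the multiplicity of
      \<open>?R\<close>, which is positive on \<open>A1\<close>, so vanishing of \<open>c'\<close>
      carries back to \<open>c\<close>.\<close>
    define c' where "c' \<mu> = c (add_mset ?R \<mu>) * int (count (add_mset ?R \<mu>) ?R)" for \<mu>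
    have finA1: "finite A1" using Suc.prems(1) by (simp add: A1_def)
    have dm: "add_mset ?R (\<mu> - {#?R#}) = \<mu>" if "\<mu> \<in> A1" for \<mu>
      using that by (intro insert_DiffM) (simp add: A1_def)
    have inj: "inj_on (\<lambda>\<mu>. \<mu> - {#?R#}) A1"
    proof (rule inj_onI)
      fix \<mu> \<nu> assume "\<mu> \<in> A1" "\<nu> \<in> A1" "\<mu> - {#?R#} = \<nu> - {#?R#}"
      then show "\<mu> = \<nu>" using dm by metis
    qed
    have "pperp ?R (of_int (c \<mu>) * hprod \<mu>) = of_int (c \<mu> * int (count \<mu> ?R)) * hprod (\<mu> - {#?R#})" if "\<mu> \<in> A" for \<mu>
      using Suc.prems(2)[OF that] pperp_hprod[of ?R \<mu>]
      by (simp add: pperp_mult pperp_of_int mult.assoc)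
    then have "pperp ?R (\<Sum>\<mu>\<in>A. of_int (c \<mu>) * hprod \<mu>) = (\<Sum>\<mu>\<in>A. of_int (c \<mu> * int (count \<mu> ?R)) * hprod (\<mu> - {#?R#}))"
      unfolding pperp_sum by (rule sum.cong[OF refl])
    then have "0 = (\<Sum>\<mu>\<in>A. of_int (c \<mu> * int (count \<mu> ?R)) * hprod (\<mu> - {#?R#}))"
      using Suc.prems(3) by (simp add: pperp_0_fun)
    also have "\<dots> = (\<Sum>\<mu>\<in>A1. of_int (c \<mu> * int (count \<mu> ?R)) * hprod (\<mu> - {#?R#}))"
      by (rule sum.mono_neutral_right[OF Suc.prems(1)]) (auto simp: A1_def not_in_iff)
    also have "\<dots> = (\<Sum>\<mu>\<in>A1. of_int (c' (\<mu> - {#?R#})) * hprod (\<mu> - {#?R#}))"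
    proof (rule sum.cong[OF refl])
      fix \<mu> assume "\<mu> \<in> A1"
      then have "add_mset ?R (\<mu> - {#?R#}) = \<mu>" by (rule dm)
      then show "of_int (c \<mu> * int (count \<mu> ?R)) * hprod (\<mu> - {#?R#}) = of_int (c' (\<mu> - {#?R#})) * hprod (\<mu> - {#?R#})"
        by (simp only: c'_def)
    qed
    also have "\<dots> = (\<Sum>\<mu>\<in>B. of_int (c' \<mu>) * hprod \<mu>)"
      unfolding B_def by (simp add: sum.reindex[OF inj])
    finally have z: "(\<Sum>\<mu>\<in>B. of_int (c' \<mu>) * hprod \<mu>) = 0" by simp
    have "(\<forall>x\<in>#\<mu>. 1 \<le> x \<and> x \<le> ?R) \<and> size \<mu> \<le> d" if "\<mu> \<in> B" for \<mu>
    proof -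
      obtain \<nu> where \<nu>: "\<nu> \<in> A" "?R \<in># \<nu>" "\<mu> = \<nu> - {#?R#}" using \<open>\<mu> \<in> B\<close> by (auto simp: B_def A1_def)
      then show ?thesis using Suc.prems(2)[OF \<nu>(1)] in_diffD[of _ \<nu> "{#?R#}"] by (auto simp: size_Diff_singleton)
    qed
    then have cB: "\<forall>\<mu>\<in>B. c' \<mu> = 0" using Suc.IH[of B c'] finA1 z unfolding B_def by simp
    have c1: "c \<mu> = 0" if "\<mu> \<in> A1" for \<mu>
    proof -
      have "c' (\<mu> - {#?R#}) = 0" using cB that by (simp add: B_def)
      then have "c \<mu> * int (count \<mu> ?R) = 0" unfolding c'_def dm[OF that] .
      moreover have "count \<mu> ?R \<noteq> 0" using that by (simp add: A1_def)
      ultimately show ?thesis by simp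
    qed
    have "(\<Sum>\<mu>\<in>A - A1. of_int (c \<mu>) * hprod \<mu>) = (\<Sum>\<mu>\<in>A. of_int (c \<mu>) * hprod \<mu>)"
      by (rule sum.mono_neutral_left) (use Suc.prems(1) c1 in auto)
    then have "\<forall>\<mu>\<in>A - A1. c \<mu> = 0"
    proof (intro outer[of "A - A1" "Suc d"])
      fix \<mu> assume \<mu>: "\<mu> \<in> A - A1"
      then have "?R \<notin># \<mu>" by (simp add: A1_def)
      then show "(\<forall>x\<in>#\<mu>. 1 \<le> x \<and> x \<le> r) \<and> size \<mu> \<le> Suc d"
        using Suc.prems(2)[of \<mu>] \<mu> by (auto simp: le_Suc_eq)
    qed (use Suc.prems in auto)
    then show ?case using c1 by blast
  qed
qed

lemma hprod_independent:
  assumes "finite A" "A \<subseteq> k_bounded k" "(\<Sum>\<mu>\<in>A. of_int (c \<mu>) * hprod \<mu>) = 0" "\<mu> \<in> A"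
  shows "c \<mu> = 0"
proof -
  have "size \<mu> \<le> Max (size ` A)" if "\<mu> \<in> A" for \<mu> using that assms(1) by simp
  then have "\<forall>\<mu>\<in>A. c \<mu> = 0"
    using assms(2,3) by (intro hprod_independent_aux[OF assms(1), of k "Max (size ` A)" c])
      (auto simp: k_bounded_iff subset_iff)
  then show ?thesis using assms(4) by blast
qed

section \<open>The Pieri recursion\<close>

text \<open>For a bounded partition this is the sum of \<open>x choose 2\<close> over its parts
  \<open>x\<close>.\<close>

definition col_weight :: "nat \<Rightarrow> nat multiset \<Rightarrow> nat" where
  "col_weight k \<mu> = (\<Sum>t<k. t * col \<mu> t)"

text \<open>Among the partitions $\mu$ occurring in $h_r g_\nu$ in top degree, $\nu \cup (r)$ is the one whose
  new cells lie in the leftmost columns, so it has the least \<open>col_weight\<close>.\<close>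

definition lower :: "nat \<Rightarrow> nat multiset \<Rightarrow> nat multiset \<Rightarrow> bool" where
  "lower k \<mu> \<nu> \<longleftrightarrow> \<mu> \<in> k_bounded k \<and> (sum_mset \<mu> < sum_mset \<nu> \<or>
    sum_mset \<mu> = sum_mset \<nu> \<and> col_weight k \<nu> < col_weight k \<mu>)"

lemma col_weight_add: "col_weight k (\<mu> + \<nu>) = col_weight k \<mu> + col_weight k \<nu>"
  by (simp add: col_weight_def sum.distrib distrib_left)

lemma lower_trans: "lower k \<mu> \<nu> \<Longrightarrow> lower k \<nu> \<rho> \<Longrightarrow> lower k \<mu> \<rho>"
  unfolding lower_def by auto

lemma lower_add: "lower k \<mu> \<nu> \<Longrightarrow> 1 \<le> r \<Longrightarrow> r \<le> k \<Longrightarrow> lower k (\<mu> + {#r#}) (\<nu> + {#r#})"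
  unfolding lower_def by (auto simp: col_weight_add k_bounded_iff simp del: union_mset_add_mset_right add_mset_add_single[symmetric])

text \<open>Going down in \<open>lower\<close> within one degree raises the weight; this bound makes
  the descent finite.\<close>

lemma col_weight_le:
  assumes "\<mu> \<in> k_bounded k" shows "col_weight k \<mu> \<le> k * sum_mset \<mu>"
proof -
  have "col_weight k \<mu> \<le> (\<Sum>t<k. k * col \<mu> t)"
    unfolding col_weight_def by (intro sum_mono mult_right_mono) auto
  also have "\<dots> = k * sum_mset \<mu>"
    using sum_mset_eq_sum_col[OF assms order_refl] by (simp add: sum_distrib_left)
  finally show ?thesis .
qed

lemma k_bounded_lower_induct [consumes 1, case_names less]:
  assumes "\<theta> \<in> k_bounded k"
    and step: "\<And>\<theta>. \<theta> \<in> k_bounded k \<Longrightarrow> (\<And>\<mu>. lower k \<mu> \<theta> \<Longrightarrow> R \<mu>) \<Longrightarrow> R \<theta>"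
  shows "R \<theta>"
  using assms(1)
proof (induction \<theta> rule: wf_induct_rule[OF wf_measures[of "[sum_mset, \<lambda>\<mu>. k * sum_mset \<mu> - col_weight k \<mu>]"]])
  case (1 \<theta>)
  show ?case
  proof (rule step[OF 1(2)])
    fix \<mu> assume l: "lower k \<mu> \<theta>"
    then have \<mu>: "\<mu> \<in> k_bounded k" by (simp add: lower_def)
    have "(\<mu>, \<theta>) \<in> measures [sum_mset, \<lambda>\<mu>. k * sum_mset \<mu> - col_weight k \<mu>]"
      using l col_weight_le[OF \<mu>] unfolding lower_def by auto
    then show "R \<mu>" using 1(1) \<mu> by blast
  qed
qed

text \<open>Exchange argument: the elements of \<open>T\<close> outside the initial segment are at
  least \<open>card T\<close>, the equally many missing ones are smaller.\<close>

lemma sum_lessThan_card_less: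
  fixes T :: "nat set"
  assumes "finite T" "T \<noteq> {..<card T}"
  shows "\<Sum>{..<card T} < \<Sum>T"
proof -
  let ?L = "{..<card T}"
  have c: "card (T - ?L) = card (?L - T)"
    using card_Diff_subset_Int[of T ?L] card_Diff_subset_Int[of ?L T] assms(1) by (simp add: Int_commute)
  have ne: "?L - T \<noteq> {}"
  proof
    assume "?L - T = {}"
    then have "?L = T" using assms(1) by (intro card_subset_eq) auto
    then show False using assms(2) by simp
  qed
  have "\<Sum>(?L - T) < (\<Sum>t\<in>?L - T. card T)" using ne by (intro sum_strict_mono) auto
  also have "\<dots> = (\<Sum>t\<in>T - ?L. card T)" using c by simp
  also have "\<dots> \<le> \<Sum>(T - ?L)" by (intro sum_mono) auto
  finally have "\<Sum>(?L - T) < \<Sum>(T - ?L)" .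
  moreover have "\<Sum>T = \<Sum>(T \<inter> ?L) + \<Sum>(T - ?L)" by (rule sum.Int_Diff[OF assms(1)])
  moreover have "\<Sum>?L = \<Sum>(?L \<inter> T) + \<Sum>(?L - T)" by (rule sum.Int_Diff) simp
  ultimately show ?thesis by (simp add: Int_commute)
qed

text \<open>A strip of size \<open>s\<close> over \<nu> adds \<open>s\<close> to the total size and
  the sum of its column set \<open>T\<close> to the weight. For \<open>s = r\<close> this sum is
  least for \<open>T = {..<r}\<close>, and that column set means adding the part
  \<open>r\<close>.\<close>

lemma strips_lower:
  assumes \<nu>: "\<nu> \<in> k_bounded k" and s: "s \<le> r" "1 \<le> r" "r \<le> k" and \<mu>: "\<mu> \<in> strips k s \<nu>"
    and ne: "s = r \<Longrightarrow> \<mu> \<noteq> \<nu> + {#r#}"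
  shows "lower k \<mu> (\<nu> + {#r#})"
proof -
  have \<mu>k: "\<mu> \<in> k_bounded k" using \<mu> by (rule strips_bounded)
  obtain T where T: "T \<subseteq> {..<k}" "card T = s" "\<And>t. col \<mu> t = col \<nu> t + (if t \<in> T then 1 else 0)"
    using strips_col[OF \<nu> _ \<mu>] s by (metis le_trans)
  have fin: "finite T" using T(1) finite_subset by blast
  have on_T: "(\<Sum>t<k. if t \<in> T then f t else 0) = sum f T" for f :: "nat \<Rightarrow> nat"
    using T(1) by (simp add: sum.If_cases Int_absorb1)
  have "sum_mset \<mu> = (\<Sum>t<k. col \<nu> t) + (\<Sum>t<k. if t \<in> T then 1 else 0)"
    using sum_mset_eq_sum_col[OF \<mu>k order_refl] by (simp only: T(3) sum.distrib)
  then have S: "sum_mset \<mu> = sum_mset \<nu> + s"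
    using sum_mset_eq_sum_col[OF \<nu> order_refl] on_T[of "\<lambda>_. 1"] T(2) by simp
  show ?thesis
  proof (cases "s < r")
    case True
    then show ?thesis using S \<mu>k by (simp add: lower_def)
  next
    case False
    then have sr: "s = r" using s by simp
    have "T \<noteq> {..<r}"
    proof
      assume h: "T = {..<r}"
      have "\<mu> = \<nu> + {#r#}"
      proof (rule k_bounded_eqI[OF \<mu>k])
        show "\<nu> + {#r#} \<in> k_bounded k" using \<nu> s by (auto simp: k_bounded_iff)
        show "col \<mu> t = col (\<nu> + {#r#}) t" for t unfolding T(3) col_add col_single h by simp
      qed
      then show False using ne sr by blast
    qed
    then have "\<Sum>{..<r} < \<Sum>T" using sum_lessThan_card_less[OF fin] T(2) sr by simp
    moreover have "col_weight k \<mu> = col_weight k \<nu> + \<Sum>T"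
    proof -
      have "col_weight k \<mu> = (\<Sum>t<k. t * col \<nu> t + (if t \<in> T then t else 0))"
        unfolding col_weight_def by (rule sum.cong) (auto simp: T(3))
      then show ?thesis using on_T[of "\<lambda>t. t"] by (simp add: sum.distrib col_weight_def)
    qed
    moreover have "col_weight k {#r#} = \<Sum>{..<r}"
    proof -
      have "col_weight k {#r#} = (\<Sum>t<k. if t \<in> {..<r} then t else 0)"
        unfolding col_weight_def by (rule sum.cong) auto
      also have "\<dots> = \<Sum>({..<k} \<inter> {..<r})" by (simp add: sum.If_cases lessThan_def)
      also have "{..<k} \<inter> {..<r} = {..<r}" using s by auto
      finally show ?thesis .
    qed
    ultimately show ?thesis using S sr \<mu>k col_weight_add[of k \<nu> "{#r#}"] by (simp add: lower_def)
  qed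
qed

text \<open>The statistic \<open>d\<close> is left free so that the families shifted by
  \<open>P\<close> and by \<open>Q\<close> can be placed under one and the same rule.\<close>

definition pieri :: "nat \<Rightarrow> (nat multiset \<Rightarrow> nat multiset \<Rightarrow> nat) \<Rightarrow> (nat multiset \<Rightarrow> symfun) \<Rightarrow> bool" where
  "pieri k d F \<longleftrightarrow> (\<forall>\<nu>\<in>k_bounded k. \<forall>r\<le>k. hsym r * F \<nu> =
    (\<Sum>s = 0..r. (- 1) ^ (r - s) * (\<Sum>\<mu>\<in>strips k s \<nu>. of_nat (d \<mu> \<nu> choose (r - s)) * F \<mu>)))"

text \<open>The term for \<open>\<nu> + {#r#}\<close> occurs with \<open>s = r\<close>, hence with
  sign and binomial coefficient 1, so the rule can be solved for it over the integers.\<close>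

lemma pieri_add_part:
  assumes F: "pieri k d F" and \<nu>: "\<nu> \<in> k_bounded k" and r: "1 \<le> r" "r \<le> k"
  shows "F (\<nu> + {#r#}) = hsym r * F \<nu> - (\<Sum>\<mu>\<in>strips k r \<nu> - {\<nu> + {#r#}}. F \<mu>) -
    (\<Sum>s<r. \<Sum>\<mu>\<in>strips k s \<nu>. of_int ((- 1) ^ (r - s) * int (d \<mu> \<nu> choose (r - s))) * F \<mu>)"
proof -
  define t where "t s = (- 1) ^ (r - s) * (\<Sum>\<mu>\<in>strips k s \<nu>. of_nat (d \<mu> \<nu> choose (r - s)) * F \<mu>)" for s
  have "hsym r * F \<nu> = (\<Sum>s = 0..r. t s)" using F \<nu> r unfolding pieri_def t_def by blast
  also have "\<dots> = (\<Sum>s<r. t s) + t r"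
    by (simp add: atLeast0AtMost lessThan_Suc_atMost[symmetric])
  also have "t r = (\<Sum>\<mu>\<in>strips k r \<nu>. F \<mu>)" by (simp add: t_def)
  also have "\<dots> = F (\<nu> + {#r#}) + (\<Sum>\<mu>\<in>strips k r \<nu> - {\<nu> + {#r#}}. F \<mu>)"
    by (rule sum.remove[OF finite_strips[OF \<nu> r(2)] strips_add[OF \<nu> r]])
  also have "(\<Sum>s<r. t s) =
    (\<Sum>s<r. \<Sum>\<mu>\<in>strips k s \<nu>. of_int ((- 1) ^ (r - s) * int (d \<mu> \<nu> choose (r - s))) * F \<mu>)"
    unfolding t_def by (simp add: sum_distrib_left mult.assoc)
  finally show ?thesis by simp
qed

lemma k_bounded_cases:
  assumes "\<theta> \<in> k_bounded k" "\<theta> \<noteq> {#}"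
  obtains \<nu> r where "\<theta> = \<nu> + {#r#}" "\<nu> \<in> k_bounded k" "1 \<le> r" "r \<le> k" "lower k \<nu> \<theta>"
proof -
  obtain r \<nu> where l: "\<theta> = add_mset r \<nu>" using assms(2) by (metis multiset_cases)
  then have "\<nu> \<in> k_bounded k" "1 \<le> r" "r \<le> k" using assms(1) by (auto simp: k_bounded_iff)
  then show ?thesis using that[of \<nu> r] l by (simp add: lower_def)
qed

text \<open>All other values in the recursion are at lower partitions, so the initial value
  determines the family; for a difference of two families this is uniqueness.\<close>

lemma pieri_eq_0:
  assumes F: "pieri k d F" and 0: "F {#} = 0" and \<theta>: "\<theta> \<in> k_bounded k"
  shows "F \<theta> = 0"
  using \<theta>
proof (induction rule: k_bounded_lower_induct)
  case (less \<theta>)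
  show ?case
  proof (cases "\<theta> = {#}")
    case False
    then obtain \<nu> r where l: "\<theta> = \<nu> + {#r#}" "\<nu> \<in> k_bounded k" "1 \<le> r" "r \<le> k" "lower k \<nu> \<theta>"
      using k_bounded_cases[OF less(1)] by metis
    have "F \<mu> = 0" if "\<mu> \<in> strips k r \<nu> - {\<nu> + {#r#}}" for \<mu>
      using strips_lower[OF l(2) order_refl l(3,4)] that less(2) l(1) by blast
    moreover have "F \<mu> = 0" if "\<mu> \<in> strips k s \<nu>" "s < r" for \<mu> s
      using strips_lower[OF l(2) _ l(3,4) that(1)] that(2) less(2) l(1) by simp
    moreover have "F \<nu> = 0" using less(2) l(5) by blast
    ultimately show ?thesis unfolding l(1) pieri_add_part[OF F l(2,3,4)] by simp
  qed (use 0 in simp)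
qed

text \<open>The integer span of the products over lower partitions. In this form closure properties
  are inductions; coefficients are needed only for the independence argument.\<close>

inductive_set lower_span :: "nat \<Rightarrow> nat multiset \<Rightarrow> symfun set" for k \<theta> where
  zero: "0 \<in> lower_span k \<theta>"
| step: "x \<in> lower_span k \<theta> \<Longrightarrow> lower k \<mu> \<theta> \<Longrightarrow> x + of_int c * hprod \<mu> \<in> lower_span k \<theta>"

lemma lower_span_hprod: "lower k \<mu> \<theta> \<Longrightarrow> hprod \<mu> \<in> lower_span k \<theta>"
  using lower_span.step[OF lower_span.zero, of k \<mu> \<theta> 1] by simp

lemma lower_span_add: "y \<in> lower_span k \<theta> \<Longrightarrow> x \<in> lower_span k \<theta> \<Longrightarrow> x + y \<in> lower_span k \<theta>"
  by (induction rule: lower_span.induct) (auto simp: add.assoc[symmetric] intro: lower_span.step)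

lemma lower_span_scale: "x \<in> lower_span k \<theta> \<Longrightarrow> of_int c * x \<in> lower_span k \<theta>"
proof (induction rule: lower_span.induct)
  case (step x \<mu> d)
  have "of_int c * (x + of_int d * hprod \<mu>) = of_int c * x + of_int (c * d) * hprod \<mu>"
    by (simp add: algebra_simps)
  then show ?case using lower_span.step[OF step(3,2)] by metis
qed (simp add: lower_span.zero)

lemma lower_span_diff:
  assumes "x \<in> lower_span k \<theta>" "y \<in> lower_span k \<theta>" shows "x - y \<in> lower_span k \<theta>"
  using lower_span_add[OF lower_span_scale[OF assms(2), of "-1"] assms(1)] by simp

lemma lower_span_sum: "(\<And>i. i \<in> A \<Longrightarrow> f i \<in> lower_span k \<theta>) \<Longrightarrow> sum f A \<in> lower_span k \<theta>"
  by (induction A rule: infinite_finite_induct) (auto intro: lower_span.zero lower_span_add)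

lemma lower_span_trans: "x \<in> lower_span k \<mu> \<Longrightarrow> lower k \<mu> \<theta> \<Longrightarrow> x \<in> lower_span k \<theta>"
  by (induction rule: lower_span.induct) (auto intro: lower_span.intros lower_trans)

lemma lower_span_mult:
  assumes "x \<in> lower_span k \<theta>" "1 \<le> r" "r \<le> k"
  shows "hsym r * x \<in> lower_span k (\<theta> + {#r#})"
  using assms(1)
proof induction
  case (step x \<mu> c)
  have "hsym r * (x + of_int c * hprod \<mu>) = hsym r * x + of_int c * hprod (\<mu> + {#r#})"
    unfolding hprod_add by (simp add: algebra_simps)
  then show ?case using lower_span.step[OF step(3) lower_add[OF step(2) assms(2,3)]] by metis
qed (simp add: lower_span.zero)

lemma lower_span_explicit:
  "x \<in> lower_span k \<theta> \<Longrightarrow> \<exists>A c. finite A \<and> A \<subseteq> {\<mu>. lower k \<mu> \<theta>} \<and> x = (\<Sum>\<mu>\<in>A. of_int (c \<mu>) * hprod \<mu>)"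
proof (induction rule: lower_span.induct)
  case zero
  then show ?case by (intro exI[of _ "{}"]) simp
next
  case (step x \<mu> d)
  then obtain A c where A: "finite A" "A \<subseteq> {\<mu>. lower k \<mu> \<theta>}" "x = (\<Sum>\<mu>\<in>A. of_int (c \<mu>) * hprod \<mu>)" by blast
  define c' where "c' \<nu> = (if \<nu> \<in> A then c \<nu> else 0) + (if \<nu> = \<mu> then d else 0)" for \<nu>
  have "(\<Sum>\<nu>\<in>insert \<mu> A. of_int (c' \<nu>) * hprod \<nu>) =
    (\<Sum>\<nu>\<in>insert \<mu> A. of_int (if \<nu> \<in> A then c \<nu> else 0) * hprod \<nu>) +
    (\<Sum>\<nu>\<in>insert \<mu> A. of_int (if \<nu> = \<mu> then d else 0) * hprod \<nu>)"
    by (simp add: c'_def sum.distrib[symmetric] distrib_right)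
  also have "(\<Sum>\<nu>\<in>insert \<mu> A. of_int (if \<nu> \<in> A then c \<nu> else 0) * hprod \<nu>) = x"
    unfolding A(3) by (rule sum.mono_neutral_cong_right) (use A(1) in auto)
  also have "(\<Sum>\<nu>\<in>insert \<mu> A. of_int (if \<nu> = \<mu> then d else 0) * hprod \<nu>) = (\<Sum>\<nu>\<in>{\<mu>}. of_int d * hprod \<nu>)"
    by (rule sum.mono_neutral_cong_right) (use A(1) in auto)
  finally have "x + of_int d * hprod \<mu> = (\<Sum>\<nu>\<in>insert \<mu> A. of_int (c' \<nu>) * hprod \<nu>)" by simp
  then show ?case using A step(2) by (intro exI[of _ "insert \<mu> A"] exI[of _ c']) auto
qed

text \<open>Multiplying the leading product at \<nu> by \<open>hsym r\<close> gives the one at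
  \<theta>; by \<open>strips_lower\<close> everything else in the recursion is lower, so the
  expansion is unitriangular.\<close>

lemma pieri_leading_term:
  assumes F: "pieri k d F" and 1: "F {#} = 1" and \<theta>: "\<theta> \<in> k_bounded k"
  shows "F \<theta> - hprod \<theta> \<in> lower_span k \<theta>"
  using \<theta>
proof (induction rule: k_bounded_lower_induct)
  case (less \<theta>)
  have low: "F \<mu> \<in> lower_span k \<theta>" if "lower k \<mu> \<theta>" for \<mu>
    using lower_span_add[OF lower_span_hprod[OF that] lower_span_trans[OF less(2)[OF that] that]] by simp
  show ?case
  proof (cases "\<theta> = {#}")
    case True
    then show ?thesis using 1 by (simp add: hprod_def lower_span.zero)
  next
    case False
    then obtain \<nu> r where l: "\<theta> = \<nu> + {#r#}" "\<nu> \<in> k_bounded k" "1 \<le> r" "r \<le> k" "lower k \<nu> \<theta>"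
      using k_bounded_cases[OF less(1)] by metis
    let ?A = "\<Sum>\<mu>\<in>strips k r \<nu> - {\<nu> + {#r#}}. F \<mu>"
    let ?B = "\<Sum>s<r. \<Sum>\<mu>\<in>strips k s \<nu>. of_int ((- 1) ^ (r - s) * int (d \<mu> \<nu> choose (r - s))) * F \<mu>"
    have A: "?A \<in> lower_span k \<theta>"
      using strips_lower[OF l(2) order_refl l(3,4)] l(1) by (intro lower_span_sum low) blast
    have "lower k \<mu> \<theta>" if "s < r" "\<mu> \<in> strips k s \<nu>" for s \<mu>
      unfolding l(1) using strips_lower[OF l(2) _ l(3,4) that(2)] that(1) by simp
    then have B: "?B \<in> lower_span k \<theta>"
      by (intro lower_span_sum lower_span_scale low) auto
    have C: "hsym r * (F \<nu> - hprod \<nu>) \<in> lower_span k \<theta>"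
      unfolding l(1) by (rule lower_span_mult[OF less(2)[OF l(5)] l(3,4)])
    have "F \<theta> - hprod \<theta> = hsym r * (F \<nu> - hprod \<nu>) - ?A - ?B"
      unfolding l(1) pieri_add_part[OF F l(2,3,4)] hprod_add by (simp add: right_diff_distrib)
    then show ?thesis using lower_span_diff[OF lower_span_diff[OF C A] B] by simp
  qed
qed

text \<open>The product at \<theta> has coefficient 1 and does not recur among the lower ones, so a
  vanishing value would contradict independence.\<close>

lemma pieri_nonzero:
  assumes F: "pieri k d F" and 1: "F {#} = 1" and \<theta>: "\<theta> \<in> k_bounded k"
  shows "F \<theta> \<noteq> 0"
proof
  assume z: "F \<theta> = 0"
  obtain A c where A: "finite A" "A \<subseteq> {\<mu>. lower k \<mu> \<theta>}" "F \<theta> - hprod \<theta> = (\<Sum>\<mu>\<in>A. of_int (c \<mu>) * hprod \<mu>)"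
    using lower_span_explicit[OF pieri_leading_term[OF assms]] by blast
  have nA: "\<theta> \<notin> A" using A(2) by (auto simp: lower_def)
  have "(\<Sum>\<mu>\<in>insert \<theta> A. of_int ((c(\<theta> := 1)) \<mu>) * hprod \<mu>) = hprod \<theta> + (\<Sum>\<mu>\<in>A. of_int ((c(\<theta> := 1)) \<mu>) * hprod \<mu>)"
    using A(1) nA by simp
  also have "(\<Sum>\<mu>\<in>A. of_int ((c(\<theta> := 1)) \<mu>) * hprod \<mu>) = (\<Sum>\<mu>\<in>A. of_int (c \<mu>) * hprod \<mu>)"
    using nA by (intro sum.cong) auto
  finally have "(\<Sum>\<mu>\<in>insert \<theta> A. of_int ((c(\<theta> := 1)) \<mu>) * hprod \<mu>) = 0"
    using A(3)[symmetric] z by simp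
  then have "(c(\<theta> := 1)) \<theta> = 0"
    using A \<theta> by (intro hprod_independent[of "insert \<theta> A" k]) (auto simp: lower_def)
  then show False by simp
qed

section \<open>Comparison of the families shifted by \<open>P\<close> and by
  \<open>Q\<close>\<close>

lemma pieri_shift:
  assumes g: "pieri k (\<lambda>\<mu> \<nu>. num_residues k (bounded_to_core k \<mu>) (bounded_to_core k \<nu>)) g"
    and P: "rect_shift k P \<sigma>"
  shows "pieri k (\<lambda>\<mu> \<nu>. num_residues k (bounded_to_core k (P + \<mu>)) (bounded_to_core k (P + \<nu>))) (\<lambda>\<nu>. g (P + \<nu>))"
  unfolding pieri_def
proof (intro ballI allI impI)
  fix \<nu> r assume \<nu>: "\<nu> \<in> k_bounded k" and r: "r \<le> k"
  have Pk: "P \<in> k_bounded k" using P by (simp add: rect_shift_def)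
  have "hsym r * g (P + \<nu>) = (\<Sum>s = 0..r. (- 1) ^ (r - s) * (\<Sum>\<xi>\<in>strips k s (P + \<nu>).
      of_nat (num_residues k (bounded_to_core k \<xi>) (bounded_to_core k (P + \<nu>)) choose (r - s)) * g \<xi>))"
    using g k_bounded_add[OF Pk \<nu>] r unfolding pieri_def by blast
  also have "\<dots> = (\<Sum>s = 0..r. (- 1) ^ (r - s) * (\<Sum>\<mu>\<in>strips k s \<nu>.
      of_nat (num_residues k (bounded_to_core k (P + \<mu>)) (bounded_to_core k (P + \<nu>)) choose (r - s)) * g (P + \<mu>)))"
  proof (rule sum.cong[OF refl])
    fix s assume "s \<in> {0..r}"
    then have s: "s \<le> k" using r by simp
    have inj: "inj_on ((+) P) (strips k s \<nu>)" by (auto intro: inj_onI)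
    show "(- 1) ^ (r - s) * (\<Sum>\<xi>\<in>strips k s (P + \<nu>).
        of_nat (num_residues k (bounded_to_core k \<xi>) (bounded_to_core k (P + \<nu>)) choose (r - s)) * g \<xi>) =
      (- 1) ^ (r - s) * (\<Sum>\<mu>\<in>strips k s \<nu>.
        of_nat (num_residues k (bounded_to_core k (P + \<mu>)) (bounded_to_core k (P + \<nu>)) choose (r - s)) * g (P + \<mu>))"
      unfolding strips_shift[OF \<nu> P s] sum.reindex[OF inj] by simp
  qed
  finally show "hsym r * g (P + \<nu>) = (\<Sum>s = 0..r. (- 1) ^ (r - s) * (\<Sum>\<mu>\<in>strips k s \<nu>.
      of_nat (num_residues k (bounded_to_core k (P + \<mu>)) (bounded_to_core k (P + \<nu>)) choose (r - s)) * g (P + \<mu>)))" .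
qed

lemma pieri_linear:
  assumes "pieri k d F" "pieri k d G"
  shows "pieri k d (\<lambda>\<nu>. F \<nu> * x - G \<nu> * y)"
  unfolding pieri_def
proof (intro ballI allI impI)
  fix \<nu> r assume h: "\<nu> \<in> k_bounded k" "r \<le> k"
  have "hsym r * (F \<nu> * x - G \<nu> * y) = (hsym r * F \<nu>) * x - (hsym r * G \<nu>) * y"
    by (simp add: algebra_simps)
  also have "\<dots> = (\<Sum>s = 0..r. (- 1) ^ (r - s) * (\<Sum>\<mu>\<in>strips k s \<nu>. of_nat (d \<mu> \<nu> choose (r - s)) * F \<mu>)) * x
    - (\<Sum>s = 0..r. (- 1) ^ (r - s) * (\<Sum>\<mu>\<in>strips k s \<nu>. of_nat (d \<mu> \<nu> choose (r - s)) * G \<mu>)) * y"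
    using assms h unfolding pieri_def by simp
  also have "\<dots> = (\<Sum>s = 0..r. (- 1) ^ (r - s) * (\<Sum>\<mu>\<in>strips k s \<nu>. of_nat (d \<mu> \<nu> choose (r - s)) * (F \<mu> * x - G \<mu> * y)))"
    by (simp add: sum_distrib_right right_diff_distrib sum_subtractf mult.assoc)
  finally show "hsym r * (F \<nu> * x - G \<nu> * y) = (\<Sum>s = 0..r. (- 1) ^ (r - s) *
    (\<Sum>\<mu>\<in>strips k s \<nu>. of_nat (d \<mu> \<nu> choose (r - s)) * (F \<mu> * x - G \<mu> * y)))" .
qed

lemma pieri_cong:
  assumes "pieri k d F" "\<And>s \<mu> \<nu>. \<nu> \<in> k_bounded k \<Longrightarrow> s \<le> k \<Longrightarrow> \<mu> \<in> strips k s \<nu> \<Longrightarrow> d \<mu> \<nu> = d' \<mu> \<nu>"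
  shows "pieri k d' F"
  unfolding pieri_def
proof (intro ballI allI impI)
  fix \<nu> r assume h: "\<nu> \<in> k_bounded k" "r \<le> k"
  have "hsym r * F \<nu> = (\<Sum>s = 0..r. (- 1) ^ (r - s) * (\<Sum>\<mu>\<in>strips k s \<nu>. of_nat (d \<mu> \<nu> choose (r - s)) * F \<mu>))"
    using assms(1) h unfolding pieri_def by blast
  also have "\<dots> = (\<Sum>s = 0..r. (- 1) ^ (r - s) * (\<Sum>\<mu>\<in>strips k s \<nu>. of_nat (d' \<mu> \<nu> choose (r - s)) * F \<mu>))"
  proof (intro sum.cong refl arg_cong2[of _ _ _ _ "(*)"])
    fix s \<mu> assume "s \<in> {0..r}" "\<mu> \<in> strips k s \<nu>"
    then have "d \<mu> \<nu> = d' \<mu> \<nu>" using assms(2)[OF h(1), of s \<mu>] h(2) by simp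
    then show "of_nat (d \<mu> \<nu> choose (r - s)) = (of_nat (d' \<mu> \<nu> choose (r - s)) :: symfun)" by simp
  qed
  finally show "hsym r * F \<nu> = (\<Sum>s = 0..r. (- 1) ^ (r - s) * (\<Sum>\<mu>\<in>strips k s \<nu>. of_nat (d' \<mu> \<nu> choose (r - s)) * F \<mu>))" .
qed

theorem theorem3p6:
  fixes k m :: nat
    and t a :: "nat \<Rightarrow> nat"
    and P Q \<nu> :: "nat multiset"
    and g :: "nat multiset \<Rightarrow> symfun"
  assumes "k \<ge> 1" and "m \<ge> 1"
    and "\<And>i. i \<in> {1..m} \<Longrightarrow> 1 \<le> t i \<and> t i \<le> k"
    and "inj_on t {1..m}"
    and "\<And>i. i \<in> {1..m} \<Longrightarrow> a i > 0"
    and "P = (\<Sum>i = 1..m. repeat_mset (a i) (rect k (t i)))"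
    and "Q = (\<Sum>i = 1..m. rect k (t i))"
    and "K_k_Schur k g"
    and "\<nu> \<in> k_bounded k"
  shows "Fract (g (P + \<nu>)) (g P) = Fract (g (Q + \<nu>)) (g Q)"
proof -
  define \<tau> :: "nat \<Rightarrow> nat \<Rightarrow> int" where "\<tau> i q = (if t i \<le> q then 1 else 0)" for i q
  define \<sigma> where "\<sigma> q = (\<Sum>i\<in>{1..m}. int (a i) * \<tau> i q)" for q
  define \<rho> where "\<rho> q = (\<Sum>i\<in>{1..m}. \<tau> i q)" for q
  have \<tau>: "rect_shift k (rect k (t i)) (\<tau> i)" if "i \<in> {1..m}" for i
    unfolding \<tau>_def using rect_shift_rect assms(3)[OF that] by blast
  have P: "rect_shift k P \<sigma>" unfolding assms(6) \<sigma>_def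
    by (rule rect_shift_sum) (use rect_shift_repeat[OF \<tau>] in auto)
  have Q: "rect_shift k Q \<rho>" unfolding assms(7) \<rho>_def
    by (rule rect_shift_sum) (auto intro: \<tau>)
  have Pk: "P \<in> k_bounded k" and Qk: "Q \<in> k_bounded k" using P Q by (auto simp: rect_shift_def)
  \<comment> \<open>\<sigma> and \<rho> are positive combinations of the same step functions. Their
    increment from \<open>p\<close> to \<open>q \<ge> p\<close> is a sum of nonnegative terms and
    vanishes iff each step function is constant between the two.\<close>
  have pattern: "\<sigma> p = \<sigma> q \<longleftrightarrow> \<rho> p = \<rho> q" for p q
  proof -
    have w: "(\<Sum>i\<in>{1..m}. int (c i) * \<tau> i p) = (\<Sum>i\<in>{1..m}. int (c i) * \<tau> i q) \<longleftrightarrow>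
        (\<forall>i\<in>{1..m}. \<tau> i p = \<tau> i q)"
      if "p \<le> q" "\<And>i. i \<in> {1..m} \<Longrightarrow> 0 < c i" for p q c
    proof -
      have mono: "\<tau> i p \<le> \<tau> i q" for i using that(1) by (simp add: \<tau>_def)
      have "(\<Sum>i\<in>{1..m}. int (c i) * \<tau> i p) = (\<Sum>i\<in>{1..m}. int (c i) * \<tau> i q) \<longleftrightarrow>
          (\<Sum>i\<in>{1..m}. int (c i) * (\<tau> i q - \<tau> i p)) = 0"
        by (auto simp: right_diff_distrib sum_subtractf)
      also have "\<dots> \<longleftrightarrow> (\<forall>i\<in>{1..m}. int (c i) * (\<tau> i q - \<tau> i p) = 0)"
        using mono by (intro sum_nonneg_eq_0_iff) auto
      also have "\<dots> \<longleftrightarrow> (\<forall>i\<in>{1..m}. \<tau> i p = \<tau> i q)" 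
      proof (intro ball_cong refl)
        fix i assume "i \<in> {1..m}"
        then have "c i \<noteq> 0" using that(2) by force
        then show "int (c i) * (\<tau> i q - \<tau> i p) = 0 \<longleftrightarrow> \<tau> i p = \<tau> i q" by auto
      qed
      finally show ?thesis .
    qed
    have "\<sigma> p = \<sigma> q \<longleftrightarrow> \<rho> p = \<rho> q" if "p \<le> q" for p q
      using w[OF that, of a] w[OF that, of "\<lambda>_. 1"] assms(5) unfolding \<sigma>_def \<rho>_def by simp
    then show ?thesis by (metis nle_le)
  qed
  let ?d = "\<lambda>X \<mu> \<nu>. num_residues k (bounded_to_core k (X + \<mu>)) (bounded_to_core k (X + \<nu>))"
  have g: "pieri k (\<lambda>\<mu> \<nu>. num_residues k (bounded_to_core k \<mu>) (bounded_to_core k \<nu>)) g" and g1: "g {#} = 1"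
    using assms(8) unfolding K_k_Schur_def pieri_def strips_def by auto
  have FP: "pieri k (?d P) (\<lambda>\<nu>. g (P + \<nu>))" by (rule pieri_shift[OF g P])
  \<comment> \<open>Exchanges the statistic of \<open>Q\<close> for that of \<open>P\<close>, so
    that the two families can be subtracted.\<close>
  have "pieri k (?d P) (\<lambda>\<nu>. g (Q + \<nu>))"
    by (rule pieri_cong[OF pieri_shift[OF g Q]]) (rule num_residues_shift[OF _ _ _ Q P], use pattern in auto)
  then have "pieri k (?d P) (\<lambda>\<nu>. g (P + \<nu>) * g Q - g (Q + \<nu>) * g P)"
    by (rule pieri_linear[OF FP])
  \<comment> \<open>At the empty partition the difference is \<open>g P * g Q - g Q * g P\<close>,
    which is zero by commutativity.\<close>
  then have "g (P + \<nu>) * g Q - g (Q + \<nu>) * g P = 0"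
    by (rule pieri_eq_0) (use assms(9) in \<open>auto simp: mult.commute\<close>)
  moreover have "g P \<noteq> 0" "g Q \<noteq> 0" using pieri_nonzero[OF g g1] Pk Qk by auto
  ultimately show ?thesis by (simp add: eq_fract)
qed

end
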